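(* Let $\Delta$ be a flag simplicial $3$-manifold on $n$ vertices. Then $f_i(\Delta)\leq f_i(J_2(n))$ for every $i$. If equality holds for some $1\leq i\leq 3$, then $\Delta=J_2(n)$.
   Context: A simplicial complex is flag if every minimal non-face has exactly two elements (equivalently, it is the clique complex of its graph). A simplicial $3$-manifold is a simplicial complex whose geometric realization is homeomorphic to a $3$-dimensional manifold. $f_i$ denotes the number of $i$-dimensional faces. $J_2(n)$ is the $3$-sphere on $n$ vertices obtained as the join of two cycles (circles) with $\lfloor n/2\rfloor$ and $\lceil n/2\rceil$ vertices respectively. *)

theory Defs
  imports "HOL-Analysis.Analysis"
begin

text \<open>Finite abstract simplicial complexes, given by their sets of faces; the empty set is always
  a face, and the vertex set is the union of all faces (so every vertex is a face).\<close>

definition simplicial_complex :: "'a set set \<Rightarrow> bool" where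
  "simplicial_complex K \<longleftrightarrow>
     finite K \<and> K \<noteq> {} \<and> (\<forall>F\<in>K. finite F) \<and> (\<forall>F\<in>K. \<forall>G. G \<subseteq> F \<longrightarrow> G \<in> K)"

definition vertices :: "'a set set \<Rightarrow> 'a set" where
  "vertices K = \<Union>K"

definition minimal_nonface :: "'a set set \<Rightarrow> 'a set \<Rightarrow> bool" where
  "minimal_nonface K F \<longleftrightarrow> F \<subseteq> vertices K \<and> F \<notin> K \<and> (\<forall>G. G \<subset> F \<longrightarrow> G \<in> K)"

definition flag_complex :: "'a set set \<Rightarrow> bool" where
  "flag_complex K \<longleftrightarrow> simplicial_complex K \<and> (\<forall>F. minimal_nonface K F \<longrightarrow> card F = 2)"

text \<open>The index is an integer because the empty face has dimension \<open>-1\<close>.\<close>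

definition face_number :: "'a set set \<Rightarrow> int \<Rightarrow> nat" where
  "face_number K i = card {F \<in> K. int (card F) = i + 1}"

text \<open>Points of the geometric realization are given by their barycentric coordinates. As the complex
  is finite, the topology of pointwise convergence is the usual topology of the realization.\<close>

definition geometric_realization :: "'a set set \<Rightarrow> ('a \<Rightarrow> real) topology" where
  "geometric_realization K =
     subtopology (powertop_real UNIV)
       {x. (\<forall>v. 0 \<le> x v) \<and> {v. x v \<noteq> 0} \<in> K \<and> (\<Sum>v\<in>vertices K. x v) = 1}"

definition second_countable_space :: "'a topology \<Rightarrow> bool" where
  "second_countable_space X \<longleftrightarrow>
     (\<exists>B. countable B \<and> openin X = arbitrary union_of (\<lambda>U. U \<in> B))"

text \<open>Manifolds are without boundary, and they are not assumed to be connected.\<close>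

definition topological_manifold :: "nat \<Rightarrow> 'a topology \<Rightarrow> bool" where
  "topological_manifold d X \<longleftrightarrow>
     Hausdorff_space X \<and> second_countable_space X \<and>
     (\<forall>x\<in>topspace X. \<exists>U V. openin X U \<and> x \<in> U \<and> openin (Euclidean_space d) V \<and>
        subtopology X U homeomorphic_space subtopology (Euclidean_space d) V)"

text \<open>Being a manifold is invariant under homeomorphism, so a space homeomorphic to a manifold is
  one itself.\<close>

definition simplicial_manifold :: "nat \<Rightarrow> 'a set set \<Rightarrow> bool" where
  "simplicial_manifold d K \<longleftrightarrow>
     simplicial_complex K \<and> topological_manifold d (geometric_realization K)"

definition simplicial_isomorphic :: "'a set set \<Rightarrow> 'b set set \<Rightarrow> bool" where
  "simplicial_isomorphic K L \<longleftrightarrow>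
     (\<exists>f. bij_betw f (vertices K) (vertices L) \<and> (\<lambda>F. f ` F) ` K = L)"

definition simplicial_join :: "'a set set \<Rightarrow> 'b set set \<Rightarrow> ('a + 'b) set set" where
  "simplicial_join K L = {F <+> G |F G. F \<in> K \<and> G \<in> L}"

text \<open>A circle with \<open>k\<close> vertices if \<open>k \<ge> 3\<close>; smaller \<open>k\<close> give degenerate values.\<close>

definition cycle_complex :: "nat \<Rightarrow> nat set set" where
  "cycle_complex k = {{}} \<union> {{i} |i. i < k} \<union> {{i, Suc i mod k} |i. i < k}"

definition J2 :: "nat \<Rightarrow> (nat + nat) set set" where
  "J2 n = simplicial_join (cycle_complex (nat \<lfloor>real n / 2\<rfloor>)) (cycle_complex (nat \<lceil>real n / 2\<rceil>))"

end

theory Submission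
  imports Defs
begin

text \<open>Let \<open>f\<^sub>1\<close> be the number of edges and \<open>d(v)\<close> the degree of a vertex. Every vertex link is a
  triangulated 2-sphere, so it has \<open>2 d(v) - 4\<close> triangles, and hence there are \<open>f\<^sub>1 - n\<close>
  tetrahedra. By flagness no vertex is adjacent to all of a tetrahedron \<open>\<sigma>\<close>, and exactly eight are
  adjacent to three of its vertices, so the degrees of the vertices of \<open>\<sigma>\<close> add up to at most
  \<open>2 n + 8\<close>. Summing over all tetrahedra and using Cauchy-Schwarz gives \<open>4 f\<^sub>1 \<le> n\<^sup>2 + 4 n\<close>.
  In the extremal case every vertex is adjacent to at least two vertices of every tetrahedron. Given an
  edge with a longest possible link cycle \<open>C\<close>, this forces every vertex outside \<open>C\<close> to be adjacent to
  all of \<open>C\<close>, and the manifold is the join of \<open>C\<close> with the link of an edge of \<open>C\<close>.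

  Of the topology only two things are used. Invariance of domain at the barycentres of faces shows that
  the complex is pure and that each triangle lies in exactly two tetrahedra. For the links, a \<open>\<int>/2\<close>-valued
  1-cocycle on the link of a vertex (or of the midpoint of an edge) defines a double cover of a punctured
  chart ball; this ball is simply connected, so the cocycle is a coboundary. Thus \<open>H\<^sup>1\<close> of a vertex link
  vanishes, which determines its Euler characteristic.\<close>

section \<open>Charts of the geometric realization\<close>

text \<open>The number eight arises because each of the four triangles of a tetrahedron has exactly
  two common neighbours, and these four pairs are disjoint. Cauchy-Schwarz is carried out as an
  exact identity for the squares of 2 d(v) - (n + 4); here n / 2 + 2 is the degree in the join of
  two equally long cycles. For odd n the target leaves a slack of 1, but then every one of these
  squares is odd, hence at least 1, so the error terms vanish in the extremal case as well.

  In an extremal graph the cycle C = lk(uv) splits the sphere lk(u) into the star of v and a far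
  side. The far side spans no triangle and has one edge fewer than vertices, so some vertex there
  has at most one far neighbour. If it has none, it is adjacent to all of C; if it has one, C cannot
  have five or more vertices. Hence the length of C is used only through a dichotomy: either C has
  at least five vertices, or every link cycle has exactly four and all vertex links have six
  vertices.\<close>

definition realize :: "'a set set \<Rightarrow> ('a \<Rightarrow> real) set" where
  "realize K = {x. (\<forall>v. 0 \<le> x v) \<and> {v. x v \<noteq> 0} \<in> K \<and> (\<Sum>v\<in>vertices K. x v) = 1}"

lemma geometric_realization_eq: "geometric_realization K = top_of_set (realize K)"
  by (simp add: geometric_realization_def realize_def euclidean_product_topology)

text \<open>\<open>Euclidean_space 3\<close> consists of sequences that vanish from index 3 on.
  Invariance of domain and simple connectedness are applied to a Euclidean type instead, so charts
  are moved to triples of reals.\<close>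

lemma homeomorphic_maps_Euclidean_space_3:
  "homeomorphic_maps (Euclidean_space 3) euclidean (\<lambda>z. (z 0, z 1, z 2))
     (\<lambda>(a, b, c) i. if i = 0 then a else if i = 1 then b else if i = 2 then c else (0::real))"
proof -
  have *: "Euclidean_space 3 = top_of_set {z::nat \<Rightarrow> real. \<forall>i\<ge>3. z i = 0}"
    by (simp add: Euclidean_space_def euclidean_product_topology)
  have "continuous_on UNIV (\<lambda>(a, b, c) i. if i = (0::nat) then a else if i = 1 then b else if i = 2 then c else (0::real))"
  proof (rule continuous_on_coordinatewise_then_product)
    fix i :: nat
    consider "i = 0" | "i = 1" | "i = 2" | "i \<ge> 3" by linarith
    then show "continuous_on UNIV (\<lambda>x. (case x of (a, b, c) \<Rightarrow> \<lambda>i. if i = 0 then a else if i = 1 then b else if i = 2 then c else (0::real)) i)"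
      by cases (auto simp: case_prod_beta intro!: continuous_intros)
  qed
  moreover have "(\<lambda>(a, b, c) i. if i = (0::nat) then a else if i = 1 then b else if i = 2 then c else (0::real)) (z 0, z 1, z 2) = z"
    if "\<forall>i\<ge>3. z i = 0" for z
  proof
    fix i :: nat
    consider "i = 0" | "i = 1" | "i = 2" | "i \<ge> 3" by linarith
    then show "(\<lambda>(a, b, c) i. if i = (0::nat) then a else if i = 1 then b else if i = 2 then c else (0::real)) (z 0, z 1, z 2) i = z i"
      by cases (simp_all add: that)
  qed
  moreover have "continuous_on {z::nat \<Rightarrow> real. \<forall>i\<ge>3. z i = 0} (\<lambda>z. (z 0, z 1, z 2))"
    by (intro continuous_on_Pair continuous_on_subset[OF continuous_on_product_coordinates] subset_UNIV)
  ultimately show ?thesis unfolding homeomorphic_maps_def *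
    by (simp add: continuous_map_in_subtopology case_prod_beta)
qed

text \<open>A chart can be shrunk until its domain is a round ball and its image lies in a
  prescribed neighbourhood \<open>W\<close>. The ball is what later makes the punctured chart simply
  connected.\<close>

lemma manifold3_chart:
  fixes S :: "'b::topological_space set"
  assumes man: "topological_manifold 3 (top_of_set S)" and x: "x \<in> S"
    and W: "openin (top_of_set S) W" "x \<in> W"
  obtains p :: "real \<times> real \<times> real" and e g g' where
    "0 < e" "g p = x" "homeomorphism (ball p e) (g ` ball p e) g g'"
    "openin (top_of_set S) (g ` ball p e)" "g ` ball p e \<subseteq> W"
proof -
  obtain U V where U: "openin (top_of_set S) U" "x \<in> U" and V: "openin (Euclidean_space 3) V"
    and "subtopology (top_of_set S) U homeomorphic_space subtopology (Euclidean_space 3) V"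
    using man x unfolding topological_manifold_def by force
  then obtain f f' where f: "homeomorphic_maps (subtopology (top_of_set S) U) (subtopology (Euclidean_space 3) V) f f'"
    unfolding homeomorphic_space_def by blast
  have US: "subtopology (top_of_set S) U = top_of_set U"
    using U by (simp add: openin_imp_subset subtopology_subtopology inf.absorb2)
  let ?t = "\<lambda>z::nat\<Rightarrow>real. (z 0, z 1, z 2)"
  let ?t' = "\<lambda>(a, b, c) i. if i = (0::nat) then a else if i = 1 then b else if i = 2 then c else (0::real)"
  have t: "homeomorphic_maps (subtopology (Euclidean_space 3) V) (top_of_set (?t ` V)) ?t ?t'"
    by (rule homeomorphic_maps_subtopologies[OF homeomorphic_maps_Euclidean_space_3])
       (use V in \<open>auto dest!: openin_subset\<close>)
  have "open (?t ` V)"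
  proof -
    have "homeomorphic_map (Euclidean_space 3) (euclidean::(real \<times> real \<times> real) topology) ?t"
      using homeomorphic_maps_Euclidean_space_3 unfolding homeomorphic_maps_map by (rule conjunct1)
    then have "open_map (Euclidean_space 3) (euclidean::(real \<times> real \<times> real) topology) ?t"
      by (rule homeomorphic_imp_open_map)
    with V show ?thesis unfolding open_map_def by (intro open_openin[THEN iffD2]) auto
  qed
  define G where "G = ?t \<circ> f"
  define G' where "G' = f' \<circ> ?t'"
  define D where "D = ?t ` V"
  have oD: "open D" unfolding D_def by fact
  have "homeomorphic_maps (top_of_set U) (top_of_set D) G G'"
    unfolding D_def G_def G'_def by (rule homeomorphic_maps_compose[OF conjI[OF f[unfolded US] t]])
  then have h: "homeomorphism U D G G'"
    unfolding homeomorphic_maps_def by (intro homeomorphismI) (auto simp: continuous_map_in_subtopology image_subset_iff Pi_iff)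
  define W' where "W' = U \<inter> W"
  have W': "openin (top_of_set S) W'" "W' \<subseteq> U" "x \<in> W'" using U W by (auto simp: W'_def)
  have "openin (top_of_set U) W'"
    using W' U openin_imp_subset[OF U(1)] by (intro openin_subset_trans[OF W'(1)])
  then have "openin (top_of_set D) (G ` W')" using h homeomorphism_imp_open_map by blast
  then have oW: "open (G ` W')" using oD openin_open_eq by blast
  then obtain e where e: "e > 0" "ball (G x) e \<subseteq> G ` W'"
    using W' open_contains_ball[of "G ` W'"] by auto
  have sub: "G' ` ball (G x) e \<subseteq> W'"
  proof -
    have "G' (G w) = w" if "w \<in> W'" for w using homeomorphism_apply1[OF h] W'(2) that by auto
    then have "G' ` (G ` W') = W'" by (simp add: image_image)
    then show ?thesis using image_mono[OF e(2), of G'] by simp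
  qed
  have bV: "ball (G x) e \<subseteq> D"
  proof -
    have "G ` W' \<subseteq> D" using image_mono[OF W'(2), of G] homeomorphism_image1[OF h] by simp
    with e(2) show ?thesis by (rule order_trans)
  qed
  have h': "homeomorphism D U G' G" using h homeomorphism_symD by blast
  show ?thesis
  proof
    show "0 < e" by fact
    show "G' (G x) = x" using homeomorphism_apply1[OF h] U by simp
    show "homeomorphism (ball (G x) e) (G' ` ball (G x) e) G' G"
      by (rule homeomorphism_of_subsets[OF h' bV order_refl refl])
    have "openin (top_of_set D) (ball (G x) e)" using bV by (simp add: open_subset)
    then have "openin (top_of_set U) (G' ` ball (G x) e)"
      by (rule homeomorphism_imp_open_map[OF h'])
    then show "openin (top_of_set S) (G' ` ball (G x) e)" using U(1) by (rule openin_trans)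
    show "G' ` ball (G x) e \<subseteq> W" using sub by (auto simp: W'_def)
  qed
qed

text \<open>Openness is local, and near each image point the inverse of a chart turns
  \<open>f\<close> into an injective map between subsets of 3-space, where Brouwer's theorem
  applies.\<close>

lemma manifold3_invariance_of_domain:
  fixes S :: "'b::topological_space set" and f :: "real \<times> real \<times> real \<Rightarrow> 'b"
  assumes man: "topological_manifold 3 (top_of_set S)"
    and "open Z" "continuous_on Z f" "inj_on f Z" "f ` Z \<subseteq> S"
  shows "openin (top_of_set S) (f ` Z)"
proof (subst openin_subopen, intro ballI)
  fix x assume "x \<in> f ` Z"
  then obtain z where z: "z \<in> Z" "x = f z" by blast
  obtain p :: "real \<times> real \<times> real" and e g g' where g:
    "0 < e" "g p = x" "homeomorphism (ball p e) (g ` ball p e) g g'"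
    "openin (top_of_set S) (g ` ball p e)"
  proof (rule manifold3_chart[OF man])
    show "x \<in> S" "x \<in> S" using z assms(5) by auto
    show "openin (top_of_set S) S" by simp
  qed
  define Y where "Y = Z \<inter> f -` (g ` ball p e)"
  have "openin (top_of_set Z) Y" unfolding Y_def
    by (rule continuous_openin_preimage[OF assms(3) _ g(4)]) (use assms in auto)
  then have Y: "open Y" "Y \<subseteq> Z" using \<open>open Z\<close> openin_open_eq by (auto simp: Y_def)
  have gg: "g' (g q) = q" if "q \<in> ball p e" for q using that g(3) homeomorphism_apply1 by blast
  have sub: "f y \<in> g ` ball p e" if "y \<in> Y" for y using that by (auto simp: Y_def)
  have cg': "continuous_on (g ` ball p e) g'" using g(3) unfolding homeomorphism_def by blast
  have "open ((g' \<circ> f) ` Y)"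
  proof (rule invariance_of_domain)
    show "continuous_on Y (g' \<circ> f)"
      using cg' assms(3) Y sub by (intro continuous_on_compose) (auto intro: continuous_on_subset)
    show "inj_on (g' \<circ> f) Y"
    proof (rule inj_onI)
      fix a b assume ab: "a \<in> Y" "b \<in> Y" "(g' \<circ> f) a = (g' \<circ> f) b"
      then have "f a = f b" using sub[of a] sub[of b] gg by auto
      then show "a = b" using ab Y assms(4) by (auto dest: inj_onD)
    qed
  qed fact
  moreover have subb: "(g' \<circ> f) ` Y \<subseteq> ball p e" using sub gg by force
  ultimately have "openin (top_of_set (ball p e)) ((g' \<circ> f) ` Y)" by (simp add: open_subset)
  then have "openin (top_of_set (g ` ball p e)) (g ` ((g' \<circ> f) ` Y))"
    using homeomorphism_imp_open_map[OF g(3)] by blast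
  then have "openin (top_of_set S) (g ` ((g' \<circ> f) ` Y))" using g(4) openin_trans by blast
  moreover have "g ` ((g' \<circ> f) ` Y) = f ` Y" using sub gg by (force simp: image_iff)
  moreover have "x \<in> f ` Y"
  proof -
    have "g p \<in> g ` ball p e" using g(1) by (intro imageI) simp
    then show ?thesis using z g(2) by (auto simp: Y_def)
  qed
  ultimately show "\<exists>T. openin (top_of_set S) T \<and> x \<in> T \<and> T \<subseteq> f ` Z" using Y by (metis image_mono)
qed

text \<open>The counterpart of \<open>manifold3_invariance_of_domain\<close> with the manifold as
  the source. It prevents a neighbourhood in the manifold from being mapped injectively into a half
  space.\<close>

lemma manifold3_open_image:
  fixes S :: "'b::topological_space set" and f :: "'b \<Rightarrow> real \<times> real \<times> real"
  assumes man: "topological_manifold 3 (top_of_set S)"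
    and W: "openin (top_of_set S) W" and f: "continuous_on W f" "inj_on f W" "x \<in> W"
  obtains O' where "open O'" "f x \<in> O'" "O' \<subseteq> f ` W"
proof -
  have "x \<in> S" using W f openin_imp_subset by blast
  then obtain p :: "real \<times> real \<times> real" and e g g' where g:
    "0 < e" "g p = x" "homeomorphism (ball p e) (g ` ball p e) g g'"
    "g ` ball p e \<subseteq> W" by (rule manifold3_chart[OF man _ W f(3)])
  have "open ((f \<circ> g) ` ball p e)"
  proof (rule invariance_of_domain)
    show "continuous_on (ball p e) (f \<circ> g)"
      using g f unfolding homeomorphism_def by (intro continuous_on_compose) (auto intro: continuous_on_subset)
    have "inj_on g (ball p e)" using g(3) by (metis homeomorphism_def inj_on_inverseI)
    then show "inj_on (f \<circ> g) (ball p e)" using f(2) g(4) comp_inj_on inj_on_subset by blast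
  qed simp
  moreover have "f x \<in> (f \<circ> g) ` ball p e" using g by (auto simp: image_iff intro!: bexI[of _ p])
  ultimately show thesis using that g(4) by (metis image_comp image_mono)
qed

section \<open>Faces, barycentres and open stars of the realization\<close>

locale simplicial_3manifold =
  fixes K :: "'a set set"
  assumes sc: "simplicial_complex K"
    and man: "topological_manifold 3 (top_of_set (realize K))"
begin

lemma finite_vertices: "finite (vertices K)"
  using sc by (auto simp: simplicial_complex_def vertices_def)

lemma face_subset: "F \<in> K \<Longrightarrow> G \<subseteq> F \<Longrightarrow> G \<in> K"
  using sc by (auto simp: simplicial_complex_def)

lemma finite_face: "F \<in> K \<Longrightarrow> finite F"
  using sc by (auto simp: simplicial_complex_def)

lemma face_in_vertices: "F \<in> K \<Longrightarrow> F \<subseteq> vertices K"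
  by (auto simp: vertices_def)

lemma realizeD:
  assumes "x \<in> realize K"
  shows "0 \<le> x v" "{v. x v \<noteq> 0} \<in> K" "(\<Sum>v\<in>vertices K. x v) = 1"
  using assms by (auto simp: realize_def)

lemma realizeI:
  assumes "\<And>v. 0 \<le> x v" "\<And>v. v \<notin> F \<Longrightarrow> x v = 0" "F \<in> K" "(\<Sum>v\<in>F. x v) = 1"
  shows "x \<in> realize K"
proof -
  have "(\<Sum>v\<in>vertices K. x v) = (\<Sum>v\<in>F. x v)"
    using assms face_in_vertices finite_vertices by (intro sum.mono_neutral_right) auto
  moreover have "{v. x v \<noteq> 0} \<subseteq> F" using assms by auto
  ultimately show ?thesis using assms face_subset by (auto simp: realize_def)
qed

lemma realize_segment:
  assumes x: "x \<in> realize K" and y: "y \<in> realize K"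
    and F: "{v. x v \<noteq> 0} \<union> {v. y v \<noteq> 0} \<in> K" and e: "0 \<le> e" "e \<le> 1"
  shows "(\<lambda>v. (1 - e) * x v + e * y v) \<in> realize K"
proof (rule realizeI[OF _ _ F])
  have sum: "(\<Sum>v\<in>{v. x v \<noteq> 0} \<union> {v. y v \<noteq> 0}. z v) = 1"
    if z: "z \<in> realize K" "{v. z v \<noteq> 0} \<subseteq> {v. x v \<noteq> 0} \<union> {v. y v \<noteq> 0}" for z
  proof -
    have "(\<Sum>v\<in>{v. x v \<noteq> 0} \<union> {v. y v \<noteq> 0}. z v) = (\<Sum>v\<in>vertices K. z v)"
      using z face_in_vertices[OF F] finite_vertices by (intro sum.mono_neutral_left) auto
    then show ?thesis using realizeD[OF z(1)] by simp
  qed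
  show "(\<Sum>v\<in>{v. x v \<noteq> 0} \<union> {v. y v \<noteq> 0}. (1 - e) * x v + e * y v) = 1"
    using sum[OF x] sum[OF y] by (simp add: sum.distrib flip: sum_distrib_left)
qed (use e realizeD[OF x] realizeD[OF y] in auto)

text \<open>The segment starts inside \<open>G\<close>, so by continuity a short positive piece
  stays inside. This allows moving off \<open>x\<close> and enlarging the support without leaving
  \<open>G\<close>.\<close>

lemma segment_meets_open:
  assumes G: "openin (top_of_set (realize K)) G" "x \<in> G"
    and y: "y \<in> realize K" and F: "{v. x v \<noteq> 0} \<union> {v. y v \<noteq> 0} \<in> K"
  obtains e where "0 < e" "e \<le> 1" "(\<lambda>v. (1 - e) * x v + e * y v) \<in> G"
proof -
  let ?f = "\<lambda>(e::real) v. (1 - e) * x v + e * y v"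
  have x: "x \<in> realize K" using G openin_imp_subset by blast
  have "continuous_on {0..1} ?f"
    by (intro continuous_on_coordinatewise_then_product continuous_intros)
  then have "openin (top_of_set {0..1}) ({0..1} \<inter> ?f -` G)"
    by (rule continuous_openin_preimage[OF _ _ G(1)]) (use realize_segment[OF x y F] in auto)
  moreover have "0 \<in> {0..1} \<inter> ?f -` G" using G by simp
  ultimately obtain d where d: "d > 0" "ball 0 d \<inter> {0..1} \<subseteq> ?f -` G"
    unfolding openin_contains_ball by blast
  have "min (d / 2) 1 \<in> ball 0 d \<inter> {0..1}" using d(1) by auto
  then have "?f (min (d / 2) 1) \<in> G" using d(2) by blast
  then show thesis using d(1) by (intro that[of "min (d / 2) 1"]) auto
qed

definition barycenter :: "'a set \<Rightarrow> 'a \<Rightarrow> real" where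
  "barycenter F = (\<lambda>v. if v \<in> F then 1 / card F else 0)"

lemma barycenter_realize:
  assumes "F \<in> K" "F \<noteq> {}"
  shows "barycenter F \<in> realize K" "{v. barycenter F v \<noteq> 0} = F"
  using assms finite_face[of F] by (auto simp: barycenter_def card_gt_0_iff intro!: realizeI[of _ F])

definition open_star :: "'a set \<Rightarrow> ('a \<Rightarrow> real) set" where
  "open_star F = {x \<in> realize K. \<forall>v\<in>F. 0 < x v}"

lemma openin_positive: "openin (top_of_set (realize K)) {x \<in> realize K. 0 < x v}"
proof -
  have "openin (top_of_set (realize K)) (realize K \<inter> (\<lambda>x. x v) -` {0<..})"
    by (rule continuous_openin_preimage[of _ _ UNIV])
       (auto intro: continuous_on_subset[OF continuous_on_product_coordinates])
  moreover have "realize K \<inter> (\<lambda>x. x v) -` {0<..} = {x \<in> realize K. 0 < x v}" by auto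
  ultimately show ?thesis by simp
qed

lemma openin_open_star: "finite F \<Longrightarrow> openin (top_of_set (realize K)) (open_star F)"
proof (induction F rule: finite_induct)
  case (insert v F)
  have "open_star (insert v F) = open_star F \<inter> {x \<in> realize K. 0 < x v}"
    by (auto simp: open_star_def)
  then show ?case using insert openin_positive by (simp add: openin_Int)
qed (simp add: open_star_def)

lemma open_star_support: "x \<in> open_star F \<Longrightarrow> F \<subseteq> {v. x v \<noteq> 0}"
  by (force simp: open_star_def)

lemma barycenter_open_star: "F \<in> K \<Longrightarrow> F \<noteq> {} \<Longrightarrow> barycenter F \<in> open_star F"
  using barycenter_realize[of F] finite_face[of F]
  by (auto simp: open_star_def barycenter_def card_gt_0_iff)

text \<open>Otherwise a neighbourhood of the barycentre of \<open>F\<close> injects into a half space.\<close>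

lemma two_cofaces:
  assumes F: "F \<in> K" "F \<noteq> {}" "card F \<le> 3"
  shows "\<exists>a. a \<noteq> w \<and> a \<notin> F \<and> insert a F \<in> K"
proof (rule ccontr)
  assume none: "\<not> ?thesis"
  \<comment> \<open>Repetitions are allowed, so that vertices, edges and triangles are treated at
    once.\<close>
  obtain s1 s2 s3 where s: "F = {s1, s2, s3}"
  proof -
    from F obtain a where a: "a \<in> F" by blast
    have f: "finite F" using finite_face[OF F(1)] .
    consider "F = {a}" | b where "b \<in> F" "b \<noteq> a" using a by blast
    then show thesis
    proof cases
      case 1 then show ?thesis using that[of a a a] by simp
    next
      case 2
      have "card (F - {a} - {b}) \<le> 1" using F f a 2 by (simp add: card_Diff_singleton)
      then have "F - {a} - {b} = {} \<or> (\<exists>c. F - {a} - {b} = {c})"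
        using f by (metis One_nat_def card_0_eq card_1_singletonE finite_Diff le_SucE le_zero_eq)
      then show ?thesis
      proof
        assume "F - {a} - {b} = {}" then show thesis using that[of a a b] a 2 by blast
      next
        assume "\<exists>c. F - {a} - {b} = {c}"
        then obtain c where "F - {a} - {b} = {c}" by blast
        then show thesis using that[of a b c] a 2 by blast
      qed
    qed
  qed
  \<comment> \<open>In the open star of \<open>F\<close> only \<open>F\<close> and \<open>w\<close>
    can carry weight, and the weight of \<open>s3\<close> is determined by the total 1. So these
    three coordinates determine the point, and the last one is never negative.\<close>
  define f :: "('a \<Rightarrow> real) \<Rightarrow> real \<times> real \<times> real"
    where "f = (\<lambda>x. (x s1, x s2, if w \<in> F then 0 else x w))"
  have "continuous_on (open_star F) f" unfolding f_def by (cases "w \<in> F")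
      (auto intro!: continuous_on_Pair continuous_on_const continuous_on_subset[OF continuous_on_product_coordinates])
  moreover have "inj_on f (open_star F)"
  proof (rule inj_onI)
    have supp: "x v = 0" if "x \<in> open_star F" "v \<notin> F" "v \<noteq> w" for x v
    proof (rule ccontr)
      assume "x v \<noteq> 0"
      then have "insert v F \<subseteq> {v. x v \<noteq> 0}" using open_star_support[OF that(1)] by blast
      moreover have "{v. x v \<noteq> 0} \<in> K" using that(1) realizeD by (auto simp: open_star_def)
      ultimately have "insert v F \<in> K" using face_subset by blast
      then show False using none that by blast
    qed
    fix x y assume x: "x \<in> open_star F" and y: "y \<in> open_star F" and fxy: "f x = f y"
    have off: "x v = y v" if "v \<noteq> s3" for v
    proof (cases "v \<in> F \<or> v = w")
      case True
      then show ?thesis using fxy that s by (auto simp: f_def split: if_splits)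
    next
      case False
      then show ?thesis using supp[OF x, of v] supp[OF y, of v] by simp
    qed
    have "s3 \<in> vertices K" using s F face_in_vertices by blast
    then have "(\<Sum>v\<in>vertices K. x v) = x s3 + (\<Sum>v\<in>vertices K - {s3}. x v)"
      "(\<Sum>v\<in>vertices K. y v) = y s3 + (\<Sum>v\<in>vertices K - {s3}. y v)"
      using finite_vertices by (simp_all add: sum.remove)
    moreover have "(\<Sum>v\<in>vertices K - {s3}. x v) = (\<Sum>v\<in>vertices K - {s3}. y v)"
      using off by (intro sum.cong) auto
    ultimately have "x s3 = y s3"
      using realizeD(3)[of x] realizeD(3)[of y] x y by (simp add: open_star_def)
    then show "x = y" using off by (intro ext) (metis (full_types))
  qed
  ultimately obtain O' where O': "open O'" "f (barycenter F) \<in> O'" "O' \<subseteq> f ` open_star F"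
    using manifold3_open_image[OF man openin_open_star[OF finite_face[OF F(1)]] _ _
        barycenter_open_star[OF F(1,2)]] by blast
  then obtain e where e: "e > 0" "ball (f (barycenter F)) e \<subseteq> O'" using open_contains_ball by blast
  have fb: "f (barycenter F) = (barycenter F s1, barycenter F s2, 0)"
    by (auto simp: f_def barycenter_def)
  \<comment> \<open>A point slightly below the image of the barycentre: it would need a negative
    third coordinate.\<close>
  have "(barycenter F s1, barycenter F s2, - e / 2) \<in> ball (f (barycenter F)) e"
    using e(1) unfolding fb by (simp add: dist_Pair_Pair dist_real_def)
  then have "(barycenter F s1, barycenter F s2, - e / 2) \<in> f ` open_star F"
    using e(2) O'(3) by blast
  then obtain x where "x \<in> open_star F" "f x = (barycenter F s1, barycenter F s2, - e / 2)"
    by (rule imageE) simp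
  then show False using e(1) realizeD(1)[of x w] by (auto simp: f_def open_star_def split: if_splits)
qed

text \<open>The two tetrahedra on a triangle already fill a neighbourhood of its barycentre.\<close>

lemma coface_of_triangle:
  assumes s: "{s1, s2, s3} \<in> K" "card {s1, s2, s3} = 3"
    and w: "w1 \<noteq> w2" "w1 \<notin> {s1, s2, s3}" "w2 \<notin> {s1, s2, s3}"
      "insert w1 {s1, s2, s3} \<in> K" "insert w2 {s1, s2, s3} \<in> K"
    and F: "F \<in> K" "{s1, s2, s3} \<subseteq> F"
  shows "F \<subseteq> insert w1 {s1, s2, s3} \<or> F \<subseteq> insert w2 {s1, s2, s3}"
proof -
  have d: "s1 \<noteq> s2" "s1 \<noteq> s3" "s2 \<noteq> s3"
    using s(2) by (auto simp: insert_commute card_insert_if split: if_splits)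
  \<comment> \<open>The two tetrahedra unfolded into 3-space: \<open>a\<close> and \<open>b\<close>
    displace the point within the triangle, and \<open>t\<close> is a signed height, given as weight
    to \<open>w1\<close> if positive and to \<open>w2\<close> if negative. The vertex
    \<open>s3\<close> compensates so that the weights add up to 1.\<close>
  define \<Psi> :: "real \<times> real \<times> real \<Rightarrow> 'a \<Rightarrow> real" where
    "\<Psi> = (\<lambda>(a, b, t) v. if v = s1 then 1/3 + a else if v = s2 then 1/3 + b else if v = s3 then 1/3 - a - b - \<bar>t\<bar>
       else if v = w1 then max t 0 else if v = w2 then max (- t) 0 else 0)"
  define Z :: "(real \<times> real \<times> real) set" where
    "Z = {q. 0 < 1/3 + fst q \<and> 0 < 1/3 + fst (snd q) \<and> 0 < 1/3 - fst q - fst (snd q) - \<bar>snd (snd q)\<bar>}"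
  have "open Z" unfolding Z_def by (intro open_Collect_conj open_Collect_less continuous_intros)
  moreover have "continuous_on Z \<Psi>"
  proof (rule continuous_on_coordinatewise_then_product)
    fix v
    show "continuous_on Z (\<lambda>q. \<Psi> q v)" unfolding \<Psi>_def case_prod_beta
      by (cases "v = s1"; cases "v = s2"; cases "v = s3"; cases "v = w1"; cases "v = w2")
        (auto intro!: continuous_intros)
  qed
  moreover have "inj_on \<Psi> Z"
  proof (rule inj_onI)
    fix p q assume pq: "\<Psi> p = \<Psi> q"
    have "\<Psi> p v = \<Psi> q v" for v using pq by simp
    from this[of s1] this[of s2] this[of w1] this[of w2] show "p = q"
      using d w by (cases p; cases q) (auto simp: \<Psi>_def max_def split: if_splits)
  qed
  moreover have "\<Psi> ` Z \<subseteq> realize K"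
  proof clarify
    fix a b t :: real assume "(a, b, t) \<in> Z"
    then have pos: "0 < 1/3 + a" "0 < 1/3 + b" "0 < 1/3 - a - b - \<bar>t\<bar>" by (auto simp: Z_def)
    show "\<Psi> (a, b, t) \<in> realize K"
    proof (cases "t \<ge> 0")
      case True
      then show ?thesis using pos d w
        by (intro realizeI[of _ "insert w1 {s1, s2, s3}"]) (auto simp: \<Psi>_def)
    next
      case False
      then show ?thesis using pos d w
        by (intro realizeI[of _ "insert w2 {s1, s2, s3}"]) (auto simp: \<Psi>_def)
    qed
  qed
  ultimately have op: "openin (top_of_set (realize K)) (\<Psi> ` Z)"
    by (rule manifold3_invariance_of_domain[OF man])
  have b: "barycenter {s1, s2, s3} \<in> \<Psi> ` Z"
  proof
    show "barycenter {s1, s2, s3} = \<Psi> (0, 0, 0)" using d by (auto simp: \<Psi>_def barycenter_def)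
    show "(0, 0, 0) \<in> Z" by (simp add: Z_def)
  qed
  have Fne: "F \<noteq> {}" using F by blast
  have un: "{v. barycenter {s1, s2, s3} v \<noteq> 0} \<union> {v. barycenter F v \<noteq> 0} \<in> K"
    unfolding barycenter_realize(2)[OF s(1) insert_not_empty] barycenter_realize(2)[OF F(1) Fne] Un_absorb1[OF F(2)]
    by (rule F(1))
  \<comment> \<open>Moving from the barycentre of the triangle towards that of \<open>F\<close>
    makes all weights on \<open>F\<close> positive, while every point of the image of \<Psi> is
    supported on one of the two tetrahedra.\<close>
  obtain e where e: "0 < e" "e \<le> 1"
    "(\<lambda>v. (1 - e) * barycenter {s1, s2, s3} v + e * barycenter F v) \<in> \<Psi> ` Z"
    by (rule segment_meets_open[OF op b barycenter_realize(1)[OF F(1) Fne] un])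
  from e(3) obtain q where q: "(\<lambda>v. (1 - e) * barycenter {s1, s2, s3} v + e * barycenter F v) = \<Psi> q"
    by (rule imageE)
  obtain a b t where abt: "q = (a, b, t)" by (cases q)
  note t = q[unfolded abt]
  have sub: "\<Psi> (a, b, t) v \<noteq> 0" if "v \<in> F" for v
  proof -
    have "barycenter F v > 0" using that finite_face[OF F(1)] by (auto simp: barycenter_def card_gt_0_iff)
    then have "0 < (1 - e) * barycenter {s1, s2, s3} v + e * barycenter F v"
      using e by (intro add_nonneg_pos mult_nonneg_nonneg mult_pos_pos) (auto simp: barycenter_def)
    then show ?thesis using fun_cong[OF t, of v] by simp
  qed
  show ?thesis
  proof (cases "t \<ge> 0")
    case True
    have "v \<in> insert w1 {s1, s2, s3}" if "v \<in> F" for v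
      using sub[OF that] True by (auto simp: \<Psi>_def split: if_splits)
    then show ?thesis by blast
  next
    case False
    have "v \<in> insert w2 {s1, s2, s3}" if "v \<in> F" for v
      using sub[OF that] False by (auto simp: \<Psi>_def split: if_splits)
    then show ?thesis by blast
  qed
qed

end

section \<open>Sign cocycles on simply connected spaces\<close>

text \<open>Bounded sequences form a normed space with a coordinate for every index of a finite
  cover; the double cover below is built inside it.\<close>

definition unit_seq :: "nat \<Rightarrow> (nat \<Rightarrow>\<^sub>C real)" where
  "unit_seq b = Bcontfun (\<lambda>j. if j = b then 1 else 0)"

lemma unit_seq_apply: "apply_bcontfun (unit_seq b) j = (if j = b then 1 else 0)"
proof -
  have "(\<lambda>j. if j = b then 1 else (0::real)) \<in> bcontfun" by (rule bcontfun_normI[of _ 1]) auto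
  then show ?thesis by (simp add: unit_seq_def Bcontfun_inverse)
qed

lemma apply_bcontfun_sum: "apply_bcontfun (\<Sum>b\<in>I. f b) j = (\<Sum>b\<in>I. apply_bcontfun (f b) j)"
  by (induction I rule: infinite_finite_induct) auto

lemma continuous_on_apply_bcontfun_at:
  fixes f :: "'b::topological_space \<Rightarrow> ('c::topological_space \<Rightarrow>\<^sub>C real)"
  assumes "continuous_on S f"
  shows "continuous_on S (\<lambda>x. apply_bcontfun (f x) j)"
proof -
  have "continuous_on UNIV (\<lambda>g::'c \<Rightarrow>\<^sub>C real. apply_bcontfun g j)" unfolding continuous_on_iff
    by (metis dist_fun_lt_imp_dist_val_lt)
  then show ?thesis using continuous_on_compose2[OF _ assms] by blast
qed

text \<open>A sign cocycle defines a double cover of \<open>Y\<close>, realised inside \<open>Y\<close> times a sequence space: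
  the \<open>i\<close>-th coordinate over the \<open>i\<close>-th open set is \<open>\<plusminus> \<rho> i\<close>. As \<open>Y\<close> is simply connected the
  cover has a section.\<close>

lemma simply_connected_sign_cocycle:
  fixes Y :: "'e::real_normed_vector set" and \<rho> :: "nat \<Rightarrow> 'e \<Rightarrow> real" and \<kappa> :: "nat \<Rightarrow> nat \<Rightarrow> real"
  assumes Y: "simply_connected Y" "locally path_connected Y" and I: "finite I"
    and cont: "\<And>i. i \<in> I \<Longrightarrow> continuous_on Y (\<rho> i)"
    and nonneg: "\<And>i y. i \<in> I \<Longrightarrow> y \<in> Y \<Longrightarrow> 0 \<le> \<rho> i y"
    and cover: "\<And>y. y \<in> Y \<Longrightarrow> \<exists>i\<in>I. 0 < \<rho> i y"
    and sign: "\<And>i j. i \<in> I \<Longrightarrow> j \<in> I \<Longrightarrow> \<kappa> i j = 1 \<or> \<kappa> i j = -1"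
    and cocycle: "\<And>y i j k. y \<in> Y \<Longrightarrow> i \<in> I \<Longrightarrow> j \<in> I \<Longrightarrow> k \<in> I \<Longrightarrow>
      0 < \<rho> i y \<Longrightarrow> 0 < \<rho> j y \<Longrightarrow> 0 < \<rho> k y \<Longrightarrow> \<kappa> i j * \<kappa> j k = \<kappa> i k"
  obtains s :: "nat \<Rightarrow> 'e \<Rightarrow> real" where
    "\<And>i. i \<in> I \<Longrightarrow> continuous_on {y \<in> Y. 0 < \<rho> i y} (s i)"
    "\<And>i y. i \<in> I \<Longrightarrow> y \<in> Y \<Longrightarrow> 0 < \<rho> i y \<Longrightarrow> s i y = 1 \<or> s i y = -1"
    "\<And>i j y. i \<in> I \<Longrightarrow> j \<in> I \<Longrightarrow> y \<in> Y \<Longrightarrow> 0 < \<rho> i y \<Longrightarrow> 0 < \<rho> j y \<Longrightarrow> s i y = \<kappa> i j * s j y"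
proof -
  \<comment> \<open>\<open>Z i \<epsilon> y\<close> is the fibre coordinate over \<open>y\<close> on
    sheet \<epsilon> as seen from the \<open>i\<close>-th open set. By the cocycle condition another
    index yields the same two points, up to exchanging the sheets. The factor
    \<open>\<rho> b y\<close> lets each coordinate fade out at the boundary of its open set, so that
    \<open>Z i \<epsilon>\<close> is continuous on all of \<open>Y\<close>.\<close>
  define Z where "Z i \<epsilon> y = (\<Sum>b\<in>I. (\<epsilon> * \<kappa> i b * \<rho> b y) *\<^sub>R unit_seq b)" for i \<epsilon> y
  define U where "U i = {y \<in> Y. 0 < \<rho> i y}" for i
  define u where "u i \<epsilon> = (\<lambda>y. (y, Z i \<epsilon> y)) ` U i" for i \<epsilon>
  define C where "C = (\<Union>i\<in>I. u i 1 \<union> u i (-1))"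
  have diag: "\<kappa> i i = 1" if "i \<in> I" "y \<in> U i" for i y
    using cocycle[of y i i i] sign[of i i] that by (auto simp: U_def)
  have sym: "\<kappa> j i = \<kappa> i j" if "i \<in> I" "j \<in> I" "y \<in> U i" "y \<in> U j" for i j y
    using cocycle[of y i j i] sign[of i j] sign[of j i] diag that by (auto simp: U_def)
  have coord: "apply_bcontfun (Z i \<epsilon> y) j = \<epsilon> * \<kappa> i j * \<rho> j y" if "j \<in> I" for i j \<epsilon> y
  proof -
    have "apply_bcontfun (Z i \<epsilon> y) j = (\<Sum>b\<in>I. if b = j then \<epsilon> * \<kappa> i j * \<rho> j y else 0)"
      unfolding Z_def apply_bcontfun_sum by (intro sum.cong) (auto simp: unit_seq_apply)
    then show ?thesis using that I by simp
  qed
  have change: "Z j \<epsilon> y = Z i (\<epsilon> * \<kappa> i j) y" if "i \<in> I" "j \<in> I" "y \<in> U i" "y \<in> U j" for i j \<epsilon> y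
    unfolding Z_def
  proof (intro sum.cong refl arg_cong2[of _ _ _ _ scaleR])
    fix b assume b: "b \<in> I"
    show "\<epsilon> * \<kappa> j b * \<rho> b y = \<epsilon> * \<kappa> i j * \<kappa> i b * \<rho> b y"
    proof (cases "\<rho> b y = 0")
      case False
      then have "0 < \<rho> b y" using nonneg[OF b, of y] that by (force simp: U_def)
      then have "\<kappa> j i * \<kappa> i b = \<kappa> j b" using cocycle[of y j i b] that b by (auto simp: U_def)
      then have "\<kappa> j b = \<kappa> i j * \<kappa> i b" using sym that by simp
      then show ?thesis by simp
    qed simp
  qed
  have contZ: "continuous_on Y (Z i \<epsilon>)" if "i \<in> I" for i \<epsilon>
    unfolding Z_def using cont by (intro continuous_intros) auto
  have C_cases: "\<exists>j\<in>I. \<exists>\<delta> y. (\<delta> = 1 \<or> \<delta> = -1) \<and> y \<in> U j \<and> c = (y, Z j \<delta> y)" if "c \<in> C" for c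
    using that unfolding C_def u_def by blast
  \<comment> \<open>The sign of the \<open>i\<close>-th coordinate separates the two sheets over
    \<open>U i\<close>; this makes them open and disjoint.\<close>
  have u_eq: "u i \<epsilon> = {c \<in> C. fst c \<in> U i \<and> 0 < \<epsilon> * apply_bcontfun (snd c) i}"
    if i: "i \<in> I" and e: "\<epsilon> = 1 \<or> \<epsilon> = -1" for i \<epsilon>
  proof (intro equalityI subsetI)
    fix c assume "c \<in> u i \<epsilon>"
    then obtain y where y: "y \<in> U i" "c = (y, Z i \<epsilon> y)" by (auto simp: u_def)
    have "0 < \<epsilon> * apply_bcontfun (Z i \<epsilon> y) i"
      using coord[OF i, of i \<epsilon> y] diag[OF i y(1)] y e by (auto simp: U_def)
    then show "c \<in> {c \<in> C. fst c \<in> U i \<and> 0 < \<epsilon> * apply_bcontfun (snd c) i}"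
      using y i e \<open>c \<in> u i \<epsilon>\<close> by (auto simp: C_def)
  next
    fix c assume "c \<in> {c \<in> C. fst c \<in> U i \<and> 0 < \<epsilon> * apply_bcontfun (snd c) i}"
    then have c: "c \<in> C" "fst c \<in> U i" "0 < \<epsilon> * apply_bcontfun (snd c) i" by auto
    from C_cases[OF c(1)] obtain j \<delta> y where j: "j \<in> I" "\<delta> = 1 \<or> \<delta> = -1" "y \<in> U j" "c = (y, Z j \<delta> y)"
      by blast
    have y: "y \<in> U i" "0 < \<epsilon> * apply_bcontfun (Z j \<delta> y) i" using c j by auto
    have "Z j \<delta> y = Z i (\<delta> * \<kappa> i j) y" using change i j y by blast
    moreover have "\<delta> * \<kappa> i j = \<epsilon>"
    proof -
      have "0 < \<rho> i y" using y by (simp add: U_def)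
      moreover have "0 < \<epsilon> * (\<delta> * \<kappa> j i * \<rho> i y)" using y coord i by simp
      moreover have "\<kappa> j i = \<kappa> i j" using sym i j y by blast
      ultimately show ?thesis using sign[OF i j(1)] e j(2) by auto
    qed
    ultimately show "c \<in> u i \<epsilon>" using j y by (auto simp: u_def)
  qed
  have oU: "openin (top_of_set Y) (U i)" if "i \<in> I" for i
  proof -
    have "openin (top_of_set Y) (Y \<inter> \<rho> i -` {0<..})"
      by (rule continuous_openin_preimage[OF cont[OF that], of UNIV]) auto
    then show ?thesis by (simp add: U_def vimage_def Int_def)
  qed
  have UY: "U i \<subseteq> Y" for i by (auto simp: U_def)
  have contfst: "continuous_on C fst" by (intro continuous_intros)
  have CY: "fst ` C \<subseteq> Y" by (auto simp: C_def u_def U_def)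
  have ou: "openin (top_of_set C) (u i \<epsilon>)" if i: "i \<in> I" and e: "\<epsilon> = 1 \<or> \<epsilon> = -1" for i \<epsilon>
  proof -
    have "openin (top_of_set C) (C \<inter> fst -` U i)"
      by (rule continuous_openin_preimage[OF contfst _ oU[OF i]]) (use CY in auto)
    moreover have "openin (top_of_set C) (C \<inter> (\<lambda>c. \<epsilon> * apply_bcontfun (snd c) i) -` {0<..})"
      by (rule continuous_openin_preimage[of _ _ UNIV])
        (auto intro!: continuous_intros continuous_on_apply_bcontfun_at)
    ultimately have "openin (top_of_set C) ((C \<inter> fst -` U i) \<inter> (C \<inter> (\<lambda>c. \<epsilon> * apply_bcontfun (snd c) i) -` {0<..}))"
      by (rule openin_Int)
    then show ?thesis unfolding u_eq[OF i e] by (rule back_subst[of "openin (top_of_set C)"]) auto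
  qed
  have "covering_space C fst Y"
  proof
    show "fst ` C = Y"
    proof
      show "Y \<subseteq> fst ` C"
      proof
        fix y assume y: "y \<in> Y"
        then obtain i where "i \<in> I" "0 < \<rho> i y" using cover by blast
        then have "(y, Z i 1 y) \<in> C" using y by (auto simp: C_def u_def U_def)
        then show "y \<in> fst ` C" by force
      qed
    qed (fact CY)
    fix y assume y: "y \<in> Y"
    then obtain i where i: "i \<in> I" "0 < \<rho> i y" using cover by blast
    have 1: "\<Union>{u i 1, u i (-1)} = C \<inter> fst -` U i"
    proof
      show "\<Union>{u i 1, u i (-1)} \<subseteq> C \<inter> fst -` U i" using i by (auto simp: C_def u_def)
      show "C \<inter> fst -` U i \<subseteq> \<Union>{u i 1, u i (-1)}"
      proof
        fix c assume "c \<in> C \<inter> fst -` U i"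
        then have c: "c \<in> C" "fst c \<in> U i" by auto
        from C_cases[OF c(1)] obtain j \<delta> y where j: "j \<in> I" "\<delta> = 1 \<or> \<delta> = -1" "y \<in> U j" "c = (y, Z j \<delta> y)"
          by blast
        have y: "y \<in> U i" using c j by simp
        have "c = (y, Z i (\<delta> * \<kappa> i j) y)" unfolding j(4) by (simp only: change[OF i(1) j(1) y j(3)])
        moreover have "\<delta> * \<kappa> i j = 1 \<or> \<delta> * \<kappa> i j = -1" using sign[OF i(1) j(1)] j(2) by auto
        ultimately show "c \<in> \<Union>{u i 1, u i (-1)}" using y by (auto simp: u_def)
      qed
    qed
    have 2: "pairwise disjnt {u i 1, u i (-1)}"
      using u_eq[of i 1] u_eq[of i "-1"] i by (auto simp: pairwise_def disjnt_def)
    have 3: "\<exists>q. homeomorphism (u i \<epsilon>) (U i) fst q" for \<epsilon>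
      by (rule exI[of _ "\<lambda>y. (y, Z i \<epsilon> y)"], rule homeomorphismI)
        (auto simp: u_def intro!: continuous_intros continuous_on_subset[OF contZ[OF i(1)] UY])
    show "\<exists>T. y \<in> T \<and> openin (top_of_set Y) T \<and> (\<exists>v. \<Union>v = C \<inter> fst -` T \<and>
        (\<forall>u\<in>v. openin (top_of_set C) u) \<and> pairwise disjnt v \<and> (\<forall>u\<in>v. \<exists>q. homeomorphism u T fst q))"
    proof (intro exI conjI)
      show "y \<in> U i" using y i by (simp add: U_def)
      show "openin (top_of_set Y) (U i)" using oU i by blast
      show "\<forall>u\<in>{u i 1, u i (-1)}. openin (top_of_set C) u" using ou[OF i(1)] by simp
      show "\<forall>u\<in>{u i 1, u i (-1)}. \<exists>q. homeomorphism u (U i) fst q" using 3 by simp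
    qed (fact 1 2)+
  qed (fact contfst)
  \<comment> \<open>A lift of the identity of \<open>Y\<close> is a section of the covering.\<close>
  then obtain g where g: "continuous_on Y g" "g \<in> Y \<rightarrow> C" "\<And>y. y \<in> Y \<Longrightarrow> fst (g y) = y"
    by (rule covering_space_lift[OF _ Y, of C fst Y "\<lambda>y. y"]) auto
  \<comment> \<open>Over \<open>U i\<close> the \<open>i\<close>-th coordinate of the section is the
    sheet sign times \<open>\<rho> i y\<close>, so the quotient recovers the sign.\<close>
  define s where "s i y = apply_bcontfun (snd (g y)) i / \<rho> i y" for i y
  have gZ: "\<exists>\<epsilon>. (\<epsilon> = 1 \<or> \<epsilon> = -1) \<and> g y = (y, Z i \<epsilon> y)" if "i \<in> I" "y \<in> U i" for i y
  proof -
    have y: "y \<in> Y" using that UY by blast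
    then have "g y \<in> C" using g(2) by blast
    from C_cases[OF this] obtain j \<delta> y' where j': "j \<in> I" "\<delta> = 1 \<or> \<delta> = -1" "y' \<in> U j" "g y = (y', Z j \<delta> y')"
      by blast
    then have "y' = y" using g(3)[OF y] by simp
    with j' have j: "j \<in> I" "\<delta> = 1 \<or> \<delta> = -1" "y \<in> U j" "g y = (y, Z j \<delta> y)" by auto
    have "g y = (y, Z i (\<delta> * \<kappa> i j) y)" unfolding j(4) by (simp only: change[OF that(1) j(1) that(2) j(3)])
    moreover have "\<delta> * \<kappa> i j = 1 \<or> \<delta> * \<kappa> i j = -1" using sign[OF that(1) j(1)] j(2) by auto
    ultimately show ?thesis by blast
  qed
  show thesis
  proof (rule that[of s])
    fix i assume i: "i \<in> I"
    show "continuous_on {y \<in> Y. 0 < \<rho> i y} (s i)" unfolding s_def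
      by (intro continuous_on_divide continuous_on_apply_bcontfun_at continuous_on_snd)
        (auto intro: continuous_on_subset[OF g(1)] continuous_on_subset[OF cont[OF i]])
    fix y assume y: "y \<in> Y" "0 < \<rho> i y"
    then have yU: "y \<in> U i" by (simp add: U_def)
    obtain \<epsilon> where e: "\<epsilon> = 1 \<or> \<epsilon> = -1" "g y = (y, Z i \<epsilon> y)" using gZ[OF i yU] by blast
    have "s i y = \<epsilon>" using coord[OF i] diag[OF i yU] y e by (simp add: s_def)
    then show "s i y = 1 \<or> s i y = -1" using e by simp
  next
    fix i j y assume ij: "i \<in> I" "j \<in> I" and y: "y \<in> Y" "0 < \<rho> i y" "0 < \<rho> j y"
    then have yU: "y \<in> U i" "y \<in> U j" by (auto simp: U_def)
    obtain \<epsilon> where e: "\<epsilon> = 1 \<or> \<epsilon> = -1" "g y = (y, Z j \<epsilon> y)" using gZ[OF ij(2) yU(2)] by blast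
    have "s j y = \<epsilon>" using coord[OF ij(2)] diag[OF ij(2) yU(2)] y e by (simp add: s_def)
    moreover have "s i y = \<epsilon> * \<kappa> j i" using coord[OF ij(1)] y e by (simp add: s_def)
    ultimately show "s i y = \<kappa> i j * s j y" using sym[OF ij yU] by simp
  qed
qed

section \<open>Links in a simplicial 3-manifold\<close>

context simplicial_3manifold
begin

text \<open>Dimension three enters here: a ball minus its centre is simply connected, which fails
  for a disc.\<close>

lemma punctured_chart:
  assumes F: "F \<in> K" "F \<noteq> {}"
  obtains Y :: "(real \<times> real \<times> real) set" and g g' G where
    "simply_connected Y" "open Y" "continuous_on Y g"
    "\<And>y. y \<in> Y \<Longrightarrow> g y \<in> open_star F" "\<And>y. y \<in> Y \<Longrightarrow> g y \<noteq> barycenter F"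
    "openin (top_of_set (realize K)) G" "barycenter F \<in> G" "continuous_on G g'"
    "\<And>x. x \<in> G \<Longrightarrow> x \<noteq> barycenter F \<Longrightarrow> g' x \<in> Y" "\<And>x. x \<in> G \<Longrightarrow> g (g' x) = x"
proof -
  have \<beta>: "barycenter F \<in> open_star F" by (rule barycenter_open_star[OF F])
  obtain p :: "real \<times> real \<times> real" and e g g' where g: "0 < e" "g p = barycenter F"
    "homeomorphism (ball p e) (g ` ball p e) g g'"
    "openin (top_of_set (realize K)) (g ` ball p e)" "g ` ball p e \<subseteq> open_star F"
    by (rule manifold3_chart[OF man _ openin_open_star[OF finite_face[OF F(1)]] \<beta>])
      (use \<beta> in \<open>auto simp: open_star_def\<close>)
  have p: "p \<in> ball p e" using g(1) by simp
  show thesis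
  proof (rule that[of "ball p e - {p}" g "g ` ball p e" g'])
    show "simply_connected (ball p e - {p})"
      by (rule simply_connected_punctured_convex) (use g(1) in \<open>auto simp: aff_dim_open\<close>)
    show "open (ball p e - {p})" by (intro open_delete open_ball)
    show "continuous_on (ball p e - {p}) g"
      using g(3) by (auto simp: homeomorphism_def intro: continuous_on_subset)
    fix y assume y: "y \<in> ball p e - {p}"
    then show "g y \<in> open_star F" using g(5) by auto
    show "g y \<noteq> barycenter F"
    proof
      assume "g y = barycenter F"
      then have "g' (g y) = g' (g p)" using g(2) by simp
      then show False using y p homeomorphism_apply1[OF g(3)] by simp
    qed
  next
    show "barycenter F \<in> g ` ball p e" using p g(2)[symmetric] by simp
    show "continuous_on (g ` ball p e) g'" using g(3) by (simp add: homeomorphism_def)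
    fix x assume x: "x \<in> g ` ball p e"
    show gx: "g (g' x) = x" by (rule homeomorphism_apply2[OF g(3) x])
    assume "x \<noteq> barycenter F"
    then have "g' x \<noteq> p" using gx g(2) by metis
    then show "g' x \<in> ball p e - {p}" using x homeomorphism_image2[OF g(3)] by blast
  qed (rule g(4))
qed

text \<open>The sets A with A \<union> {u, v} in K that do not contain {u, v} are the faces of the
  link of the barycentre of {u, v}. For u = v this is the link of a vertex, for u \<noteq> v it is
  the suspension of the link of an edge. A sign cocycle on it is pulled back to a punctured chart
  ball by projecting radially from the barycentre. It splits there, and reading the splitting off on
  a small copy of the link gives \<open>h\<close>.\<close>

lemma sign_cocycle_link:
  assumes uv: "{u, v} \<in> K"
    and sign: "\<And>a b. \<kappa> a b = 1 \<or> \<kappa> a b = (-1::real)"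
    and cocycle: "\<And>a b c. {a, b, c} \<union> {u, v} \<in> K \<Longrightarrow> \<not> {u, v} \<subseteq> {a, b, c} \<Longrightarrow> \<kappa> a b * \<kappa> b c = \<kappa> a c"
  obtains h where "\<And>a. h a = 1 \<or> h a = (-1::real)"
    "\<And>a b. {a, b} \<union> {u, v} \<in> K \<Longrightarrow> \<not> {u, v} \<subseteq> {a, b} \<Longrightarrow> \<kappa> a b = h a * h b"
proof -
  define \<beta> where "\<beta> = barycenter {u, v}"
  have \<beta>: "\<beta> \<in> open_star {u, v}" unfolding \<beta>_def by (rule barycenter_open_star[OF uv]) simp
  have \<beta>_eq: "\<beta> x = (if x \<in> {u, v} then 1 / card {u, v} else 0)" for x
    by (simp add: \<beta>_def barycenter_def)
  have card_pos: "0 < card {u, v}" by (simp add: card_gt_0_iff)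
  \<comment> \<open>Removing the common weight of \<open>u\<close> and \<open>v\<close> removes the
    part of \<open>x\<close> in the direction of the barycentre. The vertices where \<xi> is
    positive span the face of the link to which \<open>x\<close> projects. For \<open>u = v\<close>
    the coordinate at \<open>u\<close> becomes zero.\<close>
  define \<xi> where "\<xi> a x = x a - (if a \<in> {u, v} then min (x u) (x v) else 0)" for a and x :: "'a \<Rightarrow> real"
  have \<xi>_le: "\<xi> a x \<le> x a" if "x \<in> open_star {u, v}" for a x
    using that by (auto simp: \<xi>_def open_star_def)
  have \<xi>_nonneg: "0 \<le> \<xi> a x" if "x \<in> open_star {u, v}" for a x
    using that realizeD(1) by (auto simp: \<xi>_def open_star_def)
  have face: "A \<union> {u, v} \<in> K" "\<not> {u, v} \<subseteq> A"
    if x: "x \<in> open_star {u, v}" and A: "\<And>a. a \<in> A \<Longrightarrow> 0 < \<xi> a x" for A x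
  proof -
    have "A \<union> {u, v} \<subseteq> {w. x w \<noteq> 0}"
    proof
      fix w assume "w \<in> A \<union> {u, v}"
      then have "x w > 0" using A[of w] \<xi>_le[OF x, of w] x by (auto simp: open_star_def)
      then show "w \<in> {w. x w \<noteq> 0}" by simp
    qed
    then show "A \<union> {u, v} \<in> K" using x realizeD(2)[of x] face_subset by (auto simp: open_star_def)
    show "\<not> {u, v} \<subseteq> A"
    proof
      assume "{u, v} \<subseteq> A"
      then have "0 < \<xi> u x" "0 < \<xi> v x" using A by auto
      then show False by (auto simp: \<xi>_def min_def split: if_splits)
    qed
  qed
  have cover: "\<exists>a\<in>vertices K. 0 < \<xi> a x" if x: "x \<in> open_star {u, v}" and ne: "x \<noteq> \<beta>" for x
  proof (rule ccontr)
    assume "\<not> ?thesis"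
    then have le: "\<xi> a x \<le> 0" if "a \<in> vertices K" for a using that by force
    have xr: "x \<in> realize K" using x by (simp add: open_star_def)
    have uvV: "u \<in> vertices K" "v \<in> vertices K" using face_in_vertices[OF uv] by auto
    have eq: "x u = x v" using le[OF uvV(1)] le[OF uvV(2)] by (auto simp: \<xi>_def min_def split: if_splits)
    have 0: "x a = 0" if "a \<notin> {u, v}" for a
    proof (cases "a \<in> vertices K")
      case True
      then show ?thesis using le[OF True] realizeD(1)[OF xr, of a] that by (auto simp: \<xi>_def)
    next
      case False
      then show ?thesis using face_in_vertices[OF realizeD(2)[OF xr]] by auto
    qed
    have "(\<Sum>w\<in>vertices K. x w) = (\<Sum>w\<in>{u, v}. x w)"
      using 0 uvV finite_vertices by (intro sum.mono_neutral_right) auto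
    also have "\<dots> = (\<Sum>w\<in>{u, v}. x u)" using eq by (intro sum.cong) auto
    finally have "card {u, v} * x u = 1" using realizeD(3)[OF xr] by simp
    then have "x u = 1 / card {u, v}" using card_pos by (simp add: field_simps)
    then have "x = \<beta>" using 0 eq by (auto simp: fun_eq_iff \<beta>_eq)
    then show False using ne by simp
  qed
  obtain Y :: "(real \<times> real \<times> real) set" and g g' G where Y: "simply_connected Y" "open Y" and cg: "continuous_on Y g"
    and gY: "\<And>y. y \<in> Y \<Longrightarrow> g y \<in> open_star {u, v}" "\<And>y. y \<in> Y \<Longrightarrow> g y \<noteq> \<beta>"
    and G: "openin (top_of_set (realize K)) G" "\<beta> \<in> G" and cg': "continuous_on G g'"
    and g'Y: "\<And>x. x \<in> G \<Longrightarrow> x \<noteq> \<beta> \<Longrightarrow> g' x \<in> Y" and gg': "\<And>x. x \<in> G \<Longrightarrow> g (g' x) = x"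
    by (rule punctured_chart[OF uv insert_not_empty, folded \<beta>_def]) (rule that)
  \<comment> \<open>The vertices are numbered because the covering argument indexes its open sets by
    natural numbers.\<close>
  obtain f :: "'a \<Rightarrow> nat" where f: "inj_on f (vertices K)"
    using finite_imp_inj_to_nat_seg[OF finite_vertices] by blast
  define w where "w = inv_into (vertices K) f"
  have w: "w (f a) = a" if "a \<in> vertices K" for a using that f by (simp add: w_def)
  define \<rho> where "\<rho> i y = \<xi> (w i) (g y)" for i y
  have contx: "continuous_on Y (\<lambda>y. g y a)" for a
    by (rule continuous_on_compose2[OF continuous_on_product_coordinates cg]) simp
  have cont\<rho>: "continuous_on Y (\<rho> i)" for i
    unfolding \<rho>_def \<xi>_def by (cases "w i \<in> {u, v}") (auto intro!: continuous_intros contx)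
  have nonneg\<rho>: "0 \<le> \<rho> i y" if "y \<in> Y" for i y unfolding \<rho>_def by (rule \<xi>_nonneg[OF gY(1)[OF that]])
  have cov: "\<exists>i\<in>f ` vertices K. 0 < \<rho> i y" if "y \<in> Y" for y
    using cover[OF gY[OF that]] w by (auto simp: \<rho>_def)
  have coc: "\<kappa> (w i) (w j) * \<kappa> (w j) (w k) = \<kappa> (w i) (w k)"
    if "y \<in> Y" "0 < \<rho> i y" "0 < \<rho> j y" "0 < \<rho> k y" for y i j k
    by (rule cocycle; rule face[OF gY(1)[OF that(1)]]) (use that in \<open>auto simp: \<rho>_def\<close>)
  obtain s :: "nat \<Rightarrow> real \<times> real \<times> real \<Rightarrow> real" where s:
    "\<And>i. i \<in> f ` vertices K \<Longrightarrow> continuous_on {y \<in> Y. 0 < \<rho> i y} (s i)"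
    "\<And>i y. i \<in> f ` vertices K \<Longrightarrow> y \<in> Y \<Longrightarrow> 0 < \<rho> i y \<Longrightarrow> s i y = 1 \<or> s i y = -1"
    "\<And>i j y. i \<in> f ` vertices K \<Longrightarrow> j \<in> f ` vertices K \<Longrightarrow> y \<in> Y \<Longrightarrow> 0 < \<rho> i y \<Longrightarrow> 0 < \<rho> j y \<Longrightarrow>
       s i y = \<kappa> (w i) (w j) * s j y"
  proof (rule simply_connected_sign_cocycle[where Y = Y and I = "f ` vertices K" and \<rho> = \<rho> and \<kappa> = "\<lambda>i j. \<kappa> (w i) (w j)"])
    show "simply_connected Y" "locally path_connected Y" by (fact Y(1), rule open_imp_locally_path_connected[OF Y(2)])
    show "finite (f ` vertices K)" using finite_vertices by simp
    show "continuous_on Y (\<rho> i)" for i by (rule cont\<rho>)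
    show "0 \<le> \<rho> i y" if "y \<in> Y" for i y by (rule nonneg\<rho>[OF that])
    show "\<exists>i\<in>f ` vertices K. 0 < \<rho> i y" if "y \<in> Y" for y by (rule cov[OF that])
    show "\<kappa> (w i) (w j) = 1 \<or> \<kappa> (w i) (w j) = -1" for i j by (rule sign)
    show "\<kappa> (w i) (w j) * \<kappa> (w j) (w k) = \<kappa> (w i) (w k)"
      if "y \<in> Y" "0 < \<rho> i y" "0 < \<rho> j y" "0 < \<rho> k y" for y i j k by (rule coc[OF that])
  qed (rule that)
  define S where "S a = s (f a)" for a
  have S1: "continuous_on {y \<in> Y. 0 < \<xi> a (g y)} (S a)" if "a \<in> vertices K" for a
    using s(1)[of "f a"] that w by (simp add: S_def \<rho>_def)
  have S2: "S a y = 1 \<or> S a y = -1" if "a \<in> vertices K" "y \<in> Y" "0 < \<xi> a (g y)" for a y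
    using s(2)[of "f a" y] that w by (simp add: S_def \<rho>_def)
  have S3: "S a y = \<kappa> a b * S b y"
    if "a \<in> vertices K" "b \<in> vertices K" "y \<in> Y" "0 < \<xi> a (g y)" "0 < \<xi> b (g y)" for a b y
    using s(3)[of "f a" "f b" y] that w by (simp add: S_def \<rho>_def)
  \<comment> \<open>\<open>F a b r t\<close> runs along the link edge from \<open>a\<close> to
    \<open>b\<close> as \<open>t\<close> grows, shrunk towards the barycentre by the factor
    \<open>r\<close>.\<close>
  define F where "F a b r t x = (1 - r) * \<beta> x + r * ((1 - t) * of_bool (x = a) + t * of_bool (x = b))"
    for a b r t and x :: 'a
  have F_realize: "F a b r t \<in> realize K"
    if ab: "{a, b} \<union> {u, v} \<in> K" and "0 \<le> r" "r \<le> 1" "0 \<le> t" "t \<le> 1" for a b r t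
  proof -
    let ?y = "\<lambda>x. (1 - t) * of_bool (x = a) + t * of_bool (x = b)"
    have y: "?y \<in> realize K"
    proof (rule realizeI[of _ "{a, b}"])
      show "{a, b} \<in> K" using face_subset[OF ab] by blast
      show "(\<Sum>x\<in>{a, b}. ?y x) = 1" by (cases "a = b") auto
    qed (use that in auto)
    have sup: "{x. \<beta> x \<noteq> 0} \<union> {x. ?y x \<noteq> 0} \<in> K"
      by (rule face_subset[OF ab]) (auto simp: \<beta>_eq split: if_splits)
    have "(\<lambda>x. (1 - r) * \<beta> x + r * ?y x) \<in> realize K"
      by (rule realize_segment[OF _ y sup that(2,3)]) (use \<beta> in \<open>simp add: open_star_def\<close>)
    then show ?thesis by (simp add: F_def[abs_def])
  qed
  define Bad where "Bad a b = {q \<in> {0..1} \<times> {0..1}. F a b (fst q) (snd q) \<notin> G}" for a b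
  have Bad: "compact (Bad a b)" "(0, t) \<notin> Bad a b" if ab: "{a, b} \<union> {u, v} \<in> K" for a b t
  proof -
    let ?Q = "{0..1} \<times> {0..1} :: (real \<times> real) set" and ?f = "\<lambda>q. F a b (fst q) (snd q)"
    have "openin (top_of_set ?Q) (?Q \<inter> ?f -` (G))"
    proof (rule continuous_openin_preimage[OF _ _ G(1)])
      show "continuous_on ?Q ?f"
        unfolding F_def by (intro continuous_on_coordinatewise_then_product continuous_intros)
      show "?f \<in> ?Q \<rightarrow> realize K" using F_realize[OF ab] by auto
    qed
    then have "closedin (top_of_set ?Q) (?Q - (?Q \<inter> ?f -` (G)))"
      by (rule closedin_diff[rotated]) simp
    then have "compact (?Q - (?Q \<inter> ?f -` (G)))"
      by (rule closedin_compact[rotated]) (intro compact_Times compact_Icc)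
    moreover have "?Q - (?Q \<inter> ?f -` (G)) = Bad a b" by (auto simp: Bad_def)
    ultimately show "compact (Bad a b)" by simp
    have "F a b 0 t = \<beta>" by (auto simp: F_def fun_eq_iff)
    then show "(0, t) \<notin> Bad a b" using G(2) by (simp add: Bad_def)
  qed
  \<comment> \<open>There are finitely many pairs, and each compact set of parameters at which the
    shrunken edge leaves \<open>G\<close> misses \<open>r = 0\<close>. So a single positive
    \<open>r\<close> keeps all shrunken edges inside \<open>G\<close>.\<close>
  define Pr where "Pr = {(a, b). {a, b} \<union> {u, v} \<in> K}"
  have "Pr \<subseteq> vertices K \<times> vertices K" using face_in_vertices by (force simp: Pr_def)
  then have "finite Pr" using finite_vertices finite_subset by blast
  have "compact (\<Union>(a, b)\<in>Pr. fst ` Bad a b)" by (intro compact_UN \<open>finite Pr\<close>)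
      (auto simp: Pr_def intro!: compact_continuous_image continuous_intros Bad)
  then have "open (- (\<Union>(a, b)\<in>Pr. fst ` Bad a b))" by (intro open_Compl compact_imp_closed)
  moreover have "0 \<in> - (\<Union>(a, b)\<in>Pr. fst ` Bad a b)"
  proof
    assume "0 \<in> (\<Union>(a, b)\<in>Pr. fst ` Bad a b)"
    then obtain a b q where "(a, b) \<in> Pr" "q \<in> Bad a b" "0 = fst q" by auto
    then show False using Bad(2)[of a b "snd q"] by (cases q) (simp add: Pr_def)
  qed
  ultimately have "\<exists>d>0. ball 0 d \<subseteq> - (\<Union>(a, b)\<in>Pr. fst ` Bad a b)" by (rule openE) blast
  then obtain d where d: "d > 0" "ball 0 d \<subseteq> - (\<Union>(a, b)\<in>Pr. fst ` Bad a b)" by (elim exE conjE)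
  define r where "r = min (d / 2) 1"
  have r: "0 < r" "r \<le> 1" "r \<in> ball 0 d" using d(1) by (auto simp: r_def)
  have FG: "F a b r t \<in> G" if ab: "{a, b} \<union> {u, v} \<in> K" and t: "0 \<le> t" "t \<le> 1" for a b t
  proof (rule ccontr)
    assume "F a b r t \<notin> G"
    then have "(r, t) \<in> Bad a b" using r t by (simp add: Bad_def)
    then have "r \<in> fst ` Bad a b" by force
    then have "r \<in> (\<Union>(a, b)\<in>Pr. fst ` Bad a b)" using ab by (auto simp: Pr_def)
    then show False using d(2) r(3) by blast
  qed
  have \<xi>F: "\<xi> a (F a b r t) = r * (1 - t)" "\<xi> b (F a b r t) = r * t"
    if ab: "a \<noteq> b" "\<not> {u, v} \<subseteq> {a, b}" and t: "0 \<le> t" "t \<le> 1" for a b t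
  proof -
    have m: "min (F a b r t u) (F a b r t v) = (1 - r) * (1 / card {u, v})"
      using ab t r by (auto simp: F_def \<beta>_eq min_def)
    show "\<xi> a (F a b r t) = r * (1 - t)" "\<xi> b (F a b r t) = r * t"
      using ab(1) unfolding \<xi>_def m by (auto simp: F_def \<beta>_eq)
  qed
  \<comment> \<open>The sign of the section at the shrunken copy of the vertex \<open>a\<close>,
    taken in the open set belonging to \<open>a\<close>. Outside the link the value is irrelevant
    and set to 1.\<close>
  define h where "h a = (if {a} \<union> {u, v} \<in> K \<and> \<not> {u, v} \<subseteq> {a} then S a (g' (F a a r 0)) else 1)" for a
  have \<xi>\<beta>: "\<xi> a \<beta> = 0" for a by (auto simp: \<xi>_def \<beta>_eq)
  have inY: "g' x \<in> Y" if "x \<in> G" "0 < \<xi> a x" for x a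
    by (rule g'Y[OF that(1)]) (use \<xi>\<beta>[of a] that(2) in auto)
  \<comment> \<open>A continuous function with values in {1, -1} is constant on a connected part of
    the shrunken edge, as long as the open set of \<open>c\<close> is not left.\<close>
  have const: "S c (g' (F a b r t)) = S c (g' (F a b r t'))"
    if ab: "{a, b} \<union> {u, v} \<in> K" and c: "c \<in> vertices K" and T: "T \<subseteq> {0..1}" "connected T" "t \<in> T" "t' \<in> T"
      and pos: "\<And>x. x \<in> T \<Longrightarrow> 0 < \<xi> c (F a b r x)" for a b c t t' T
  proof -
    have FGT: "F a b r x \<in> G" if "x \<in> T" for x using FG[OF ab] T(1) that by auto
    have inYT: "g' (F a b r x) \<in> Y" if "x \<in> T" for x by (rule inY[OF FGT[OF that] pos[OF that]])
    have "continuous_on T (\<lambda>x. g' (F a b r x))"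
    proof (rule continuous_on_compose2[of G g'])
      show "continuous_on G g'" by (rule cg')
      show "continuous_on T (F a b r)"
        unfolding F_def by (intro continuous_on_coordinatewise_then_product continuous_intros)
    qed (use FGT in auto)
    then have "continuous_on T (\<lambda>x. S c (g' (F a b r x)))"
      by (rule continuous_on_compose2[OF S1[OF c]]) (rule image_subsetI, simp add: inYT pos gg' FGT)
    moreover have "(\<lambda>x. S c (g' (F a b r x))) ` T \<subseteq> {1, -1}"
    proof (rule image_subsetI)
      fix x assume x: "x \<in> T"
      then have "0 < \<xi> c (g (g' (F a b r x)))" using pos FGT gg' by simp
      from S2[OF c inYT[OF x] this] show "S c (g' (F a b r x)) \<in> {1, -1}" by auto
    qed
    then have "finite ((\<lambda>x. S c (g' (F a b r x))) ` T)" using finite_subset by blast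
    ultimately have "(\<lambda>x. S c (g' (F a b r x))) constant_on T"
      using continuous_finite_range_constant T(2) by blast
    then show ?thesis using T by (auto simp: constant_on_def)
  qed
  have Faa: "F a a r 0 = F a b r 0" "F b b r 0 = F a b r 1" for a b by (auto simp: F_def fun_eq_iff)
  have \<xi>a: "0 < \<xi> a (F a a r 0)" if "\<not> {u, v} \<subseteq> {a}" for a
  proof -
    have "min (F a a r 0 u) (F a a r 0 v) = (1 - r) * (1 / card {u, v})"
      using that r(1) by (cases "u = a"; cases "v = a") (simp_all add: F_def \<beta>_eq min_def field_simps)
    then show ?thesis using r(1) unfolding \<xi>_def by (cases "a \<in> {u, v}") (simp_all add: F_def \<beta>_eq)
  qed
  have Saa: "S a (g' (F a a r 0)) = 1 \<or> S a (g' (F a a r 0)) = -1"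
    if a: "{a} \<union> {u, v} \<in> K" "\<not> {u, v} \<subseteq> {a}" for a
  proof -
    have F: "F a a r 0 \<in> G" using a(1) by (intro FG) simp_all
    have V: "a \<in> vertices K" using a(1) face_in_vertices by blast
    have "0 < \<xi> a (g (g' (F a a r 0)))" using \<xi>a[OF a(2)] gg'[OF F] by simp
    from S2[OF V inY[OF F \<xi>a[OF a(2)]] this] show ?thesis .
  qed
  show thesis
  proof (rule that[of h])
    fix a
    show "h a = 1 \<or> h a = -1"
    proof (cases "{a} \<union> {u, v} \<in> K \<and> \<not> {u, v} \<subseteq> {a}")
      case True
      then have "S a (g' (F a a r 0)) = 1 \<or> S a (g' (F a a r 0)) = -1" by (intro Saa) simp_all
      then show ?thesis using True by (simp add: h_def)
    next
      case False
      then show ?thesis by (simp only: h_def if_False) simp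
    qed
  next
    fix a b assume ab: "{a, b} \<union> {u, v} \<in> K" "\<not> {u, v} \<subseteq> {a, b}"
    have V: "a \<in> vertices K" "b \<in> vertices K" using ab face_in_vertices by blast+
    have "{a} \<union> {u, v} \<in> K" "{b} \<union> {u, v} \<in> K" by (rule face_subset[OF ab(1)]; blast)+
    then have h: "h a = S a (g' (F a a r 0))" "h b = S b (g' (F b b r 0))"
      using ab(2) by (auto simp: h_def)
    show "\<kappa> a b = h a * h b"
    proof (cases "a = b")
      case True
      have sq: "h a * h a = 1"
      proof -
        have "S a (g' (F a a r 0)) = 1 \<or> S a (g' (F a a r 0)) = -1"
          by (rule Saa) (use ab True in simp_all)
        then show ?thesis unfolding h(1) by auto
      qed
      have "\<kappa> a a * \<kappa> a a = \<kappa> a a" using cocycle[of a a a] ab True by simp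
      then have "\<kappa> a a = 1" using sign[of a a] by auto
      then show ?thesis using sq True by simp
    next
      case False
      \<comment> \<open>The open set of \<open>a\<close> contains the first half of the shrunken
        edge and that of \<open>b\<close> the second half. Both signs are therefore transported to
        the midpoint, where the transition rule compares them.\<close>
      note pos = \<xi>F[OF False ab(2)]
      have m: "F a b r (1/2) \<in> G" using FG[OF ab(1)] by simp
      have "h a = S a (g' (F a b r (1/2)))" unfolding h Faa(1)[of a b]
        by (rule const[OF ab(1) V(1), of "{0..1/2}"]) (use pos(1) r in auto)
      moreover have "h b = S b (g' (F a b r (1/2)))" unfolding h Faa(2)[of b a]
        by (rule const[OF ab(1) V(2), of "{1/2..1}"]) (use pos(2) r in auto)
      moreover have mpos: "0 < \<xi> a (F a b r (1/2))" "0 < \<xi> b (F a b r (1/2))"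
        using pos[of "1/2"] r by auto
      moreover have "S a (g' (F a b r (1/2))) = \<kappa> a b * S b (g' (F a b r (1/2)))"
        by (rule S3[OF V inY[OF m mpos(1)]]) (use mpos gg'[OF m] in auto)
      moreover have "S b (g' (F a b r (1/2))) = 1 \<or> S b (g' (F a b r (1/2))) = -1"
        by (rule S2[OF V(2) inY[OF m mpos(2)]]) (use mpos gg'[OF m] in auto)
      ultimately show ?thesis by auto
    qed
  qed
qed


text \<open>A set \<open>A\<close> closed under adjacency in the link and the rest of the link split
  the punctured ball into two open sets: the points with positive weight on \<open>A\<close> and
  those with positive weight on the rest. They are disjoint because the support of a point is a
  face. Each is nonempty if its set of vertices is, since the barycentre can be moved a little
  towards such a vertex.\<close>

lemma vertex_link_connected:
  assumes u: "{u} \<in> K" and A: "\<And>a. a \<in> A \<Longrightarrow> a \<noteq> u \<and> {a, u} \<in> K" "A \<noteq> {}"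
    and closed: "\<And>a b. a \<in> A \<Longrightarrow> b \<noteq> u \<Longrightarrow> {a, b, u} \<in> K \<Longrightarrow> b \<in> A"
    and b: "b \<noteq> u" "{b, u} \<in> K"
  shows "b \<in> A"
proof (rule ccontr)
  assume bA: "b \<notin> A"
  define \<beta> where "\<beta> = barycenter {u}"
  have \<beta>_eq: "\<beta> x = of_bool (x = u)" for x by (simp add: \<beta>_def barycenter_def)
  obtain Y :: "(real \<times> real \<times> real) set" and g g' G where Y: "simply_connected Y" "open Y" and cg: "continuous_on Y g"
    and gY: "\<And>y. y \<in> Y \<Longrightarrow> g y \<in> open_star {u}" "\<And>y. y \<in> Y \<Longrightarrow> g y \<noteq> \<beta>"
    and G: "openin (top_of_set (realize K)) G" "\<beta> \<in> G" and cg': "continuous_on G g'"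
    and g'Y: "\<And>x. x \<in> G \<Longrightarrow> x \<noteq> \<beta> \<Longrightarrow> g' x \<in> Y" and gg': "\<And>x. x \<in> G \<Longrightarrow> g (g' x) = x"
    by (rule punctured_chart[OF u insert_not_empty, folded \<beta>_def]) (rule that)
  have contx: "continuous_on Y (\<lambda>y. g y a)" for a
    by (rule continuous_on_compose2[OF continuous_on_product_coordinates cg]) simp
  define E where "E B = (\<Union>a\<in>B. Y \<inter> (\<lambda>y. g y a) -` {0<..})" for B
  have opE: "openin (top_of_set Y) (E B)" for B unfolding E_def by (intro openin_Union ballI)
      (auto intro!: continuous_openin_preimage[OF contx, where T = UNIV])
  have ne: "E B \<noteq> {}" if a: "a \<in> B" "a \<noteq> u" "{a, u} \<in> K" for a B
  proof -
    have aK: "{a} \<in> K" using face_subset[OF a(3)] by blast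
    have sup: "{v. \<beta> v \<noteq> 0} \<union> {v. barycenter {a} v \<noteq> 0} \<in> K"
      using a(3) unfolding \<beta>_def barycenter_realize(2)[OF u insert_not_empty] barycenter_realize(2)[OF aK insert_not_empty]
      by (simp add: insert_commute)
    obtain r where r: "0 < r" "r \<le> 1" "(\<lambda>v. (1 - r) * \<beta> v + r * barycenter {a} v) \<in> G"
      by (rule segment_meets_open[OF G barycenter_realize(1)[OF aK insert_not_empty] sup])
    define x where "x = (\<lambda>v. (1 - r) * \<beta> v + r * barycenter {a} v)"
    have x: "x \<in> G" "0 < x a" using r a(2) by (simp_all add: x_def \<beta>_eq barycenter_def)
    then have "x \<noteq> \<beta>" using a(2) \<beta>_eq[of a] by auto
    then have "g' x \<in> Y \<inter> (\<lambda>y. g y a) -` {0<..}" using g'Y gg' x by simp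
    then show ?thesis using a(1) by (auto simp: E_def)
  qed
  define B where "B = {b. b \<noteq> u \<and> {b, u} \<in> K \<and> b \<notin> A}"
  have face: "{a, b, u} \<in> K" if "y \<in> Y" "g y a > 0" "g y b > 0" for y a b
  proof (rule face_subset[OF realizeD(2)])
    show "g y \<in> realize K" using gY[OF that(1)] by (simp add: open_star_def)
    show "{a, b, u} \<subseteq> {v. g y v \<noteq> 0}" using that gY[OF that(1)] by (auto simp: open_star_def)
  qed
  have cover: "Y \<subseteq> E A \<union> E B"
  proof
    fix y assume y: "y \<in> Y"
    let ?x = "g y"
    have x: "?x \<in> realize K" using gY[OF y] by (simp add: open_star_def)
    have "\<exists>a. a \<noteq> u \<and> ?x a > 0"
    proof (rule ccontr)
      assume no: "\<not> ?thesis"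
      have 0: "?x a = 0" if "a \<noteq> u" for a using no that realizeD(1)[OF x, of a] by force
      have "(\<Sum>v\<in>vertices K. ?x v) = (\<Sum>v\<in>{u}. ?x v)"
        using 0 face_in_vertices[OF u] finite_vertices by (intro sum.mono_neutral_right) auto
      then have "?x u = 1" using realizeD(3)[OF x] by simp
      then have "?x = \<beta>" using 0 by (auto simp: fun_eq_iff \<beta>_eq)
      then show False using gY[OF y] by simp
    qed
    then obtain a where a: "a \<noteq> u" "?x a > 0" by blast
    have "{a, u} \<in> K" using face[OF y a(2) a(2)] by simp
    then show "y \<in> E A \<union> E B" using a y by (auto simp: E_def B_def)
  qed
  have disj: "E A \<inter> E B \<inter> Y = {}"
  proof (rule ccontr)
    assume "E A \<inter> E B \<inter> Y \<noteq> {}"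
    then obtain y a c where y: "y \<in> Y" "a \<in> A" "g y a > 0" "c \<in> B" "g y c > 0" by (auto simp: E_def)
    then have "c \<in> A" using closed[OF y(2), of c] face[OF y(1,3,5)] by (auto simp: B_def)
    then show False using y by (simp add: B_def)
  qed
  obtain a where "a \<in> A" using A(2) by blast
  then have "E A \<noteq> {}" "E B \<noteq> {}" using ne[of a A] ne[of b B] A(1)[of a] b bA by (auto simp: B_def)
  moreover have "E A \<subseteq> Y" "E B \<subseteq> Y" by (auto simp: E_def)
  ultimately show False
    using simply_connected_imp_connected[OF Y(1)] opE[of A] opE[of B] cover disj unfolding connected_openin by blast
qed

text \<open>The cocycle separating \<open>A\<close> from its complement in the suspension \<open>\<partial>{u, v} * link\<close>
  is a coboundary only if one of the two parts is empty.\<close>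

lemma edge_link_connected:
  assumes uv: "{u, v} \<in> K" "u \<noteq> v"
    and A: "\<And>a. a \<in> A \<Longrightarrow> a \<notin> {u, v} \<and> {a, u, v} \<in> K" "A \<noteq> {}"
    and closed: "\<And>a b. a \<in> A \<Longrightarrow> b \<notin> {u, v} \<Longrightarrow> {a, b, u, v} \<in> K \<Longrightarrow> b \<in> A"
    and b: "b \<notin> {u, v}" "{b, u, v} \<in> K"
  shows "b \<in> A"
proof (rule ccontr)
  assume bA: "b \<notin> A"
  define D where "D = {b. b \<notin> {u, v} \<and> {b, u, v} \<in> K \<and> b \<notin> A}"
  \<comment> \<open>Negative exactly on the edges from the suspension point \<open>u\<close> to the
    part \<open>D\<close> of the link outside \<open>A\<close>.\<close>
  define \<kappa> :: "'a \<Rightarrow> 'a \<Rightarrow> real"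
    where "\<kappa> x y = (if x = u \<and> y \<in> D \<or> y = u \<and> x \<in> D then -1 else 1)" for x y
  have uD: "u \<notin> D" by (simp add: D_def)
  obtain h where h: "\<And>a. h a = 1 \<or> h a = (-1::real)"
    "\<And>a b. {a, b} \<union> {u, v} \<in> K \<Longrightarrow> \<not> {u, v} \<subseteq> {a, b} \<Longrightarrow> \<kappa> a b = h a * h b"
  proof (rule sign_cocycle_link[OF uv(1), where \<kappa> = \<kappa>])
    show "\<kappa> a b = 1 \<or> \<kappa> a b = -1" for a b by (simp add: \<kappa>_def)
    fix x y z assume f: "{x, y, z} \<union> {u, v} \<in> K" and nf: "\<not> {u, v} \<subseteq> {x, y, z}"
    have eq: "p \<in> D \<longleftrightarrow> q \<in> D" if "p \<in> {x, y, z}" "q \<in> {x, y, z}" "p \<notin> {u, v}" "q \<notin> {u, v}" for p q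
    proof -
      have K: "{p, q, u, v} \<in> K" "{q, p, u, v} \<in> K" "{p, u, v} \<in> K" "{q, u, v} \<in> K"
        using that by (auto intro!: face_subset[OF f])
      show ?thesis using closed[of p q] closed[of q p] K that by (auto simp: D_def)
    qed
    show "\<kappa> x y * \<kappa> y z = \<kappa> x z"
    proof (cases "u \<in> {x, y, z}")
      case False
      then show ?thesis by (auto simp: \<kappa>_def)
    next
      case True
      then have nv: "v \<notin> {x, y, z}" using nf by blast
      have eq': "p \<in> D \<longleftrightarrow> q \<in> D" if "p \<in> {x, y, z}" "q \<in> {x, y, z}" "p \<noteq> u" "q \<noteq> u" for p q
        using eq[OF that(1,2)] that nv by auto
      show ?thesis using eq'[of x y] eq'[of y z] eq'[of x z] uD
        by (cases "x = u"; cases "y = u"; cases "z = u") (auto simp: \<kappa>_def)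
    qed
  qed (rule that)
  obtain a where a: "a \<in> A" using A(2) by blast
  have aD: "a \<notin> D" "a \<notin> {u, v}" "{a, u, v} \<in> K" using a A(1) by (auto simp: D_def)
  have bD: "b \<in> D" using b bA by (simp add: D_def)
  have face: "{x, c} \<union> {u, v} \<in> K" if "x \<in> {u, v}" "{c, u, v} \<in> K" for x c
    using that(1) by (intro face_subset[OF that(2)]) auto
  have "\<kappa> u b = h u * h b" "\<kappa> v b = h v * h b" "\<kappa> u a = h u * h a" "\<kappa> v a = h v * h a"
    using uv(2) b aD by (auto intro!: h(2) face)
  then have e: "h u * h b = -1" "h v * h b = 1" "h u * h a = 1" "h v * h a = 1"
    using aD bD uv(2) uD b(1) by (auto simp: \<kappa>_def)
  then show False using h(1)[of u] h(1)[of v] h(1)[of a] h(1)[of b] by auto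
qed

end

section \<open>The Euler characteristic of vertex links\<close>

lemma card_sym_diff:
  assumes "finite X" "finite Y"
  shows "card (sym_diff X Y) + 2 * card (X \<inter> Y) = card X + card Y"
proof -
  have "card (sym_diff X Y) = card (X - Y) + card (Y - X)"
    using assms by (intro card_Un_disjoint) auto
  moreover have "card X = card (X - Y) + card (X \<inter> Y)"
    using assms card_Int_Diff by (metis add.commute)
  moreover have "card Y = card (Y - X) + card (X \<inter> Y)"
    using assms card_Int_Diff by (metis add.commute inf_commute)
  ultimately show ?thesis by simp
qed

lemma odd_card_sym_diff:
  "finite X \<Longrightarrow> finite Y \<Longrightarrow> odd (card (sym_diff X Y)) \<longleftrightarrow> odd (card X) \<noteq> odd (card Y)"
  using card_sym_diff[of X Y] by presburger

lemma odd_card_filter3: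
  assumes "a \<noteq> b" "b \<noteq> c" "a \<noteq> c"
  shows "odd (card {e \<in> {a, b, c}. P e}) \<longleftrightarrow> (P a = (P b = P c))"
proof -
  have "{e \<in> {a, b, c}. P e} = (if P a then {a} else {}) \<union> (if P b then {b} else {}) \<union> (if P c then {c} else {})"
    by auto
  then have "card {e \<in> {a, b, c}. P e} = of_bool (P a) + of_bool (P b) + of_bool (P c)"
    using assms by (cases "P a"; cases "P b"; cases "P c") simp_all
  then show ?thesis by simp
qed

text \<open>Rank and nullity over the field with two elements, for subsets under symmetric difference.\<close>

lemma card_kernel_image_sym_diff:
  fixes f :: "'a set \<Rightarrow> 'b set"
  assumes A: "finite A"
    and f: "\<And>X Y. X \<subseteq> A \<Longrightarrow> Y \<subseteq> A \<Longrightarrow> f (sym_diff X Y) = sym_diff (f X) (f Y)"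
  shows "2 ^ card A = card {X. X \<subseteq> A \<and> f X = {}} * card (f ` Pow A)"
proof -
  \<comment> \<open>Translating by one preimage of \<open>y\<close> carries the fibre over
    \<open>y\<close> to the kernel.\<close>
  have fibre: "card {X \<in> Pow A. f X = y} = card {X. X \<subseteq> A \<and> f X = {}}" if "y \<in> f ` Pow A" for y
  proof -
    from that obtain X0 where X0: "X0 \<subseteq> A" "f X0 = y" by auto
    show ?thesis
    proof (rule bij_betw_same_card[of "\<lambda>X. sym_diff X X0"], rule bij_betwI[where g = "\<lambda>X. sym_diff X X0"])
      show "(\<lambda>X. sym_diff X X0) \<in> {X \<in> Pow A. f X = y} \<rightarrow> {X. X \<subseteq> A \<and> f X = {}}" using X0 f by auto
      show "(\<lambda>X. sym_diff X X0) \<in> {X. X \<subseteq> A \<and> f X = {}} \<rightarrow> {X \<in> Pow A. f X = y}"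
      proof
        fix X assume X: "X \<in> {X. X \<subseteq> A \<and> f X = {}}"
        then have "f (sym_diff X X0) = sym_diff (f X) (f X0)" using X0 by (intro f) auto
        then show "sym_diff X X0 \<in> {X \<in> Pow A. f X = y}" using X X0 by auto
      qed
    qed auto
  qed
  have "2 ^ card A = card (Pow A)" using A by (simp add: card_Pow)
  also have "\<dots> = (\<Sum>X\<in>Pow A. 1)" by simp
  also have "\<dots> = (\<Sum>y\<in>f ` Pow A. \<Sum>X\<in>{X \<in> Pow A. f X = y}. 1)" using A by (intro sum.image_gen) simp
  also have "\<dots> = (\<Sum>y\<in>f ` Pow A. card {X. X \<subseteq> A \<and> f X = {}})" using fibre by (intro sum.cong) auto
  finally show ?thesis by simp
qed

text \<open>What the counting needs from the topology, phrased for the graph alone. In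
  \<open>triangle_nb\<close> the two vertices p, q complete the triangle to its two tetrahedra, and
  flagness makes them non-adjacent. The axioms \<open>vertex_conn\<close> and
  \<open>edge_conn\<close> express connectedness of links by sets closed under adjacency. The axiom
  \<open>sign_cocycle\<close> is the vanishing of H^1 of a vertex link over the field with two
  elements, written multiplicatively.\<close>

locale flag_3manifold_graph =
  fixes V :: "'a set" and adj :: "'a \<Rightarrow> 'a \<Rightarrow> bool"
  assumes finite_V: "finite V"
    and adj_sym: "adj x y \<Longrightarrow> adj y x"
    and adj_irrefl: "\<not> adj x x"
    and adj_V: "adj x y \<Longrightarrow> x \<in> V"
    and vertex_nb: "x \<in> V \<Longrightarrow> \<exists>y. adj x y"
    and edge_nb: "adj x y \<Longrightarrow> \<exists>z. adj x z \<and> adj y z"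
    and triangle_nb: "adj x y \<Longrightarrow> adj y z \<Longrightarrow> adj x z \<Longrightarrow>
      \<exists>p q. p \<noteq> q \<and> \<not> adj p q \<and> {w. adj x w \<and> adj y w \<and> adj z w} = {p, q}"
    and vertex_conn: "u \<in> V \<Longrightarrow> A \<subseteq> {x. adj u x} \<Longrightarrow> A \<noteq> {} \<Longrightarrow>
      (\<And>a b. a \<in> A \<Longrightarrow> adj u b \<Longrightarrow> adj a b \<Longrightarrow> b \<in> A) \<Longrightarrow> A = {x. adj u x}"
    and edge_conn: "adj u v \<Longrightarrow> A \<subseteq> {x. adj u x \<and> adj v x} \<Longrightarrow> A \<noteq> {} \<Longrightarrow>
      (\<And>a b. a \<in> A \<Longrightarrow> adj u b \<Longrightarrow> adj v b \<Longrightarrow> adj a b \<Longrightarrow> b \<in> A) \<Longrightarrow> A = {x. adj u x \<and> adj v x}"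
    and sign_cocycle: "u \<in> V \<Longrightarrow> (\<And>a b. \<kappa> a b = 1 \<or> \<kappa> a b = (-1::real)) \<Longrightarrow>
      (\<And>a b c. adj u a \<Longrightarrow> adj u b \<Longrightarrow> adj u c \<Longrightarrow> a = b \<or> adj a b \<Longrightarrow> b = c \<or> adj b c \<Longrightarrow> a = c \<or> adj a c \<Longrightarrow>
         \<kappa> a b * \<kappa> b c = \<kappa> a c) \<Longrightarrow>
      \<exists>h. (\<forall>a. h a = 1 \<or> h a = -1) \<and> (\<forall>a b. adj u a \<longrightarrow> adj u b \<longrightarrow> adj a b \<longrightarrow> \<kappa> a b = h a * h b)"
begin

definition nb :: "'a \<Rightarrow> 'a set" where "nb u = {x. adj u x}"

abbreviation lk :: "'a \<Rightarrow> 'a \<Rightarrow> 'a set" where "lk u v \<equiv> nb u \<inter> nb v"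

definition link_edges :: "'a \<Rightarrow> 'a set set" where
  "link_edges u = {{x, y} |x y. adj u x \<and> adj u y \<and> adj x y}"

definition link_triangles :: "'a \<Rightarrow> 'a set set" where
  "link_triangles u = {{x, y, z} |x y z. adj u x \<and> adj u y \<and> adj u z \<and> adj x y \<and> adj y z \<and> adj x z}"

lemma adj_commute: "adj x y \<longleftrightarrow> adj y x"
  using adj_sym by blast

lemma adj_V': "adj x y \<Longrightarrow> y \<in> V"
  using adj_V adj_sym by blast

lemma adj_neq: "adj x y \<Longrightarrow> x \<noteq> y"
  using adj_irrefl by blast

lemma finite_nb: "finite (nb u)"
  by (rule finite_subset[OF _ finite_V]) (auto simp: nb_def adj_V')

lemma link_edges_subset: "link_edges u \<subseteq> Pow (nb u)"
  by (auto simp: link_edges_def nb_def)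

lemma link_triangles_subset: "link_triangles u \<subseteq> Pow (nb u)"
  by (auto simp: link_triangles_def nb_def)

lemma finite_link_edges: "finite (link_edges u)"
  using link_edges_subset finite_nb by (meson finite_Pow_iff finite_subset)

lemma finite_link_triangles: "finite (link_triangles u)"
  using link_triangles_subset finite_nb by (meson finite_Pow_iff finite_subset)

lemma mem_link_edges: "{x, y} \<in> link_edges u \<longleftrightarrow> adj u x \<and> adj u y \<and> adj x y"
  by (auto simp: link_edges_def doubleton_eq_iff dest: adj_sym)

lemma link_edge_in_triangle:
  assumes "adj u x" "adj u y" "adj u z" "adj x y" "adj y z" "adj x z"
  shows "e \<in> link_edges u \<and> e \<subseteq> {x, y, z} \<longleftrightarrow> e \<in> {{x, y}, {y, z}, {x, z}}"
proof
  assume e: "e \<in> link_edges u \<and> e \<subseteq> {x, y, z}"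
  then obtain p q where "e = {p, q}" "p \<noteq> q" "p \<in> {x, y, z}" "q \<in> {x, y, z}"
    using adj_neq by (auto simp: link_edges_def)
  then show "e \<in> {{x, y}, {y, z}, {x, z}}" by (auto simp: doubleton_eq_iff)
next
  assume "e \<in> {{x, y}, {y, z}, {x, z}}"
  then show "e \<in> link_edges u \<and> e \<subseteq> {x, y, z}" using assms by (auto simp: mem_link_edges)
qed

text \<open>A triangle of the link of \<open>u\<close> on the edge {x, y} amounts to a common
  neighbour of the triangle u, x, y.\<close>

lemma link_triangles_on_edge:
  assumes "adj u x" "adj u y" "adj x y"
  obtains p q where "p \<noteq> q" "\<not> adj p q" "{w. adj u w \<and> adj x w \<and> adj y w} = {p, q}"
    "{t \<in> link_triangles u. {x, y} \<subseteq> t} = {{x, y, p}, {x, y, q}}" "{x, y, p} \<noteq> {x, y, q}"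
proof -
  obtain p q where pq: "p \<noteq> q" "\<not> adj p q" "{w. adj u w \<and> adj x w \<and> adj y w} = {p, q}"
    using triangle_nb[of u x y] assms by blast
  then have a: "adj u p" "adj x p" "adj y p" "adj u q" "adj x q" "adj y q" by blast+
  have "{t \<in> link_triangles u. {x, y} \<subseteq> t} = {{x, y, p}, {x, y, q}}"
  proof (intro equalityI subsetI)
    fix t assume "t \<in> {t \<in> link_triangles u. {x, y} \<subseteq> t}"
    then obtain x1 y1 z1 where t: "t = {x1, y1, z1}" "adj u x1" "adj u y1" "adj u z1" "adj x1 y1" "adj y1 z1" "adj x1 z1"
      "x \<in> t" "y \<in> t" by (auto simp: link_triangles_def)
    then have xy: "{x, y} \<subseteq> {x1, y1, z1}" "x \<noteq> y" using adj_neq[OF assms(3)] by auto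
    consider "{x, y} = {x1, y1}" | "{x, y} = {x1, z1}" | "{x, y} = {y1, z1}"
      using xy by (auto simp: insert_commute)
    then have "\<exists>w. t = {x, y, w} \<and> adj u w \<and> adj x w \<and> adj y w"
    proof cases
      case 1
      then show ?thesis using t by (intro exI[of _ z1]) (auto simp: doubleton_eq_iff dest: adj_sym)
    next
      case 2
      then show ?thesis using t by (intro exI[of _ y1]) (auto simp: doubleton_eq_iff dest: adj_sym)
    next
      case 3
      then show ?thesis using t by (intro exI[of _ x1]) (auto simp: doubleton_eq_iff dest: adj_sym)
    qed
    then obtain w where w: "t = {x, y, w}" "adj u w" "adj x w" "adj y w" by blast
    then have "w \<in> {p, q}" using pq(3) by blast
    then show "t \<in> {{x, y, p}, {x, y, q}}" using w by auto
  next
    fix t assume "t \<in> {{x, y, p}, {x, y, q}}"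
    then show "t \<in> {t \<in> link_triangles u. {x, y} \<subseteq> t}"
      using a assms by (auto simp: link_triangles_def)
  qed
  moreover have "{x, y, p} \<noteq> {x, y, q}"
  proof
    assume "{x, y, p} = {x, y, q}"
    then have "p \<in> {x, y, q}" by blast
    then show False using pq(1) adj_neq[OF a(2)] adj_neq[OF a(3)] by blast
  qed
  ultimately show thesis using that pq by blast
qed

lemma card_link_triangles_on_edge:
  assumes "e \<in> link_edges u"
  shows "card {t \<in> link_triangles u. e \<subseteq> t} = 2"
proof -
  obtain x y where xy: "e = {x, y}" "adj u x" "adj u y" "adj x y"
    using assms by (auto simp: link_edges_def)
  obtain p q where "{t \<in> link_triangles u. {x, y} \<subseteq> t} = {{x, y, p}, {x, y, q}}" "{x, y, p} \<noteq> {x, y, q}"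
    by (rule link_triangles_on_edge[OF xy(2-4)])
  then show ?thesis using xy(1) by simp
qed

lemma link_triangle_distinct:
  assumes "adj x y" "adj y z" "adj x z"
  shows "{x, y} \<noteq> {y, z}" "{y, z} \<noteq> {x, z}" "{x, y} \<noteq> {x, z}"
  using assms adj_neq by (auto simp: doubleton_eq_iff)

lemma card_link_edges_in_triangle:
  assumes "t \<in> link_triangles u"
  shows "card {e \<in> link_edges u. e \<subseteq> t} = 3"
proof -
  obtain x y z where t: "t = {x, y, z}" "adj u x" "adj u y" "adj u z" "adj x y" "adj y z" "adj x z"
    using assms by (auto simp: link_triangles_def)
  have "{e \<in> link_edges u. e \<subseteq> t} = {{x, y}, {y, z}, {x, z}}"
    using link_edge_in_triangle[OF t(2-7)] unfolding t(1) by blast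
  then show ?thesis using link_triangle_distinct[OF t(5-7)] by simp
qed

lemma link_edges_triangles: "2 * card (link_edges u) = 3 * card (link_triangles u)"
proof -
  have "(\<Sum>t\<in>link_triangles u. card {e \<in> link_edges u. e \<subseteq> t}) = 2 * card (link_edges u)"
    using finite_link_edges finite_link_triangles card_link_triangles_on_edge
    by (intro sum_multicount) auto
  then show ?thesis using card_link_edges_in_triangle by simp
qed

text \<open>Adjacent triangles of a vertex link lie in the same class: first around each vertex,
  then along the edges of the link.\<close>

lemma link_strongly_connected:
  assumes u: "u \<in> V" and Q: "Q \<subseteq> link_triangles u" "Q \<noteq> {}"
    and closed: "\<And>t t' e. t \<in> Q \<Longrightarrow> t' \<in> link_triangles u \<Longrightarrow> e \<in> link_edges u \<Longrightarrow> e \<subseteq> t \<Longrightarrow> e \<subseteq> t' \<Longrightarrow> t' \<in> Q"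
  shows "Q = link_triangles u"
proof -
  \<comment> \<open>If \<open>Q\<close> contains one triangle at \<open>a\<close>, it contains all
    of them: the vertices \<open>b\<close> for which some triangle of \<open>Q\<close> contains {a,
    b} are closed under adjacency in the link of the edge {u, a}, and that link is
    connected.\<close>
  have around: "{a, b, c} \<in> Q"
    if a: "adj u a" "t \<in> Q" "a \<in> t" and bc: "adj u b" "adj u c" "adj a b" "adj b c" "adj a c" for a b c t
  proof -
    define P where "P = {b. \<exists>x. {a, b, x} \<in> Q \<and> adj u b \<and> adj a b}"
    obtain x y z where t: "t = {x, y, z}" "adj u x" "adj u y" "adj u z" "adj x y" "adj y z" "adj x z"
      using a Q(1) by (auto simp: link_triangles_def)
    have "P \<noteq> {}"
    proof -
      have Q': "{x, y, z} \<in> Q" "{y, x, z} \<in> Q" "{z, x, y} \<in> Q" using a(2) t(1) by (auto simp: insert_commute)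
      from a(3) t(1) consider "a = x" | "a = y" | "a = z" by blast
      then show ?thesis
      proof cases
        case 1
        then have "y \<in> P" unfolding P_def using Q'(1) t(3,5) by blast
        then show ?thesis by blast
      next
        case 2
        then have "x \<in> P" unfolding P_def using Q'(2) t(2) adj_sym[OF t(5)] by blast
        then show ?thesis by blast
      next
        case 3
        then have "x \<in> P" unfolding P_def using Q'(3) t(2) adj_sym[OF t(7)] by blast
        then show ?thesis by blast
      qed
    qed
    moreover have "b' \<in> P" if "b \<in> P" "adj u b'" "adj a b'" "adj b b'" for b b'
    proof -
      from that obtain x where x: "{a, b, x} \<in> Q" "adj u b" "adj a b" by (auto simp: P_def)
      have "{a, b, b'} \<in> link_triangles u" using a(1) x that by (auto simp: link_triangles_def)
      then have "{a, b, b'} \<in> Q"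
        using closed[OF x(1), of "{a, b, b'}" "{a, b}"] x a(1) by (auto simp: mem_link_edges)
      then show ?thesis using that by (auto simp: P_def insert_commute)
    qed
    ultimately have "P = {x. adj u x \<and> adj a x}"
      using edge_conn[OF a(1), of P] by (auto simp: P_def)
    then obtain x where x: "{a, b, x} \<in> Q" using bc by (auto simp: P_def)
    have "{a, b, c} \<in> link_triangles u" using a(1) bc by (auto simp: link_triangles_def)
    then show ?thesis
      using closed[OF x(1), of "{a, b, c}" "{a, b}"] bc a(1) by (auto simp: mem_link_edges)
  qed
  \<comment> \<open>The vertices reached by \<open>Q\<close>. An edge from such a vertex lies in a
    link triangle, which is in \<open>Q\<close> by \<open>around\<close>, so its other end is
    reached as well.\<close>
  define A where "A = {a. \<exists>t\<in>Q. a \<in> t}"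
  have AN: "A \<subseteq> {x. adj u x}" using Q(1) link_triangles_subset by (auto simp: A_def nb_def)
  obtain t0 where t0: "t0 \<in> Q" using Q(2) by blast
  then have "t0 \<in> link_triangles u" using Q(1) by blast
  then have "t0 \<noteq> {}" by (auto simp: link_triangles_def)
  then have "A \<noteq> {}" using t0 by (auto simp: A_def)
  moreover have "b \<in> A" if ab: "a \<in> A" "adj u b" "adj a b" for a b
  proof -
    have ua: "adj u a" using AN ab by blast
    obtain p q where "{w. adj u w \<and> adj a w \<and> adj b w} = {p, q}"
      using triangle_nb[of u a b] ua ab by blast
    then have "adj u p" "adj a p" "adj b p" by blast+
    moreover obtain t where t: "t \<in> Q" "a \<in> t" using ab by (auto simp: A_def)
    ultimately have "{a, b, p} \<in> Q" by (intro around[OF ua t ab(2) _ ab(3)])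
    then have "\<exists>t\<in>Q. b \<in> t" by (rule bexI[rotated]) simp
    then show ?thesis by (simp add: A_def)
  qed
  ultimately have A: "A = {x. adj u x}" by (intro vertex_conn[OF u AN])
  show ?thesis
  proof
    show "link_triangles u \<subseteq> Q"
    proof
      fix t assume "t \<in> link_triangles u"
      then obtain x y z where t: "t = {x, y, z}" "adj u x" "adj u y" "adj u z" "adj x y" "adj y z" "adj x z"
        by (auto simp: link_triangles_def)
      then obtain s where "s \<in> Q" "x \<in> s" using A by (auto simp: A_def)
      then show "t \<in> Q" unfolding t(1) using around[OF t(2) _ _ t(3-7)] by blast
    qed
  qed (fact Q)
qed


section \<open>Cochains of a vertex link over the field with two elements\<close>

definition cobd0 :: "'a \<Rightarrow> 'a set \<Rightarrow> 'a set set" where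
  "cobd0 u X = {e \<in> link_edges u. odd (card (e \<inter> X))}"

text \<open>A cochain is encoded as the set of simplices on which it is 1, so that addition is
  symmetric difference. With this encoding \<open>cobd0\<close> and \<open>cobd1\<close> are the two
  coboundary maps of the link.\<close>

definition cobd1 :: "'a \<Rightarrow> 'a set set \<Rightarrow> 'a set set" where
  "cobd1 u B = {t \<in> link_triangles u. odd (card {e \<in> B. e \<subseteq> t})}"

lemma finite_link_edge: "e \<in> link_edges u \<Longrightarrow> finite e"
  by (auto simp: link_edges_def)

lemma cobd0_sym_diff: "cobd0 u (sym_diff X Y) = sym_diff (cobd0 u X) (cobd0 u Y)"
proof -
  have "odd (card (e \<inter> sym_diff X Y)) \<longleftrightarrow> odd (card (e \<inter> X)) \<noteq> odd (card (e \<inter> Y))"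
    if "e \<in> link_edges u" for e
  proof -
    have "e \<inter> sym_diff X Y = sym_diff (e \<inter> X) (e \<inter> Y)" by blast
    then show ?thesis using odd_card_sym_diff[of "e \<inter> X" "e \<inter> Y"] finite_link_edge[OF that] by simp
  qed
  then show ?thesis unfolding cobd0_def by blast
qed

lemma cobd1_sym_diff:
  assumes "B \<subseteq> link_edges u" "C \<subseteq> link_edges u"
  shows "cobd1 u (sym_diff B C) = sym_diff (cobd1 u B) (cobd1 u C)"
proof -
  have "odd (card {e \<in> sym_diff B C. e \<subseteq> t}) \<longleftrightarrow> odd (card {e \<in> B. e \<subseteq> t}) \<noteq> odd (card {e \<in> C. e \<subseteq> t})" for t
  proof -
    have eq: "{e \<in> sym_diff B C. e \<subseteq> t} = sym_diff {e \<in> B. e \<subseteq> t} {e \<in> C. e \<subseteq> t}" by blast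
    have "finite {e \<in> B. e \<subseteq> t}" "finite {e \<in> C. e \<subseteq> t}"
      using finite_subset[OF assms(1) finite_link_edges] finite_subset[OF assms(2) finite_link_edges] by simp_all
    then show ?thesis unfolding eq by (rule odd_card_sym_diff)
  qed
  then show ?thesis unfolding cobd1_def by blast
qed

lemma mem_cobd0:
  assumes "adj u x" "adj u y" "adj x y"
  shows "{x, y} \<in> cobd0 u X \<longleftrightarrow> (x \<in> X) \<noteq> (y \<in> X)"
  using assms adj_neq[OF assms(3)] by (auto simp: cobd0_def mem_link_edges Int_insert_left)

lemma mem_cobd1:
  assumes "adj u x" "adj u y" "adj u z" "adj x y" "adj y z" "adj x z" and B: "B \<subseteq> link_edges u"
  shows "{x, y, z} \<in> cobd1 u B \<longleftrightarrow> ({x, y} \<in> B) = (({y, z} \<in> B) = ({x, z} \<in> B))"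
proof -
  have t: "{x, y, z} \<in> link_triangles u" using assms by (auto simp: link_triangles_def)
  have "{e \<in> B. e \<subseteq> {x, y, z}} = {e \<in> {{x, y}, {y, z}, {x, z}}. e \<in> B}"
    using link_edge_in_triangle[OF assms(1-6)] B by blast
  then show ?thesis
    using t odd_card_filter3[OF link_triangle_distinct[OF assms(4-6)], of "\<lambda>e. e \<in> B"]
    by (simp add: cobd1_def)
qed

text \<open>This is H^0: a set of vertices with empty coboundary is closed under adjacency, so in a
  connected link it is empty or everything.\<close>

lemma kernel_cobd0:
  assumes u: "u \<in> V"
  shows "card {X. X \<subseteq> nb u \<and> cobd0 u X = {}} = 2"
proof -
  have "{X. X \<subseteq> nb u \<and> cobd0 u X = {}} = {{}, nb u}"
  proof (intro equalityI subsetI)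
    fix X assume X: "X \<in> {X. X \<subseteq> nb u \<and> cobd0 u X = {}}"
    have "X = nb u" if "X \<noteq> {}" unfolding nb_def
    proof (rule vertex_conn[OF u _ that])
      show "X \<subseteq> {x. adj u x}" using X by (simp add: nb_def)
      fix a b assume ab: "a \<in> X" "adj u b" "adj a b"
      have "adj u a" using X ab by (auto simp: nb_def)
      then show "b \<in> X" using mem_cobd0[of u a b X] ab X by auto
    qed
    then show "X \<in> {{}, nb u}" by blast
  next
    fix X assume "X \<in> {{}, nb u}"
    moreover have "cobd0 u {} = {}" by (simp add: cobd0_def)
    moreover have "cobd0 u (nb u) = {}"
    proof -
      have "e \<notin> cobd0 u (nb u)" for e
      proof
        assume e: "e \<in> cobd0 u (nb u)"
        then obtain x y where "e = {x, y}" "adj u x" "adj u y" "adj x y"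
          by (auto simp: cobd0_def link_edges_def)
        then show False using e mem_cobd0[of u x y "nb u"] by (simp add: nb_def)
      qed
      then show ?thesis by blast
    qed
    ultimately show "X \<in> {X. X \<subseteq> nb u \<and> cobd0 u X = {}}" by blast
  qed
  moreover have "nb u \<noteq> {}" using vertex_nb[OF u] by (auto simp: nb_def)
  ultimately show ?thesis by simp
qed

text \<open>Exactness in the middle, that is, H^1 = 0. One inclusion is the usual fact that the
  coboundary of a coboundary is zero. For the other, a cocycle \<open>B\<close> is read as the sign
  function that is -1 on \<open>B\<close>, and \<open>sign_cocycle\<close> provides the
  potential.\<close>

lemma image_cobd0:
  assumes u: "u \<in> V"
  shows "cobd0 u ` Pow (nb u) = {B. B \<subseteq> link_edges u \<and> cobd1 u B = {}}"
proof (intro equalityI subsetI)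
  fix B assume "B \<in> cobd0 u ` Pow (nb u)"
  then obtain X where X: "B = cobd0 u X" by blast
  have sub: "B \<subseteq> link_edges u" unfolding X by (auto simp: cobd0_def)
  moreover have "t \<notin> cobd1 u B" for t
  proof
    assume t: "t \<in> cobd1 u B"
    then obtain x y z where xyz: "t = {x, y, z}" "adj u x" "adj u y" "adj u z" "adj x y" "adj y z" "adj x z"
      by (auto simp: cobd1_def link_triangles_def)
    show False using t mem_cobd1[OF xyz(2-7) sub]
      mem_cobd0[OF xyz(2,3,5), of X] mem_cobd0[OF xyz(3,4,6), of X] mem_cobd0[OF xyz(2,4,7), of X]
      unfolding xyz(1) X by blast
  qed
  ultimately show "B \<in> {B. B \<subseteq> link_edges u \<and> cobd1 u B = {}}" by blast
next
  fix B assume "B \<in> {B. B \<subseteq> link_edges u \<and> cobd1 u B = {}}"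
  then have B: "B \<subseteq> link_edges u" "cobd1 u B = {}" by auto
  define \<kappa> :: "'a \<Rightarrow> 'a \<Rightarrow> real" where "\<kappa> a b = (if {a, b} \<in> B then -1 else 1)" for a b
  have diag: "{a} \<notin> B" for a using B(1) mem_link_edges[of a a u] adj_irrefl by auto
  have "\<exists>h. (\<forall>a. h a = 1 \<or> h a = -1) \<and> (\<forall>a b. adj u a \<longrightarrow> adj u b \<longrightarrow> adj a b \<longrightarrow> \<kappa> a b = h a * h b)"
  proof (rule sign_cocycle[OF u])
    show "\<kappa> a b = 1 \<or> \<kappa> a b = -1" for a b by (simp add: \<kappa>_def)
    fix a b c assume abc: "adj u a" "adj u b" "adj u c" "a = b \<or> adj a b" "b = c \<or> adj b c" "a = c \<or> adj a c"
    show "\<kappa> a b * \<kappa> b c = \<kappa> a c"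
    proof (cases "a = b \<or> b = c \<or> a = c")
      case True
      then show ?thesis using diag by (auto simp: \<kappa>_def insert_commute)
    next
      case False
      then have "{a, b, c} \<in> cobd1 u B \<longleftrightarrow> ({a, b} \<in> B) = (({b, c} \<in> B) = ({a, c} \<in> B))"
        using abc B by (intro mem_cobd1) auto
      then show ?thesis using B(2) by (auto simp: \<kappa>_def)
    qed
  qed
  then obtain h where h: "\<And>a. h a = 1 \<or> h a = (-1::real)"
    "\<And>a b. adj u a \<Longrightarrow> adj u b \<Longrightarrow> adj a b \<Longrightarrow> \<kappa> a b = h a * h b" by blast
  define X where "X = {a \<in> nb u. h a = -1}"
  have mem: "{x, y} \<in> cobd0 u X \<longleftrightarrow> {x, y} \<in> B" if xy: "adj u x" "adj u y" "adj x y" for x y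
  proof -
    have "{x, y} \<in> cobd0 u X \<longleftrightarrow> (h x = -1) \<noteq> (h y = -1)"
      using mem_cobd0[OF xy, of X] xy by (simp add: X_def nb_def)
    also have "\<dots> \<longleftrightarrow> h x * h y = -1" using h(1)[of x] h(1)[of y] by auto
    also have "\<dots> \<longleftrightarrow> {x, y} \<in> B" unfolding h(2)[OF xy, symmetric] by (simp add: \<kappa>_def)
    finally show ?thesis .
  qed
  have "cobd0 u X = B"
  proof (intro equalityI subsetI)
    fix e assume e: "e \<in> cobd0 u X"
    then obtain x y where "e = {x, y}" "adj u x" "adj u y" "adj x y" by (auto simp: cobd0_def link_edges_def)
    then show "e \<in> B" using mem e by simp
  next
    fix e assume e: "e \<in> B"
    then obtain x y where "e = {x, y}" "adj u x" "adj u y" "adj x y" using B(1) by (auto simp: link_edges_def)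
    then show "e \<in> cobd0 u X" using mem e by simp
  qed
  then show "B \<in> cobd0 u ` Pow (nb u)" by (auto simp: X_def)
qed

lemma cobd1_edge: "e \<in> link_edges u \<Longrightarrow> cobd1 u {e} = {t \<in> link_triangles u. e \<subseteq> t}"
proof -
  have "{f \<in> {e}. f \<subseteq> t} = (if e \<subseteq> t then {e} else {})" for t by auto
  then show ?thesis unfolding cobd1_def by auto
qed

lemma finite_cobd1: "finite (cobd1 u B)"
  using finite_link_triangles by (simp add: cobd1_def)

text \<open>The coboundary of one edge consists of two triangles, and parity is additive under
  symmetric difference.\<close>

lemma even_card_cobd1:
  assumes "B \<subseteq> link_edges u"
  shows "even (card (cobd1 u B))"
proof -
  have "finite B" using assms finite_link_edges finite_subset by blast
  then show ?thesis using assms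
  proof (induction B rule: finite_induct)
    case (insert e B)
    then have "insert e B = sym_diff B {e}" by blast
    then have "cobd1 u (insert e B) = sym_diff (cobd1 u B) (cobd1 u {e})"
      using cobd1_sym_diff[of B u "{e}"] insert by auto
    moreover have "even (card (cobd1 u {e}))"
      using cobd1_edge[of e u] card_link_triangles_on_edge[of e u] insert by simp
    ultimately show ?case
      using odd_card_sym_diff[OF finite_cobd1[of u B] finite_cobd1[of u "{e}"]] insert by simp
  qed (simp add: cobd1_def)
qed

text \<open>This is H^2: the coboundaries have index two among all sets of triangles. Neighbouring
  triangles differ by the coboundary of their common edge, so by strong connectedness any two
  triangles differ by a coboundary; a single triangle is none, because coboundaries are
  even.\<close>

lemma card_image_cobd1:
  assumes u: "u \<in> V"
  shows "2 ^ card (link_triangles u) = 2 * card (cobd1 u ` Pow (link_edges u))"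
proof -
  define Im where "Im = cobd1 u ` Pow (link_edges u)"
  have Im_sym: "sym_diff X Y \<in> Im" if XY: "X \<in> Im" "Y \<in> Im" for X Y
  proof -
    obtain B C where BC: "B \<subseteq> link_edges u" "C \<subseteq> link_edges u" "X = cobd1 u B" "Y = cobd1 u C"
      using XY by (auto simp: Im_def)
    then have "sym_diff X Y = cobd1 u (sym_diff B C)" using cobd1_sym_diff by simp
    then show ?thesis using BC by (auto simp: Im_def)
  qed
  have Im_empty: "{} \<in> Im" unfolding Im_def by (rule image_eqI[of _ _ "{}"]) (auto simp: cobd1_def)
  obtain x where x: "adj u x" using vertex_nb[OF u] by blast
  obtain y where y: "adj u y" "adj x y" using edge_nb[OF x] by blast
  obtain t0 where t0: "t0 \<in> link_triangles u"
    using link_triangles_on_edge[OF x y] by (metis (mono_tags, lifting) insertI1 mem_Collect_eq)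
  \<comment> \<open>The triangles that agree with \<open>t0\<close> modulo coboundaries.\<close>
  define Q where "Q = {t \<in> link_triangles u. sym_diff {t} {t0} \<in> Im}"
  have "Q = link_triangles u"
  proof (rule link_strongly_connected[OF u])
    show "Q \<subseteq> link_triangles u" by (auto simp: Q_def)
    show "Q \<noteq> {}" using t0 Im_empty by (auto simp: Q_def intro!: exI[of _ t0])
    fix t t' e assume t: "t \<in> Q" "t' \<in> link_triangles u" and e: "e \<in> link_edges u" "e \<subseteq> t" "e \<subseteq> t'"
    show "t' \<in> Q"
    proof (cases "t = t'")
      case False
      have "{t, t'} \<subseteq> {t \<in> link_triangles u. e \<subseteq> t}" using t e by (auto simp: Q_def)
      then have "{t, t'} = {t \<in> link_triangles u. e \<subseteq> t}"
        using card_link_triangles_on_edge[OF e(1)] False finite_link_triangles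
        by (intro card_seteq) auto
      then have "{t, t'} \<in> Im" using cobd1_edge[OF e(1)] e(1) by (auto simp: Im_def intro!: image_eqI[of _ _ "{e}"])
      moreover have "sym_diff {t} {t0} \<in> Im" using t by (simp add: Q_def)
      ultimately have "sym_diff {t, t'} (sym_diff {t} {t0}) \<in> Im" by (rule Im_sym)
      moreover have "sym_diff {t, t'} (sym_diff {t} {t0}) = sym_diff {t'} {t0}" using False by auto
      ultimately show ?thesis using t by (simp add: Q_def)
    qed (use t in simp)
  qed
  then have pair: "sym_diff {t} {t0} \<in> Im" if "t \<in> link_triangles u" for t using that by (auto simp: Q_def)
  \<comment> \<open>Every set of triangles is a coboundary or becomes one by adding
    \<open>t0\<close>: inserting a triangle amounts to adding \<open>t0\<close>, up to a
    coboundary.\<close>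
  have all: "S \<in> Im \<or> sym_diff S {t0} \<in> Im" if "finite S" "S \<subseteq> link_triangles u" for S using that
  proof (induction S rule: finite_induct)
    case (insert t S)
    have p: "sym_diff {t} {t0} \<in> Im" using insert pair by auto
    have e1: "sym_diff S (sym_diff {t} {t0}) = sym_diff (insert t S) {t0}"
      and e2: "sym_diff (sym_diff S {t0}) (sym_diff {t} {t0}) = insert t S" using insert by blast+
    from insert consider "S \<in> Im" | "sym_diff S {t0} \<in> Im" by blast
    then show ?case using Im_sym[OF _ p] e1 e2 by cases metis+
  qed (use Im_empty in simp)
  have even: "even (card X)" if "X \<in> Im" for X using that even_card_cobd1 by (auto simp: Im_def)
  have fin: "finite X" if "X \<in> Im" for X using that finite_cobd1 by (auto simp: Im_def)
  have ImT: "Im \<subseteq> Pow (link_triangles u)" by (auto simp: Im_def cobd1_def)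
  have "Pow (link_triangles u) = Im \<union> (\<lambda>X. sym_diff X {t0}) ` Im"
  proof (intro equalityI subsetI)
    fix S assume "S \<in> Pow (link_triangles u)"
    then have "S \<in> Im \<or> sym_diff S {t0} \<in> Im" using all finite_link_triangles finite_subset by blast
    moreover have "S = sym_diff (sym_diff S {t0}) {t0}" by blast
    ultimately show "S \<in> Im \<union> (\<lambda>X. sym_diff X {t0}) ` Im" by blast
  qed (use ImT t0 in blast)
  moreover have "Im \<inter> (\<lambda>X. sym_diff X {t0}) ` Im = {}"
  proof (rule ccontr)
    assume "Im \<inter> (\<lambda>X. sym_diff X {t0}) ` Im \<noteq> {}"
    then obtain X where X: "X \<in> Im" "sym_diff X {t0} \<in> Im" by blast
    then show False using odd_card_sym_diff[OF fin[OF X(1)], of "{t0}"] even by simp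
  qed
  moreover have "inj_on (\<lambda>X. sym_diff X {t0}) Im"
    by (rule inj_on_inverseI[of _ "\<lambda>X. sym_diff X {t0}"]) blast
  moreover have "finite Im" using ImT finite_link_triangles finite_subset by blast
  ultimately have "card (Pow (link_triangles u)) = card Im + card ((\<lambda>X. sym_diff X {t0}) ` Im)"
    "card ((\<lambda>X. sym_diff X {t0}) ` Im) = card Im"
    by (simp_all only: card_Un_disjoint card_image finite_imageI)
  then have "card (Pow (link_triangles u)) = 2 * card Im" by simp
  then show ?thesis using finite_link_triangles by (simp add: card_Pow Im_def)
qed

text \<open>Euler characteristic: \<open>H\<^sup>0\<close> and \<open>H\<^sup>2\<close> of the link have two elements each and
  \<open>H\<^sup>1\<close> vanishes.\<close>

lemma link_euler:
  assumes u: "u \<in> V"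
  shows "card (nb u) + card (link_triangles u) = card (link_edges u) + 2"
proof -
  have "2 ^ card (nb u) = 2 * card (cobd0 u ` Pow (nb u))"
    using card_kernel_image_sym_diff[OF finite_nb[of u], of "cobd0 u"] cobd0_sym_diff kernel_cobd0[OF u] by simp
  moreover have "2 ^ card (link_edges u) = card (cobd0 u ` Pow (nb u)) * card (cobd1 u ` Pow (link_edges u))"
    using card_kernel_image_sym_diff[OF finite_link_edges[of u], of "cobd1 u"] cobd1_sym_diff image_cobd0[OF u] by simp
  moreover note card_image_cobd1[OF u]
  ultimately have "2 ^ card (nb u) * 2 ^ card (link_triangles u) = (2::nat) * 2 * 2 ^ card (link_edges u)"
    by simp
  then have "(2::nat) ^ (card (nb u) + card (link_triangles u)) = 2 ^ (card (link_edges u) + 2)"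
    by (simp add: power_add)
  then show ?thesis by (rule power_inject_exp[THEN iffD1, rotated]) simp
qed

lemma card_link_triangles: "u \<in> V \<Longrightarrow> card (link_triangles u) + 4 = 2 * card (nb u)"
  using link_euler[of u] link_edges_triangles[of u] by simp

lemma card_link_edges: "u \<in> V \<Longrightarrow> card (link_edges u) + 6 = 3 * card (nb u)"
  using link_euler[of u] link_edges_triangles[of u] by simp

end

section \<open>Counting edges and tetrahedra\<close>

context flag_3manifold_graph
begin

definition cliques :: "nat \<Rightarrow> 'a set set" where
  "cliques k = {F. F \<subseteq> V \<and> card F = k \<and> (\<forall>x\<in>F. \<forall>y\<in>F. x \<noteq> y \<longrightarrow> adj x y)}"

lemma finite_cliques: "finite (cliques k)"
  by (rule finite_subset[of _ "Pow V"]) (auto simp: cliques_def finite_V)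

lemma cliques_subset: "F \<in> cliques k \<Longrightarrow> F \<subseteq> V"
  by (simp add: cliques_def)

lemma finite_clique: "F \<in> cliques k \<Longrightarrow> finite F"
  using cliques_subset finite_V finite_subset by blast

lemma sum_over_cliques:
  fixes w :: "'a \<Rightarrow> nat"
  shows "(\<Sum>F\<in>cliques k. \<Sum>v\<in>F. w v) = (\<Sum>v\<in>V. w v * card {F \<in> cliques k. v \<in> F})"
proof -
  have "(\<Sum>F\<in>cliques k. \<Sum>v\<in>F. w v) = (\<Sum>F\<in>cliques k. \<Sum>v\<in>{v \<in> V. v \<in> F}. w v)"
  proof (rule sum.cong[OF refl])
    fix F assume "F \<in> cliques k"
    then have "{v \<in> V. v \<in> F} = F" using cliques_subset by blast
    then show "(\<Sum>v\<in>F. w v) = (\<Sum>v\<in>{v \<in> V. v \<in> F}. w v)" by simp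
  qed
  also have "\<dots> = (\<Sum>v\<in>V. \<Sum>F\<in>{F \<in> cliques k. v \<in> F}. w v)"
    by (rule sum.swap_restrict[OF finite_cliques finite_V])
  finally show ?thesis by (simp add: mult.commute)
qed

lemma card_cliques_incidence: "k * card (cliques k) = (\<Sum>v\<in>V. card {F \<in> cliques k. v \<in> F})"
proof -
  have "(\<Sum>F\<in>cliques k. \<Sum>v\<in>F. 1::nat) = (\<Sum>F\<in>cliques k. k)"
    by (intro sum.cong) (auto simp: cliques_def)
  then show ?thesis using sum_over_cliques[of "\<lambda>_. 1" k] by (simp add: mult.commute)
qed

lemma card_cliques_at:
  assumes S: "S \<subseteq> Pow (nb v)" "insert v ` S = {F \<in> cliques k. v \<in> F}"
  shows "card {F \<in> cliques k. v \<in> F} = card S"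
proof -
  have "v \<notin> nb v" using adj_irrefl by (simp add: nb_def)
  then have "inj_on (insert v) S" using S(1) by (intro inj_on_inverseI[of _ "\<lambda>F. F - {v}"]) auto
  then show ?thesis using card_image S(2) by metis
qed

lemma card_2_cliques_at:
  assumes "v \<in> V"
  shows "card {F \<in> cliques 2. v \<in> F} = card (nb v)"
proof -
  have "card {F \<in> cliques 2. v \<in> F} = card ((\<lambda>x. {x}) ` nb v)"
  proof (rule card_cliques_at)
    show "insert v ` (\<lambda>x. {x}) ` nb v = {F \<in> cliques 2. v \<in> F}"
    proof (intro equalityI subsetI)
      fix F assume "F \<in> {F \<in> cliques 2. v \<in> F}"
      then have F: "card F = 2" "v \<in> F" "\<forall>x\<in>F. \<forall>y\<in>F. x \<noteq> y \<longrightarrow> adj x y" by (auto simp: cliques_def)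
      then obtain a b where ab: "F = {a, b}" "a \<noteq> b" by (auto simp: card_2_iff)
      then have "F = {v, a} \<and> adj v a \<or> F = {v, b} \<and> adj v b" using F(2,3) by auto
      then show "F \<in> insert v ` (\<lambda>x. {x}) ` nb v" by (auto simp: nb_def)
    next
      fix F assume "F \<in> insert v ` (\<lambda>x. {x}) ` nb v"
      then obtain x where "F = {v, x}" "adj v x" by (auto simp: nb_def)
      then show "F \<in> {F \<in> cliques 2. v \<in> F}"
        using assms adj_V' adj_sym adj_neq by (auto simp: cliques_def)
    qed
  qed auto
  also have "\<dots> = card (nb v)" by (rule card_image) simp
  finally show ?thesis .
qed

lemma card_3_cliques_at:
  assumes "v \<in> V"
  shows "card {F \<in> cliques 3. v \<in> F} = card (link_edges v)"
proof (rule card_cliques_at[OF link_edges_subset], intro equalityI subsetI)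
  fix F assume "F \<in> {F \<in> cliques 3. v \<in> F}"
  then have F: "card F = 3" "v \<in> F" "\<And>x y. x \<in> F \<Longrightarrow> y \<in> F \<Longrightarrow> x \<noteq> y \<Longrightarrow> adj x y" by (auto simp: cliques_def)
  then have "card (F - {v}) = 2" by (simp add: card_Diff_singleton)
  then obtain a b where ab: "F - {v} = {a, b}" "a \<noteq> b" by (auto simp: card_2_iff)
  then have mem: "a \<in> F" "b \<in> F" "a \<noteq> v" "b \<noteq> v" by blast+
  then have "{a, b} \<in> link_edges v" using F ab(2) by (simp add: mem_link_edges)
  moreover have "F = insert v {a, b}" using ab F(2) by blast
  ultimately show "F \<in> insert v ` link_edges v" by blast
next
  fix F assume "F \<in> insert v ` link_edges v"
  then obtain x y where F: "F = {v, x, y}" "adj v x" "adj v y" "adj x y" by (auto simp: link_edges_def)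
  then have "v \<noteq> x" "v \<noteq> y" "x \<noteq> y" using adj_neq by blast+
  then show "F \<in> {F \<in> cliques 3. v \<in> F}" using assms F adj_V' adj_sym by (auto simp: cliques_def)
qed

lemma card_4_cliques_at:
  assumes "v \<in> V"
  shows "card {F \<in> cliques 4. v \<in> F} = card (link_triangles v)"
proof (rule card_cliques_at[OF link_triangles_subset], intro equalityI subsetI)
  fix F assume "F \<in> {F \<in> cliques 4. v \<in> F}"
  then have F: "card F = 4" "v \<in> F" "\<And>x y. x \<in> F \<Longrightarrow> y \<in> F \<Longrightarrow> x \<noteq> y \<Longrightarrow> adj x y" by (auto simp: cliques_def)
  then have "card (F - {v}) = 3" by (simp add: card_Diff_singleton)
  then obtain a b c where ab: "F - {v} = {a, b, c}" "a \<noteq> b" "b \<noteq> c" "a \<noteq> c" by (auto simp: card_3_iff)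
  then have mem: "a \<in> F" "b \<in> F" "c \<in> F" "a \<noteq> v" "b \<noteq> v" "c \<noteq> v" by blast+
  then have "{a, b, c} \<in> link_triangles v" using F ab(2-4) unfolding link_triangles_def by blast
  moreover have "F = insert v {a, b, c}" using ab F(2) by blast
  ultimately show "F \<in> insert v ` link_triangles v" by blast
next
  fix F assume "F \<in> insert v ` link_triangles v"
  then obtain x y z where F: "F = {v, x, y, z}" "adj v x" "adj v y" "adj v z" "adj x y" "adj y z" "adj x z"
    by (auto simp: link_triangles_def)
  then have "v \<noteq> x" "v \<noteq> y" "v \<noteq> z" "x \<noteq> y" "y \<noteq> z" "x \<noteq> z" using adj_neq by blast+
  then show "F \<in> {F \<in> cliques 4. v \<in> F}" using assms F adj_V' adj_sym by (auto simp: cliques_def)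
qed

lemma sum_degree: "(\<Sum>v\<in>V. card (nb v)) = 2 * card (cliques 2)"
  using card_cliques_incidence[of 2] card_2_cliques_at by simp

lemma card_cliques_3: "card (cliques 3) + 2 * card V = 2 * card (cliques 2)"
proof -
  have "3 * card (cliques 3) + 6 * card V = (\<Sum>v\<in>V. card (link_edges v) + 6)"
    using card_cliques_incidence[of 3] card_3_cliques_at by (simp add: sum.distrib)
  also have "\<dots> = (\<Sum>v\<in>V. 3 * card (nb v))" using card_link_edges by (intro sum.cong) auto
  finally show ?thesis using sum_degree by (simp flip: sum_distrib_left)
qed

lemma card_cliques_4: "card (cliques 4) + card V = card (cliques 2)"
proof -
  have "4 * card (cliques 4) + 4 * card V = (\<Sum>v\<in>V. card (link_triangles v) + 4)"
    using card_cliques_incidence[of 4] card_4_cliques_at by (simp add: sum.distrib)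
  also have "\<dots> = (\<Sum>v\<in>V. 2 * card (nb v))" using card_link_triangles by (intro sum.cong) auto
  finally show ?thesis using sum_degree by (simp flip: sum_distrib_left)
qed

text \<open>Both \<open>d\<close> and \<open>e\<close> are common neighbours of the triangle a, b,
  c, and the two common neighbours of a triangle are non-adjacent.\<close>

lemma no_5_clique:
  assumes "adj a b" "adj a c" "adj b c" "adj a d" "adj b d" "adj c d" "adj a e" "adj b e" "adj c e"
  shows "\<not> adj d e"
proof
  assume de: "adj d e"
  obtain p q where pq: "p \<noteq> q" "\<not> adj p q" "{w. adj a w \<and> adj b w \<and> adj c w} = {p, q}"
    using triangle_nb[of a b c] assms by blast
  then have "d \<in> {p, q}" "e \<in> {p, q}" using assms by blast+
  then show False using de pq(2) adj_irrefl adj_sym by blast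
qed

lemma clique_4_cases:
  assumes "\<sigma> \<in> cliques 4" "v \<in> \<sigma>"
  obtains a b c where "\<sigma> = {v, a, b, c}" "\<sigma> - {v} = {a, b, c}" "adj v a" "adj v b" "adj v c" "adj a b" "adj b c" "adj a c"
    "v \<noteq> a" "v \<noteq> b" "v \<noteq> c" "a \<noteq> b" "b \<noteq> c" "a \<noteq> c"
proof -
  have F: "card \<sigma> = 4" "\<And>x y. x \<in> \<sigma> \<Longrightarrow> y \<in> \<sigma> \<Longrightarrow> x \<noteq> y \<Longrightarrow> adj x y" using assms by (auto simp: cliques_def)
  then have "card (\<sigma> - {v}) = 3" using assms by (simp add: card_Diff_singleton)
  then obtain a b c where ab: "\<sigma> - {v} = {a, b, c}" "a \<noteq> b" "b \<noteq> c" "a \<noteq> c" by (auto simp: card_3_iff)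
  then have mem: "a \<in> \<sigma>" "b \<in> \<sigma>" "c \<in> \<sigma>" "a \<noteq> v" "b \<noteq> v" "c \<noteq> v" by blast+
  have "\<sigma> = {v, a, b, c}" using ab(1) assms(2) by blast
  then show thesis using that ab mem F(2) assms(2) by metis
qed

lemma clique_4_no_cone:
  assumes "\<sigma> \<in> cliques 4"
  shows "\<exists>x\<in>\<sigma>. \<not> adj w x"
proof (rule ccontr)
  assume no: "\<not> ?thesis"
  have "\<sigma> \<noteq> {}" using assms by (auto simp: cliques_def)
  then obtain v where v: "v \<in> \<sigma>" by blast
  obtain a b c where s: "\<sigma> = {v, a, b, c}" "adj v a" "adj v b" "adj v c" "adj a b" "adj b c" "adj a c"
    by (rule clique_4_cases[OF assms v])
  have w: "adj x w" if "x \<in> \<sigma>" for x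
  proof (rule adj_sym)
    show "adj w x" using no that by blast
  qed
  have mem: "a \<in> \<sigma>" "b \<in> \<sigma>" "c \<in> \<sigma>" unfolding s(1) by simp_all
  have "\<not> adj v w"
    by (rule no_5_clique[OF s(5,7,6) adj_sym[OF s(2)] adj_sym[OF s(3)] adj_sym[OF s(4)] w[OF mem(1)] w[OF mem(2)] w[OF mem(3)]])
  then show False using w[OF v] by contradiction
qed

text \<open>Each of the four triangles of \<sigma> has two common neighbours, one of them being the
  opposite vertex of \<sigma>. These four pairs are disjoint, since a vertex in two of them would be
  adjacent to all of \<sigma>.\<close>

lemma card_adjacent_to_3:
  assumes \<sigma>: "\<sigma> \<in> cliques 4"
  shows "card {w \<in> V. card (nb w \<inter> \<sigma>) = 3} = 8"
proof -
  define W where "W v = {w. \<forall>x\<in>\<sigma> - {v}. adj x w}" for v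
  have fin: "finite \<sigma>" "card \<sigma> = 4" using finite_clique[OF \<sigma>] \<sigma> by (simp_all add: cliques_def)
  have cardW: "card (W v) = 2" if v: "v \<in> \<sigma>" for v
  proof -
    obtain a b c where s: "\<sigma> - {v} = {a, b, c}" "adj a b" "adj b c" "adj a c"
      by (rule clique_4_cases[OF \<sigma> v])
    obtain p q where "p \<noteq> q" "{w. adj a w \<and> adj b w \<and> adj c w} = {p, q}"
      using triangle_nb[of a b c] s by blast
    moreover have "W v = {w. adj a w \<and> adj b w \<and> adj c w}" by (simp add: W_def s(1))
    ultimately show ?thesis by simp
  qed
  have disj: "W v \<inter> W v' = {}" if "v \<in> \<sigma>" "v' \<in> \<sigma>" "v \<noteq> v'" for v v'
  proof (rule ccontr)
    assume "W v \<inter> W v' \<noteq> {}"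
    then obtain w where w: "w \<in> W v" "w \<in> W v'" by blast
    have "adj w x" if x: "x \<in> \<sigma>" for x
      using w x \<open>v \<noteq> v'\<close> by (cases "x = v") (auto simp: W_def intro: adj_sym)
    then show False using clique_4_no_cone[OF \<sigma>, of w] by blast
  qed
  have "{w \<in> V. card (nb w \<inter> \<sigma>) = 3} = (\<Union>v\<in>\<sigma>. W v)"
  proof (intro equalityI subsetI)
    fix w assume w: "w \<in> {w \<in> V. card (nb w \<inter> \<sigma>) = 3}"
    then have "card (\<sigma> - nb w) = 1" using fin by (simp add: card_Diff_subset_Int Int_commute)
    then obtain v where "\<sigma> - nb w = {v}" by (auto simp: card_1_singleton_iff)
    then have "v \<in> \<sigma>" "w \<in> W v" by (auto simp: W_def nb_def adj_commute)
    then show "w \<in> (\<Union>v\<in>\<sigma>. W v)" by blast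
  next
    fix w assume "w \<in> (\<Union>v\<in>\<sigma>. W v)"
    then obtain v where v: "v \<in> \<sigma>" "w \<in> W v" by blast
    have "\<not> adj w v" using clique_4_no_cone[OF \<sigma>, of w] v by (auto simp: W_def adj_commute)
    then have "nb w \<inter> \<sigma> = \<sigma> - {v}" using v by (auto simp: W_def nb_def adj_commute)
    then have "card (nb w \<inter> \<sigma>) = 3" using fin v by simp
    moreover have "w \<in> V"
    proof -
      have "nb w \<inter> \<sigma> \<noteq> {}" using \<open>card (nb w \<inter> \<sigma>) = 3\<close> by (metis card.empty zero_neq_numeral)
      then obtain x where "adj w x" by (auto simp: nb_def)
      then show ?thesis by (rule adj_V)
    qed
    ultimately show "w \<in> {w \<in> V. card (nb w \<inter> \<sigma>) = 3}" by simp
  qed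
  moreover have "card (\<Union>v\<in>\<sigma>. W v) = (\<Sum>v\<in>\<sigma>. card (W v))"
  proof (rule card_UN_disjoint[OF fin(1)])
    show "\<forall>v\<in>\<sigma>. finite (W v)" using cardW by (metis card.infinite zero_neq_numeral)
    show "\<forall>i\<in>\<sigma>. \<forall>j\<in>\<sigma>. i \<noteq> j \<longrightarrow> W i \<inter> W j = {}" using disj by blast
  qed
  ultimately show ?thesis using cardW fin by simp
qed

text \<open>Truncated subtraction is intended: only vertices with fewer than two neighbours
  in \<open>\<sigma>\<close> contribute.\<close>

definition deficiency :: "'a set \<Rightarrow> nat" where
  "deficiency \<sigma> = (\<Sum>w\<in>V. 2 - card (nb w \<inter> \<sigma>))"

text \<open>The adjacent pairs between \<sigma> and \<open>V\<close> are counted from the side of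
  \<open>V\<close>. No vertex sees all of \<sigma>, so each contributes 2, plus 1 for the eight
  vertices that see three, minus its share of the deficiency.\<close>

lemma sum_degree_clique_4:
  assumes \<sigma>: "\<sigma> \<in> cliques 4"
  shows "(\<Sum>v\<in>\<sigma>. card (nb v)) + deficiency \<sigma> = 2 * card V + 8"
proof -
  have fin: "finite \<sigma>" "card \<sigma> = 4" using finite_clique[OF \<sigma>] \<sigma> by (simp_all add: cliques_def)
  have "(\<Sum>v\<in>\<sigma>. card (nb v)) = (\<Sum>w\<in>V. card (nb w \<inter> \<sigma>))"
  proof -
    have "(\<Sum>v\<in>\<sigma>. card (nb v)) = (\<Sum>v\<in>\<sigma>. \<Sum>w\<in>{w \<in> V. adj v w}. 1)"
    proof (rule sum.cong[OF refl])
      fix v show "card (nb v) = (\<Sum>w\<in>{w \<in> V. adj v w}. 1)"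
        using adj_V' by (auto simp: nb_def intro!: arg_cong[of _ _ card])
    qed
    also have "\<dots> = (\<Sum>w\<in>V. \<Sum>v\<in>{v \<in> \<sigma>. adj v w}. 1)" by (rule sum.swap_restrict[OF fin(1) finite_V])
    also have "\<dots> = (\<Sum>w\<in>V. card (nb w \<inter> \<sigma>))"
    proof (rule sum.cong[OF refl])
      fix w show "(\<Sum>v\<in>{v \<in> \<sigma>. adj v w}. 1) = card (nb w \<inter> \<sigma>)"
        using adj_commute by (auto simp: nb_def intro!: arg_cong[of _ _ card])
    qed
    finally show ?thesis .
  qed
  moreover have "(\<Sum>w\<in>V. card (nb w \<inter> \<sigma>)) + deficiency \<sigma> = (\<Sum>w\<in>V. 2 + (if card (nb w \<inter> \<sigma>) = 3 then 1 else 0))"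
    unfolding deficiency_def sum.distrib[symmetric]
  proof (rule sum.cong[OF refl])
    fix w
    have "\<exists>x\<in>\<sigma>. \<not> adj w x" by (rule clique_4_no_cone[OF \<sigma>])
    then have "nb w \<inter> \<sigma> \<subset> \<sigma>" by (auto simp: nb_def)
    then have "card (nb w \<inter> \<sigma>) < 4" using psubset_card_mono[OF fin(1)] fin(2) by simp
    then show "card (nb w \<inter> \<sigma>) + (2 - card (nb w \<inter> \<sigma>)) = 2 + (if card (nb w \<inter> \<sigma>) = 3 then 1 else 0)" by auto
  qed
  moreover have "(\<Sum>w\<in>V. if card (nb w \<inter> \<sigma>) = 3 then 1 else 0) = (8::nat)"
    using card_adjacent_to_3[OF \<sigma>] finite_V by (simp add: sum.If_cases Int_def)
  moreover have "(\<Sum>w\<in>V. 2 + (if card (nb w \<inter> \<sigma>) = 3 then 1 else 0))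
    = 2 * card V + (\<Sum>w\<in>V. if card (nb w \<inter> \<sigma>) = 3 then 1 else 0)" unfolding sum.distrib by simp
  ultimately show ?thesis by linarith
qed

text \<open>The degree sums over all tetrahedra are combined with d(v) lying in 2 d(v) - 4
  tetrahedra. Completing the square centres the degrees at n / 2 + 2. Both terms on the left are
  nonnegative, and keeping them explicitly is what makes the extremal case accessible.\<close>

lemma degree_variance:
  defines "n \<equiv> int (card V)" and "f \<equiv> int (card (cliques 2))"
  shows "(\<Sum>v\<in>V. (2 * int (card (nb v)) - (n + 4))\<^sup>2) + 2 * int (\<Sum>\<sigma>\<in>cliques 4. deficiency \<sigma>)
    = n * (n\<^sup>2 + 4 * n - 4 * f)"
proof -
  define D where "D = (\<Sum>v\<in>V. (int (card (nb v)))\<^sup>2)"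
  have sd: "(\<Sum>v\<in>V. int (card (nb v))) = 2 * f"
    using sum_degree unfolding f_def by (metis of_nat_mult of_nat_numeral of_nat_sum)
  have "(\<Sum>\<sigma>\<in>cliques 4. (\<Sum>v\<in>\<sigma>. card (nb v)) + deficiency \<sigma>) = (\<Sum>\<sigma>\<in>cliques 4. 2 * card V + 8)"
    using sum_degree_clique_4 by (intro sum.cong) auto
  then have "(\<Sum>v\<in>V. card (nb v) * card {F \<in> cliques 4. v \<in> F}) + (\<Sum>\<sigma>\<in>cliques 4. deficiency \<sigma>)
    = card (cliques 4) * (2 * card V + 8)"
    using sum_over_cliques[of "\<lambda>v. card (nb v)" 4] by (simp add: sum.distrib)
  from arg_cong[OF this, of int]
  have "int (\<Sum>v\<in>V. card (nb v) * card {F \<in> cliques 4. v \<in> F}) + int (\<Sum>\<sigma>\<in>cliques 4. deficiency \<sigma>)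
    = int (card (cliques 4)) * (2 * n + 8)"
    unfolding n_def by (simp only: of_nat_add of_nat_mult of_nat_numeral)
  moreover have "int (\<Sum>v\<in>V. card (nb v) * card {F \<in> cliques 4. v \<in> F}) = 2 * D - 4 * (2 * f)"
  proof -
    have "int (\<Sum>v\<in>V. card (nb v) * card {F \<in> cliques 4. v \<in> F})
      = (\<Sum>v\<in>V. 2 * (int (card (nb v)))\<^sup>2 - 4 * int (card (nb v)))" unfolding of_nat_sum
    proof (rule sum.cong[OF refl])
      fix v assume v: "v \<in> V"
      have c: "int (card {F \<in> cliques 4. v \<in> F}) = 2 * int (card (nb v)) - 4"
        using card_4_cliques_at[OF v] card_link_triangles[OF v] by linarith
      show "int (card (nb v) * card {F \<in> cliques 4. v \<in> F}) = 2 * (int (card (nb v)))\<^sup>2 - 4 * int (card (nb v))"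
        unfolding of_nat_mult c by (simp add: power2_eq_square algebra_simps)
    qed
    then show ?thesis by (simp add: sum_subtractf D_def sd flip: sum_distrib_left)
  qed
  moreover have "int (card (cliques 4)) = f - n"
    using card_cliques_4 unfolding f_def n_def by linarith
  moreover have "(\<Sum>v\<in>V. (2 * int (card (nb v)) - (n + 4))\<^sup>2) = 4 * D - 4 * (n + 4) * (2 * f) + n * (n + 4)\<^sup>2"
  proof -
    have "(\<Sum>v\<in>V. (2 * int (card (nb v)) - (n + 4))\<^sup>2)
      = (\<Sum>v\<in>V. 4 * (int (card (nb v)))\<^sup>2 - 4 * (n + 4) * int (card (nb v)) + (n + 4)\<^sup>2)"
      by (intro sum.cong refl) (simp add: power2_eq_square algebra_simps)
    also have "\<dots> = 4 * D - 4 * (n + 4) * (\<Sum>v\<in>V. int (card (nb v))) + n * (n + 4)\<^sup>2"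
      by (simp add: sum.distrib sum_subtractf D_def n_def sum_distrib_left)
    finally show ?thesis by (simp only: sd)
  qed
  ultimately show ?thesis by (simp add: power2_eq_square algebra_simps)
qed

lemma card_edges_le: "4 * card (cliques 2) \<le> (card V)\<^sup>2 + 4 * card V"
proof (cases "card V = 0")
  case True
  then have V: "V = {}" using finite_V by simp
  have "F \<notin> cliques 2" for F
  proof
    assume F: "F \<in> cliques 2"
    then have "card F = 2" by (simp add: cliques_def)
    moreover have "F = {}" using cliques_subset[OF F] unfolding V by blast
    ultimately show False by simp
  qed
  then have "card (cliques 2) = 0" by (metis card.empty ex_in_conv)
  then show ?thesis by simp
next
  case False
  let ?n = "int (card V)"
  have "0 \<le> ?n * (?n\<^sup>2 + 4 * ?n - 4 * int (card (cliques 2)))"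
    unfolding degree_variance[symmetric] by (intro add_nonneg_nonneg sum_nonneg) (auto intro: sum_nonneg)
  then have "0 \<le> ?n\<^sup>2 + 4 * ?n - 4 * int (card (cliques 2))"
    using False by (simp add: zero_le_mult_iff)
  then have "int (4 * card (cliques 2)) \<le> int ((card V)\<^sup>2 + 4 * card V)" by simp
  then show ?thesis by (simp only: of_nat_le_iff)
qed

text \<open>The hypothesis permits an excess of 1, because for odd n the edge number of the extremal
  complex is not exactly (n^2 + 4 n) / 4. If n is even, the excess is divisible by 4 and hence not
  positive. If n is odd, every term of the variance is the square of an odd number, so the variance
  alone uses up the right hand side. Either way nothing is left for the deficiencies.\<close>

lemma extremal_two_neighbours:
  assumes ext: "(card V)\<^sup>2 + 4 * card V \<le> 4 * card (cliques 2) + 1"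
    and \<sigma>: "\<sigma> \<in> cliques 4" and w: "w \<in> V"
  shows "2 \<le> card (nb w \<inter> \<sigma>)"
proof -
  let ?n = "int (card V)" and ?f = "int (card (cliques 2))"
  let ?A = "\<Sum>v\<in>V. (2 * int (card (nb v)) - (?n + 4))\<^sup>2"
  let ?D = "\<Sum>\<sigma>\<in>cliques 4. deficiency \<sigma>"
  have ext': "?n\<^sup>2 + 4 * ?n - 4 * ?f \<le> 1"
  proof -
    have "int ((card V)\<^sup>2 + 4 * card V) \<le> int (4 * card (cliques 2) + 1)"
      using ext by (simp only: of_nat_le_iff)
    then show ?thesis by simp
  qed
  have "2 * int ?D \<le> 0"
  proof (cases "even ?n")
    case True
    then obtain m where m: "?n = 2 * m" by blast
    have "?n\<^sup>2 + 4 * ?n - 4 * ?f = 4 * (m\<^sup>2 + 2 * m - ?f)" by (simp add: m power2_eq_square)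
    then obtain q where q: "?n\<^sup>2 + 4 * ?n - 4 * ?f = 4 * q" by blast
    then have "?n\<^sup>2 + 4 * ?n - 4 * ?f \<le> 0" using ext' unfolding q by presburger
    then have "?n * (?n\<^sup>2 + 4 * ?n - 4 * ?f) \<le> 0" by (simp add: mult_nonneg_nonpos)
    moreover have "0 \<le> ?A" by (intro sum_nonneg) simp
    ultimately show ?thesis using degree_variance by linarith
  next
    case False
    have "(\<Sum>v\<in>V. 1) \<le> ?A"
    proof (rule sum_mono)
      fix v
      have "2 * int (card (nb v)) - (?n + 4) \<noteq> 0" using False by presburger
      then show "1 \<le> (2 * int (card (nb v)) - (?n + 4))\<^sup>2"
        by (metis int_one_le_iff_zero_less zero_less_power2)
    qed
    then have "?n \<le> ?A" by simp
    moreover have "?n * (?n\<^sup>2 + 4 * ?n - 4 * ?f) \<le> ?n * 1" using ext' by (intro mult_left_mono) auto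
    ultimately show ?thesis using degree_variance by linarith
  qed
  then have "?D = 0" by linarith
  then have "deficiency \<sigma> = 0" using \<sigma> finite_cliques[of 4] by simp
  then have "2 - card (nb w \<inter> \<sigma>) = 0" using w finite_V by (simp add: deficiency_def)
  then show ?thesis by simp
qed

end

section \<open>The structure of extremal graphs\<close>

context flag_3manifold_graph
begin

lemma mem_nb: "y \<in> nb x \<longleftrightarrow> adj x y"
  by (simp add: nb_def)

lemma nb_subset: "nb x \<subseteq> V"
  using adj_V' by (auto simp: nb_def)

lemma link_2_regular:
  assumes "adj x y" "adj x z" "adj y z"
  obtains p q where "p \<noteq> q" "\<not> adj p q" "lk x y \<inter> nb z = {p, q}" "card (lk x y \<inter> nb z) = 2"
proof -
  obtain p q where pq: "p \<noteq> q" "\<not> adj p q" "{w. adj x w \<and> adj y w \<and> adj z w} = {p, q}"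
    using triangle_nb[of x y z] assms by blast
  moreover have "lk x y \<inter> nb z = {w. adj x w \<and> adj y w \<and> adj z w}" by (auto simp: nb_def)
  ultimately show thesis using that[of p q] by simp
qed

lemma card_link_2_regular:
  assumes "adj x y" "adj x z" "adj y z"
  shows "card (lk x y \<inter> nb z) = 2" by (rule link_2_regular[OF assms])

lemma sum_nb_swap:
  assumes "finite A" "finite B"
  shows "(\<Sum>x\<in>A. card (B \<inter> nb x)) = (\<Sum>y\<in>B. card (A \<inter> nb y))"
proof -
  have "(\<Sum>x\<in>A. card (B \<inter> nb x)) = (\<Sum>x\<in>A. \<Sum>y\<in>{y \<in> B. adj x y}. 1)"
    by (intro sum.cong refl) (auto simp: nb_def intro!: arg_cong[of _ _ card])
  also have "\<dots> = (\<Sum>y\<in>B. \<Sum>x\<in>{x \<in> A. adj x y}. 1)" by (rule sum.swap_restrict[OF assms])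
  also have "\<dots> = (\<Sum>y\<in>B. card (A \<inter> nb y))"
    by (intro sum.cong refl) (auto simp: nb_def adj_commute intro!: arg_cong[of _ _ card])
  finally show ?thesis .
qed

text \<open>The handshake count in the link of \<open>u\<close>, whose number of edges is 3 d(u) -
  6.\<close>

lemma sum_link_degrees:
  assumes u: "u \<in> V"
  shows "(\<Sum>x\<in>nb u. card (lk u x)) + 12 = 6 * card (nb u)"
proof -
  have "(\<Sum>x\<in>nb u. card {e \<in> link_edges u. x \<in> e}) = 2 * card (link_edges u)"
  proof (rule sum_multicount[OF finite_nb finite_link_edges])
    show "\<forall>e\<in>link_edges u. card {x \<in> nb u. x \<in> e} = 2"
    proof
      fix e assume "e \<in> link_edges u"
      then obtain x y where e: "e = {x, y}" "adj u x" "adj u y" "adj x y" by (auto simp: link_edges_def)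
      then have "{x \<in> nb u. x \<in> e} = {x, y}" by (auto simp: nb_def)
      then show "card {x \<in> nb u. x \<in> e} = 2" using adj_neq[OF e(4)] by simp
    qed
  qed
  moreover have "card {e \<in> link_edges u. x \<in> e} = card (lk u x)" if x: "x \<in> nb u" for x
  proof -
    have "{e \<in> link_edges u. x \<in> e} = (\<lambda>y. {x, y}) ` (lk u x)"
    proof (intro equalityI subsetI)
      fix e assume "e \<in> {e \<in> link_edges u. x \<in> e}"
      then obtain a b where e: "e = {a, b}" "adj u a" "adj u b" "adj a b" "x = a \<or> x = b"
        by (auto simp: link_edges_def)
      then have "e = {x, b} \<and> b \<in> lk u x \<or> e = {x, a} \<and> a \<in> lk u x"
        using adj_sym[OF e(4)] by (auto simp: nb_def)
      then show "e \<in> (\<lambda>y. {x, y}) ` (lk u x)" by blast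
    next
      fix e assume "e \<in> (\<lambda>y. {x, y}) ` (lk u x)"
      then show "e \<in> {e \<in> link_edges u. x \<in> e}" using x by (auto simp: mem_link_edges nb_def)
    qed
    moreover have "inj_on (\<lambda>y. {x, y}) (lk u x)" by (rule inj_onI) (auto simp: doubleton_eq_iff)
    ultimately show ?thesis by (simp add: card_image)
  qed
  ultimately show ?thesis using card_link_edges[OF u] by simp
qed

lemma edge_link_nonempty_nb:
  assumes "adj u v"
  shows "lk u v \<noteq> {}" using edge_nb[OF assms] by (auto simp: nb_def)

text \<open>A link vertex \<open>c\<close>, its two non-adjacent neighbours p and q in the link, and
  the neighbour of p other than \<open>c\<close> are four different vertices.\<close>

lemma card_edge_link_ge_4:
  assumes uv: "adj u v"
  shows "4 \<le> card (lk u v)"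
proof -
  obtain c where c: "adj u c" "adj v c" using edge_nb[OF uv] by blast
  obtain p q where pq: "p \<noteq> q" "\<not> adj p q" "lk u v \<inter> nb c = {p, q}"
    by (rule link_2_regular[OF uv c])
  then have p: "adj u p" "adj v p" "adj c p" and q: "adj u q" "adj v q" "adj c q" by (auto simp: nb_def)
  have "card (lk u v \<inter> nb p) = 2" by (rule card_link_2_regular[OF uv p(1,2)])
  moreover have "card {c} = 1" by simp
  ultimately have "\<not> lk u v \<inter> nb p \<subseteq> {c}" using card_mono[of "{c}" "lk u v \<inter> nb p"] by auto
  then obtain r where r: "adj u r" "adj v r" "adj p r" "r \<noteq> c" by (auto simp: nb_def)
  have "{c, p, q, r} \<subseteq> lk u v" using c p q r by (auto simp: nb_def)
  moreover have "card {c, p, q, r} = 4"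
  proof -
    have "r \<noteq> q" using r(3) pq(2) by blast
    then show ?thesis using pq(1) r(4) adj_neq[OF p(3)] adj_neq[OF q(3)] adj_neq[OF r(3)] by auto
  qed
  moreover have "finite (lk u v)" using finite_nb by blast
  ultimately show ?thesis using card_mono by metis
qed

end

text \<open>Equality in the degree count means that no tetrahedron has positive deficiency.\<close>

locale extremal_graph = flag_3manifold_graph +
  assumes two_nb: "\<sigma> \<in> cliques 4 \<Longrightarrow> w \<in> V \<Longrightarrow> 2 \<le> card (nb w \<inter> \<sigma>)"
begin

lemma two_nb_clique:
  assumes w: "w \<in> V" and a: "adj a b" "adj a c" "adj a d" "adj b c" "adj b d" "adj c d"
  obtains x y where "x \<in> {a, b, c, d}" "y \<in> {a, b, c, d}" "x \<noteq> y" "adj w x" "adj w y"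
proof -
  have d: "a \<noteq> b" "a \<noteq> c" "a \<noteq> d" "b \<noteq> c" "b \<noteq> d" "c \<noteq> d" using a adj_neq by blast+
  have "{a, b, c, d} \<in> cliques 4" using a d adj_V adj_V' adj_sym by (auto simp: cliques_def)
  then have "2 \<le> card (nb w \<inter> {a, b, c, d})" using w by (rule two_nb)
  then have "\<not> card (nb w \<inter> {a, b, c, d}) \<le> Suc 0" by simp
  then obtain x y where "x \<in> nb w \<inter> {a, b, c, d}" "y \<in> nb w \<inter> {a, b, c, d}" "x \<noteq> y"
    unfolding card_le_Suc0_iff_eq[OF finite_Int[OF disjI1[OF finite_nb]]] by blast
  then show thesis by (intro that[of x y]) (simp_all add: nb_def)
qed

text \<open>Of the two neighbours that \<open>w\<close> has in the tetrahedron u, a, b, c, at most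
  one is \<open>u\<close>.\<close>

lemma link_triangle_nb:
  assumes "w \<in> V" "adj u a" "adj u b" "adj u c" "adj a b" "adj a c" "adj b c"
  shows "adj w a \<or> adj w b \<or> adj w c" by (rule two_nb_clique[of w u a b c]) (use assms in auto)

text \<open>With \<open>u\<close> and \<open>v\<close> excluded, the two neighbours of
  \<open>w\<close> in the tetrahedron u, v, c, c' can only be c and c'.\<close>

lemma edge_link_nb:
  assumes "w \<in> V" "\<not> adj w u" "\<not> adj w v" "adj u v" "adj u c" "adj v c" "adj u c'" "adj v c'" "adj c c'"
  shows "adj w c" by (rule two_nb_clique[of w u v c c']) (use assms in auto)

text \<open>The vertices of the sphere lk(u) outside the closed star of \<open>v\<close>, hence on
  the other side of the cycle lk(uv).\<close>

definition far :: "'a \<Rightarrow> 'a \<Rightarrow> 'a set" where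
  "far u v = {x. adj u x \<and> \<not> adj v x \<and> x \<noteq> v}"

lemma finite_far: "finite (far u v)"
  by (rule finite_subset[OF _ finite_nb[of u]]) (auto simp: far_def nb_def)

lemma nb_decomp:
  assumes "adj u v"
  shows "nb u = insert v (lk u v \<union> far u v)" "v \<notin> lk u v" "v \<notin> far u v"
    "lk u v \<inter> far u v = {}" using assms adj_irrefl by (auto simp: far_def nb_def)

lemma card_nb_decomp:
  assumes "adj u v"
  shows "card (nb u) = 1 + card (lk u v) + card (far u v)"
proof -
  have "card (nb u) = card (insert v (lk u v \<union> far u v))" by (subst nb_decomp(1)[OF assms]) simp
  also have "\<dots> = Suc (card (lk u v \<union> far u v))"
    using nb_decomp[OF assms] finite_far finite_nb by (intro card_insert_disjoint) auto
  also have "card (lk u v \<union> far u v) = card (lk u v) + card (far u v)"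
    using nb_decomp(4)[OF assms] finite_far finite_nb by (intro card_Un_disjoint) auto
  finally show ?thesis by simp
qed

text \<open>The link of the edge {u, c} is a cycle in which v stands between p and q, the two
  neighbours of \<open>c\<close> on lk(uv). The other vertices are the far neighbours of
  \<open>c\<close>; between p and q they have the degree sum of a path.\<close>

lemma far_degree_at_link_vertex:
  assumes uv: "adj u v" and c: "c \<in> lk u v"
  shows "(\<Sum>x\<in>far u v \<inter> nb c. card (far u v \<inter> nb c \<inter> nb x)) + 2 = 2 * card (far u v \<inter> nb c)"
    "card (lk u c) = 3 + card (far u v \<inter> nb c)"
proof -
  let ?M = "far u v \<inter> nb c"
  have uc: "adj u c" "adj v c" using c by (auto simp: nb_def)
  obtain p q where pq: "p \<noteq> q" "\<not> adj p q" "lk u v \<inter> nb c = {p, q}"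
    by (rule link_2_regular[OF uv uc])
  then have p: "adj u p" "adj v p" "adj c p" and q: "adj u q" "adj v q" "adj c q" by (auto simp: nb_def)
  have L: "lk u c = insert v ({p, q} \<union> ?M)" "v \<notin> {p, q} \<union> ?M" "{p, q} \<inter> ?M = {}"
  proof -
    show "lk u c = insert v ({p, q} \<union> ?M)"
      unfolding pq(3)[symmetric] using uv adj_sym[OF uc(2)] by (auto simp: nb_def far_def)
    show "v \<notin> {p, q} \<union> ?M" using p q adj_irrefl by (auto simp: far_def)
    show "{p, q} \<inter> ?M = {}" using p q by (auto simp: far_def)
  qed
  have finM: "finite ?M" using finite_far by blast
  show "card (lk u c) = 3 + card ?M"
  proof -
    have "card (lk u c) = Suc (card ({p, q} \<union> ?M))"
      unfolding L(1) using L(2) finM by (intro card_insert_disjoint) auto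
    also have "card ({p, q} \<union> ?M) = card {p, q} + card ?M"
      using L(3) finM by (intro card_Un_disjoint) auto
    finally show ?thesis using pq(1) by simp
  qed
  have x: "card ({p, q} \<inter> nb x) + card (?M \<inter> nb x) = 2" if x: "x \<in> ?M" for x
  proof -
    have ux: "adj u x" "adj c x" "\<not> adj x v" using x adj_sym by (auto simp: far_def nb_def)
    have "lk u c \<inter> nb x = {p, q} \<inter> nb x \<union> ?M \<inter> nb x"
      unfolding L(1) using ux(3) by (auto simp: nb_def)
    moreover have "card ({p, q} \<inter> nb x \<union> ?M \<inter> nb x) = card ({p, q} \<inter> nb x) + card (?M \<inter> nb x)"
      using L(3) finM by (intro card_Un_disjoint) auto
    ultimately show ?thesis using card_link_2_regular[OF uc(1) ux(1,2)] by simp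
  qed
  have one: "card (?M \<inter> nb z) = 1" if z: "z \<in> {p, q}" for z
  proof -
    have uz: "adj u z" "adj v z" "adj c z" using z p q by auto
    have "\<not> adj z p" "\<not> adj z q" using z pq(2) adj_irrefl adj_commute by auto
    then have "lk u c \<inter> nb z = insert v (?M \<inter> nb z)"
      unfolding L(1) using adj_sym[OF uz(2)] by (auto simp: nb_def)
    moreover have "card (lk u c \<inter> nb z) = 2" by (rule card_link_2_regular[OF uc(1) uz(1,3)])
    moreover have "card (insert v (?M \<inter> nb z)) = Suc (card (?M \<inter> nb z))"
      using L(2) finM by (intro card_insert_disjoint) auto
    ultimately show ?thesis by simp
  qed
  have "(\<Sum>x\<in>?M. card ({p, q} \<inter> nb x)) = (\<Sum>z\<in>{p, q}. card (?M \<inter> nb z))"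
    using finM by (intro sum_nb_swap) auto
  also have "\<dots> = 2" using one pq(1) by simp
  finally have "(\<Sum>x\<in>?M. card ({p, q} \<inter> nb x)) = 2" .
  moreover have "(\<Sum>x\<in>?M. card ({p, q} \<inter> nb x)) + (\<Sum>x\<in>?M. card (?M \<inter> nb x)) = (\<Sum>x\<in>?M. 2)"
    unfolding sum.distrib[symmetric] using x by (intro sum.cong) auto
  ultimately show "(\<Sum>x\<in>?M. card (?M \<inter> nb x)) + 2 = 2 * card ?M" by simp
qed

text \<open>Hence some vertex on the far side has at most one neighbour there.\<close>

lemma sum_far_degrees:
  assumes uv: "adj u v"
  shows "(\<Sum>x\<in>far u v. card (far u v \<inter> nb x)) + 2 = 2 * card (far u v)"
proof -
  let ?C = "lk u v" and ?M = "far u v"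
  define S where "S = (\<Sum>x\<in>?M. card (?M \<inter> nb x))"
  define e where "e = (\<Sum>c\<in>?C. card (?M \<inter> nb c))"
  have fin: "finite ?C" "finite ?M" using finite_nb finite_far by auto
  have vV: "v \<in> V" using uv adj_V' by blast
  \<comment> \<open>By extremality \<open>v\<close> is adjacent to a vertex of every triangle of
    lk(u). So the far side spans no triangle, and both triangles on a far edge have their third
    vertex on the cycle.\<close>
  have two: "card (?C \<inter> nb x \<inter> nb y) = 2" if xy: "x \<in> ?M" "y \<in> ?M \<inter> nb x" for x y
  proof -
    have a: "adj u x" "adj u y" "adj x y" "\<not> adj v x" "\<not> adj v y" using xy by (auto simp: far_def nb_def)
    have "lk u x \<inter> nb y = ?C \<inter> nb x \<inter> nb y"
    proof
      show "lk u x \<inter> nb y \<subseteq> ?C \<inter> nb x \<inter> nb y"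
      proof
        fix z assume "z \<in> lk u x \<inter> nb y"
        then have z: "adj u z" "adj x z" "adj y z" by (auto simp: nb_def)
        have "adj v z" using link_triangle_nb[OF vV a(1,2) z(1) a(3) z(2,3)] a(4,5) by blast
        then show "z \<in> ?C \<inter> nb x \<inter> nb y" using z by (simp add: nb_def)
      qed
    qed auto
    then show ?thesis using card_link_2_regular[OF a(1-3)] by simp
  qed
  \<comment> \<open>The triangles with two far vertices and one on the cycle are counted from their
    far edges and from their cycle vertices. The second count uses the paths of
    \<open>far_degree_at_link_vertex\<close>.\<close>
  have "2 * S = (\<Sum>x\<in>?M. \<Sum>y\<in>?M \<inter> nb x. card (?C \<inter> nb x \<inter> nb y))"
    unfolding S_def sum_distrib_left using two by (intro sum.cong) auto
  also have "\<dots> = (\<Sum>x\<in>?M. \<Sum>c\<in>?C \<inter> nb x. card (?M \<inter> nb x \<inter> nb c))"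
    using fin by (intro sum.cong refl sum_nb_swap) auto
  also have "\<dots> = (\<Sum>x\<in>?M. \<Sum>c\<in>{c \<in> ?C. adj x c}. card (?M \<inter> nb x \<inter> nb c))"
    by (intro sum.cong refl) (auto simp: nb_def)
  also have "\<dots> = (\<Sum>c\<in>?C. \<Sum>x\<in>{x \<in> ?M. adj x c}. card (?M \<inter> nb x \<inter> nb c))"
    by (rule sum.swap_restrict[OF fin(2,1)])
  also have "\<dots> = (\<Sum>c\<in>?C. \<Sum>x\<in>?M \<inter> nb c. card (?M \<inter> nb c \<inter> nb x))"
    by (intro sum.cong refl arg_cong[of _ _ card]) (auto simp: nb_def adj_commute)
  finally have "2 * S + 2 * card ?C = (\<Sum>c\<in>?C. (\<Sum>x\<in>?M \<inter> nb c. card (?M \<inter> nb c \<inter> nb x)) + 2)"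
    unfolding sum.distrib by simp
  also have "\<dots> = 2 * e"
    unfolding e_def sum_distrib_left using far_degree_at_link_vertex(1)[OF uv] by (intro sum.cong) auto
  finally have 1: "S + card ?C = e" by simp
  \<comment> \<open>The handshake count of lk(u), split into v, the cycle and the far side.\<close>
  have "(\<Sum>x\<in>nb u. card (lk u x)) = (\<Sum>x\<in>insert v (?C \<union> ?M). card (lk u x))"
    by (rule sum.cong[OF nb_decomp(1)[OF uv] refl])
  also have "\<dots> = card ?C + (\<Sum>x\<in>?C \<union> ?M. card (lk u x))"
    using nb_decomp[OF uv] fin by (intro sum.insert) auto
  also have "(\<Sum>x\<in>?C \<union> ?M. card (lk u x)) = (\<Sum>x\<in>?C. card (lk u x)) + (\<Sum>x\<in>?M. card (lk u x))"
    using nb_decomp(4)[OF uv] fin by (intro sum.union_disjoint) auto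
  also have "(\<Sum>x\<in>?C. card (lk u x)) = 3 * card ?C + e"
  proof -
    have "(\<Sum>x\<in>?C. card (lk u x)) = (\<Sum>x\<in>?C. 3 + card (?M \<inter> nb x))"
      using far_degree_at_link_vertex(2)[OF uv] by (intro sum.cong) auto
    then show ?thesis by (simp add: sum.distrib e_def)
  qed
  also have "(\<Sum>x\<in>?M. card (lk u x)) = e + S"
  proof -
    have "card (lk u x) = card (?C \<inter> nb x) + card (?M \<inter> nb x)" if x: "x \<in> ?M" for x
    proof -
      have "\<not> adj x v" using x adj_sym by (auto simp: far_def)
      then have "lk u x = ?C \<inter> nb x \<union> ?M \<inter> nb x" using nb_decomp(1)[OF uv] by (auto simp: nb_def)
      moreover have "card (?C \<inter> nb x \<union> ?M \<inter> nb x) = card (?C \<inter> nb x) + card (?M \<inter> nb x)"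
        using nb_decomp(4)[OF uv] fin by (intro card_Un_disjoint) auto
      ultimately show ?thesis by simp
    qed
    then have "(\<Sum>x\<in>?M. card (lk u x)) = (\<Sum>x\<in>?M. card (?C \<inter> nb x)) + S"
      by (simp add: S_def sum.distrib)
    then show ?thesis using sum_nb_swap[OF fin(2,1)] by (simp add: e_def)
  qed
  finally have "(\<Sum>x\<in>nb u. card (lk u x)) = 4 * card ?C + 2 * e + S" by simp
  moreover have "(\<Sum>x\<in>nb u. card (lk u x)) + 12 = 6 * card (nb u)"
    using sum_link_degrees uv adj_V by blast
  ultimately have "S + 2 = 2 * card ?M" using 1 card_nb_decomp[OF uv] by linarith
  then show ?thesis by (simp add: S_def)
qed


text \<open>Without far neighbours the link of the edge {u, x} lies inside the cycle lk(uv). Both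
  induce 2-regular graphs, so the smaller one is closed under adjacency in the connected larger one
  and equals it.\<close>

lemma far_degree_0:
  assumes uv: "adj u v" and x: "x \<in> far u v" and 0: "far u v \<inter> nb x = {}"
  shows "lk u v \<subseteq> nb x"
proof -
  have ux: "adj u x" "\<not> adj x v" using x adj_sym by (auto simp: far_def)
  have sub: "lk u x \<subseteq> lk u v" using nb_decomp(1)[OF uv] 0 ux by (auto simp: nb_def)
  have "lk u x = {z. adj u z \<and> adj v z}"
  proof (rule edge_conn[OF uv])
    show "lk u x \<subseteq> {z. adj u z \<and> adj v z}" using sub by (auto simp: nb_def)
    show "lk u x \<noteq> {}" by (rule edge_link_nonempty_nb[OF ux(1)])
    fix a b assume a: "a \<in> lk u x" and b: "adj u b" "adj v b" "adj a b"
    have a': "adj u a" "adj x a" "adj v a" using a sub by (auto simp: nb_def)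
    have "lk u x \<inter> nb a = lk u v \<inter> nb a"
      using sub finite_nb card_link_2_regular[OF ux(1) a'(1,2)] card_link_2_regular[OF uv a'(1,3)]
      by (intro card_subset_eq) auto
    then show "b \<in> lk u x" using b by (auto simp: nb_def)
  qed
  then show ?thesis by (auto simp: nb_def)
qed

text \<open>The link of {u, x} turns out to be a 4-cycle y, p, z, q with p, q, z on the cycle C =
  lk(uv). Every vertex of C other than p, q, z is then adjacent to p; so is z. If C has five or more
  vertices, p gets three neighbours on C, contradicting 2-regularity.\<close>

lemma far_degree_not_1:
  assumes uv: "adj u v" and k: "5 \<le> card (lk u v)" and x: "x \<in> far u v"
    and 1: "far u v \<inter> nb x = {y}"
  shows False
proof -
  let ?L = "lk u x" and ?C = "lk u v"
  have ux: "adj u x" "\<not> adj x v" "x \<in> V" using x adj_sym adj_V by (auto simp: far_def)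
  have "y \<in> far u v" "y \<in> nb x" using 1 by blast+
  then have y: "adj u y" "adj x y" "\<not> adj y v" "y \<in> V"
    using adj_sym adj_V' by (auto simp: far_def nb_def)
  have L: "?L = insert y (?C \<inter> nb x)" using nb_decomp(1)[OF uv] 1 ux by (auto simp: nb_def)
  obtain p q where pq: "p \<noteq> q" "\<not> adj p q" "?L \<inter> nb y = {p, q}"
    by (rule link_2_regular[OF ux(1) y(1,2)])
  then have p: "adj u p" "adj x p" "adj y p" and q: "adj u q" "adj x q" "adj y q" by (auto simp: nb_def)
  \<comment> \<open>A vertex not adjacent to \<open>v\<close> is adjacent to an end of every edge of
    the cycle, by extremality at the tetrahedron u, v, c, c'.\<close>
  have cover: "adj w c \<or> adj w c'"
    if "w \<in> V" "\<not> adj w v" "c \<in> ?C" "c' \<in> ?C" "adj c c'" for w c c'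
    using link_triangle_nb[OF that(1) uv, of c c'] that by (auto simp: nb_def)
  \<comment> \<open>Such a \<open>z\<close> is not adjacent to \<open>y\<close>, so by
    \<open>cover\<close> its neighbours in the link are adjacent to \<open>y\<close>, and these are
    only \<open>p\<close> and \<open>q\<close>.\<close>
  have rest: "?L \<inter> nb z = {p, q}" if z: "z \<in> ?L" "z \<notin> {y, p, q}" for z
  proof -
    have uz: "adj u z" "adj x z" using z by (auto simp: nb_def)
    have zC: "z \<in> ?C" using z L by blast
    have zy: "\<not> adj y z" using z pq(3) by (auto simp: nb_def)
    have "?L \<inter> nb z \<subseteq> {p, q}"
    proof
      fix w assume w: "w \<in> ?L \<inter> nb z"
      show "w \<in> {p, q}"
      proof (rule ccontr)
        assume wn: "w \<notin> {p, q}"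
        have "w \<noteq> y" using w zy adj_sym by (auto simp: nb_def)
        then have wC: "w \<in> ?C" using w L by blast
        have "adj y z \<or> adj y w" using cover[OF y(4,3) zC wC] w by (simp add: nb_def)
        then have "w \<in> ?L \<inter> nb y" using zy w by (simp add: nb_def)
        then show False using pq(3) wn by blast
      qed
    qed
    then show ?thesis using card_link_2_regular[OF ux(1) uz] pq(1) by (intro card_subset_eq) auto
  qed
  have "card (?L \<inter> nb p) = 2" by (rule card_link_2_regular[OF ux(1) p(1,2)])
  then have "\<not> ?L \<inter> nb p \<subseteq> {y}" using card_mono[of "{y}" "?L \<inter> nb p"] by auto
  then obtain z where z: "z \<in> ?L" "adj p z" "z \<noteq> y" by (auto simp: nb_def)
  have znot: "z \<notin> {y, p, q}" using z pq(2) adj_irrefl by auto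
  have L_eq: "?L = {y, p, q, z}"
  proof
    show "{y, p, q, z} \<subseteq> ?L" using y p q z by (auto simp: nb_def)
    show "?L \<subseteq> {y, p, q, z}"
    proof
      fix w assume w: "w \<in> ?L"
      show "w \<in> {y, p, q, z}"
      proof (rule ccontr)
        assume wn: "w \<notin> {y, p, q, z}"
        then have "p \<in> nb w" using rest[OF w] by blast
        moreover have "p \<in> nb z" using rest[OF z(1) znot] by blast
        ultimately have sub: "{y, z, w} \<subseteq> ?L \<inter> nb p" using w z y p(3) adj_sym by (auto simp: nb_def)
        have "card {y, z, w} = 3" using wn znot by auto
        then show False using card_mono[OF _ sub] finite_nb \<open>card (?L \<inter> nb p) = 2\<close> by auto
      qed
    qed
  qed
  have inC: "p \<in> ?C" "q \<in> ?C" "z \<in> ?C"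
  proof -
    have C: "w \<in> ?C" if "w \<in> ?L" "w \<noteq> y" for w using that(1) unfolding L using that(2) by simp
    show "p \<in> ?C" "q \<in> ?C" "z \<in> ?C"
      by (rule C; use L_eq adj_neq[OF p(3)] adj_neq[OF q(3)] z(3) in simp)+
  qed
  have Cx: "?C \<inter> nb x = {p, q, z}"
  proof
    show "{p, q, z} \<subseteq> ?C \<inter> nb x" using inC p(2) q(2) z(1) by (simp add: mem_nb)
    show "?C \<inter> nb x \<subseteq> {p, q, z}"
    proof
      fix w assume w: "w \<in> ?C \<inter> nb x"
      then have "w \<in> ?L" by simp
      then have "w \<in> {y, p, q, z}" unfolding L_eq .
      moreover have "w \<noteq> y" using w y(3) adj_sym[of v w] by (auto simp: mem_nb)
      ultimately show "w \<in> {p, q, z}" by simp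
    qed
  qed
  have Cz: "?C \<inter> nb z = {p, q}"
  proof -
    have "{p, q} \<subseteq> ?C \<inter> nb z" using rest[OF z(1) znot] inC by blast
    moreover have "card (?C \<inter> nb z) = 2" using inC(3) by (intro card_link_2_regular[OF uv]) (auto simp: nb_def)
    ultimately show ?thesis using finite_nb pq(1) card_subset_eq[of "?C \<inter> nb z" "{p, q}"] by auto
  qed
  \<comment> \<open>Since \<open>c\<close> is not adjacent to \<open>x\<close>, its cycle neighbours
    are, by \<open>cover\<close>. They lie in {p, q, z}, and z already has p and q as its two cycle
    neighbours.\<close>
  have other: "adj p c" if c: "c \<in> ?C" "c \<notin> {p, q, z}" for c
  proof -
    have "?C \<inter> nb c \<subseteq> {p, q}"
    proof
      fix w assume w: "w \<in> ?C \<inter> nb c"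
      then have "adj x c \<or> adj x w" using cover[OF ux(3,2) c(1), of w] by (simp add: nb_def)
      moreover have "\<not> adj x c" using Cx c by (auto simp: nb_def)
      ultimately have "w \<in> {p, q, z}" using Cx w by (auto simp: nb_def)
      moreover have "w \<noteq> z"
      proof
        assume "w = z"
        then have "c \<in> ?C \<inter> nb z" using w c adj_sym by (auto simp: nb_def)
        then show False using Cz c by blast
      qed
      ultimately show "w \<in> {p, q}" by blast
    qed
    moreover have "card (?C \<inter> nb c) = 2" using c(1) by (intro card_link_2_regular[OF uv]) (auto simp: nb_def)
    ultimately have "?C \<inter> nb c = {p, q}" using pq(1) card_subset_eq[of "{p, q}" "?C \<inter> nb c"] by auto
    then show ?thesis using adj_sym by (auto simp: nb_def)
  qed
  have "card {p, q, z} \<le> 3" by (simp add: card_insert_if)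
  then have "2 \<le> card (?C - {p, q, z})" using k diff_card_le_card_Diff[of "{p, q, z}" ?C] by simp
  then have "\<not> card (?C - {p, q, z}) \<le> Suc 0" by simp
  then have "\<not> (\<forall>c\<in>?C - {p, q, z}. \<forall>c'\<in>?C - {p, q, z}. c = c')"
    unfolding card_le_Suc0_iff_eq[OF finite_Diff[OF finite_Int[OF disjI1[OF finite_nb]]]] .
  then obtain c c' where c: "c \<in> ?C - {p, q, z}" "c' \<in> ?C - {p, q, z}" "c \<noteq> c'" by blast
  have "{z, c, c'} \<subseteq> ?C \<inter> nb p" using c other[of c] other[of c'] inC(3) z(2) by (simp add: mem_nb)
  moreover have "card (?C \<inter> nb p) = 2" using inC(1) by (intro card_link_2_regular[OF uv]) (auto simp: nb_def)
  moreover have "card {z, c, c'} = 3" using c by auto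
  moreover have "finite (?C \<inter> nb p)" by (simp add: finite_nb)
  ultimately show False using card_mono[of "?C \<inter> nb p" "{z, c, c'}"] by linarith
qed

lemma edge_link_edge:
  assumes "adj u v" "c \<in> lk u v"
  obtains c' where "c' \<in> lk u v" "adj c c'"
proof -
  have "card (lk u v \<inter> nb c) = 2" using assms by (intro card_link_2_regular) (auto simp: nb_def)
  then have "lk u v \<inter> nb c \<noteq> {}" by (metis card.empty zero_neq_numeral)
  then show thesis using that by (auto simp: nb_def)
qed

text \<open>A second far vertex y is adjacent to some c on the cycle, by extremality. But the link
  of {u, c} contains the closed 4-cycle v, p, x, q, where p and q are the cycle neighbours of c, and
  by connectedness it has no room for y.\<close>

lemma far_unique:
  assumes uv: "adj u v" and x: "x \<in> far u v" and C: "lk u v \<subseteq> nb x"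
  shows "far u v = {x}"
proof (rule ccontr)
  assume "far u v \<noteq> {x}"
  then obtain y where y: "y \<in> far u v" "y \<noteq> x" using x by blast
  have yv: "y \<in> V" "\<not> adj y v" "adj u y" using y adj_sym adj_V' by (auto simp: far_def)
  have ux: "adj u x" using x by (simp add: far_def)
  obtain c0 where c0: "c0 \<in> lk u v" using edge_link_nonempty_nb[OF uv] by blast
  obtain c0' where c0': "c0' \<in> lk u v" "adj c0 c0'" by (rule edge_link_edge[OF uv c0])
  have "adj y c0 \<or> adj y c0'"
    using link_triangle_nb[OF yv(1) uv, of c0 c0'] c0 c0' yv(2) by (auto simp: nb_def)
  then obtain c where c: "c \<in> lk u v" "adj y c" using c0 c0' by blast
  have uc: "adj u c" "adj v c" "adj x c" using c C by (auto simp: nb_def)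
  obtain p q where pq: "p \<noteq> q" "\<not> adj p q" "lk u v \<inter> nb c = {p, q}"
    by (rule link_2_regular[OF uv uc(1,2)])
  then have p: "adj u p" "adj v p" "adj c p" "adj x p" and q: "adj u q" "adj v q" "adj c q" "adj x q"
    using C by (auto simp: nb_def)
  have xv: "x \<noteq> v" "\<not> adj v x" using x by (auto simp: far_def)
  have pair: "lk u c \<inter> nb z = {a, b}"
    if "adj u z" "adj c z" "{a, b} \<subseteq> lk u c \<inter> nb z" "a \<noteq> b" for z a b
    using card_link_2_regular[OF uc(1) that(1,2)] that finite_nb
    by (intro card_subset_eq[symmetric]) auto
  have "{v, x, p, q} = {z. adj u z \<and> adj c z}"
  proof (rule edge_conn[OF uc(1)])
    show "{v, x, p, q} \<subseteq> {z. adj u z \<and> adj c z}" using uv ux uc p q adj_sym by auto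
    fix a b assume a: "a \<in> {v, x, p, q}" and b: "adj u b" "adj c b" "adj a b"
    have b': "b \<in> lk u c \<inter> nb a" using b by (simp add: nb_def)
    have s: "adj c v" "adj c x" "adj p v" "adj p x" "adj q v" "adj q x" using uc p q adj_sym by blast+
    have "lk u c \<inter> nb v = {p, q}" by (rule pair[OF uv s(1) _ pq(1)]) (simp add: mem_nb p q)
    moreover have "lk u c \<inter> nb x = {p, q}" by (rule pair[OF ux s(2) _ pq(1)]) (simp add: mem_nb p q)
    moreover have "lk u c \<inter> nb p = {v, x}"
      by (rule pair[OF p(1,3) _ xv(1)[symmetric]]) (simp add: mem_nb uv ux s)
    moreover have "lk u c \<inter> nb q = {v, x}"
      by (rule pair[OF q(1,3) _ xv(1)[symmetric]]) (simp add: mem_nb uv ux s)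
    ultimately show "b \<in> {v, x, p, q}" using a b' by blast
  qed simp
  moreover have "y \<in> {z. adj u z \<and> adj c z}" using yv c adj_sym by auto
  ultimately have "y \<in> {v, x, p, q}" by blast
  then show False using y yv p q adj_sym by (auto simp: far_def)
qed

text \<open>A far vertex without far neighbours is needed. In the first case the degree sum gives
  one with at most one far neighbour, and exactly one is impossible. In the second case every vertex
  of lk(u) has degree 4 there, so the handshake count gives d(u) = 6 and leaves a single far
  vertex.\<close>

lemma far_singleton:
  assumes uv: "adj u v"
    and k: "5 \<le> card (lk u v) \<or> (\<forall>x\<in>nb u. card (lk u x) = 4)"
  obtains x where "far u v = {x}" "lk u v \<subseteq> nb x"
proof -
  have sum: "(\<Sum>x\<in>far u v. card (far u v \<inter> nb x)) + 2 = 2 * card (far u v)"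
    by (rule sum_far_degrees[OF uv])
  have "\<exists>x\<in>far u v. far u v \<inter> nb x = {}"
  proof (cases "5 \<le> card (lk u v)")
    case True
    have "\<exists>x\<in>far u v. card (far u v \<inter> nb x) < 2"
    proof (rule ccontr)
      assume "\<not> ?thesis"
      then have "(\<Sum>x\<in>far u v. 2) \<le> (\<Sum>x\<in>far u v. card (far u v \<inter> nb x))" by (intro sum_mono) force
      then show False using sum by simp
    qed
    then obtain x where x: "x \<in> far u v" "card (far u v \<inter> nb x) < 2" by blast
    have "card (far u v \<inter> nb x) \<noteq> 1"
    proof
      assume "card (far u v \<inter> nb x) = 1"
      then obtain y where "far u v \<inter> nb x = {y}" by (auto simp: card_1_singleton_iff)
      then show False by (rule far_degree_not_1[OF uv True x(1)])
    qed
    then have "card (far u v \<inter> nb x) = 0" using x(2) by simp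
    then show ?thesis using x(1) finite_far by auto
  next
    case False
    then have 4: "\<forall>x\<in>nb u. card (lk u x) = 4" using k by blast
    then have "(\<Sum>x\<in>nb u. card (lk u x)) = 4 * card (nb u)" by simp
    then have "card (nb u) = 6" using sum_link_degrees[of u] uv adj_V by force
    moreover have "card (lk u v) = 4" using 4 uv by (auto simp: nb_def)
    ultimately have "card (far u v) = 1" using card_nb_decomp[OF uv] by simp
    then obtain x where x: "far u v = {x}" by (auto simp: card_1_singleton_iff)
    then have "far u v \<inter> nb x = {}" using adj_irrefl by (auto simp: nb_def)
    then show ?thesis using x by blast
  qed
  then obtain x where x: "x \<in> far u v" "far u v \<inter> nb x = {}" by blast
  have C: "lk u v \<subseteq> nb x" by (rule far_degree_0[OF uv x])
  show thesis by (rule that[OF far_unique[OF uv x(1) C] C])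
qed

text \<open>Once every vertex outside the cycle C is adjacent to all of C, the complement of C is
  the link of any edge of C, because a common vertex would complete a 5-clique.\<close>

lemma join_structure:
  assumes "V \<noteq> {}"
  obtains u v c c' where "adj u v" "adj c c'" "V = lk u v \<union> lk c c'"
    "lk u v \<inter> (lk c c') = {}"
    "\<And>x y. x \<in> lk u v \<Longrightarrow> y \<in> lk c c' \<Longrightarrow> adj x y"
proof -
  obtain u v where uv: "adj u v" and
    k: "5 \<le> card (lk u v) \<or> (\<forall>x y. adj x y \<longrightarrow> card (lk x y) = 4)"
  proof (cases "\<exists>u v. adj u v \<and> 5 \<le> card (lk u v)")
    case False
    have "card (lk x y) = 4" if "adj x y" for x y
    proof -
      have "\<not> 5 \<le> card (lk x y)" using False that by blast
      then show ?thesis using card_edge_link_ge_4[OF that] by linarith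
    qed
    moreover obtain u v where "adj u v" using assms vertex_nb by blast
    ultimately show ?thesis using that by blast
  qed (use that in blast)
  let ?C = "lk u v"
  have vu: "adj v u" using uv by (rule adj_sym)
  have ku: "5 \<le> card (lk u v) \<or> (\<forall>x\<in>nb u. card (lk u x) = 4)"
    and kv: "5 \<le> card (lk v u) \<or> (\<forall>x\<in>nb v. card (lk v x) = 4)"
    using k unfolding Int_commute[of "nb v" "nb u"] by (auto simp: mem_nb)
  obtain x where x: "far u v = {x}" "?C \<subseteq> nb x" by (rule far_singleton[OF uv ku])
  obtain x' where x': "far v u = {x'}" "lk v u \<subseteq> nb x'" by (rule far_singleton[OF vu kv])
  have join: "adj y c" if y: "y \<in> V" "y \<notin> ?C" and c: "c \<in> ?C" for y c
  proof -
    have cc: "adj u c" "adj v c" using c by (auto simp: nb_def)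
    \<comment> \<open>A vertex outside C is u, v, the unique far vertex on one of the two sides, or
      adjacent to neither u nor v; \<open>edge_link_nb\<close> settles the last case.\<close>
    consider "y = u" | "y = v" | "y \<noteq> v" "adj u y" "\<not> adj v y" | "y \<noteq> u" "adj v y" "\<not> adj u y"
      | "y \<noteq> u" "y \<noteq> v" "\<not> adj u y" "\<not> adj v y" using y(2) by (auto simp: nb_def)
    then show ?thesis
    proof cases
      case 3
      then have "y \<in> far u v" by (simp add: far_def)
      then show ?thesis using x c by (auto simp: nb_def)
    next
      case 4
      then have "y \<in> far v u" by (simp add: far_def)
      then show ?thesis using x' c by (auto simp: nb_def)
    next
      case 5
      obtain c' where c': "c' \<in> ?C" "adj c c'" by (rule edge_link_edge[OF uv c])
      show ?thesis
        by (rule edge_link_nb[OF y(1) _ _ uv cc _ _ c'(2)]) (use 5 adj_sym c' in \<open>auto simp: nb_def\<close>)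
    qed (use cc in auto)
  qed
  obtain c where c: "c \<in> ?C" using edge_link_nonempty_nb[OF uv] by blast
  obtain c' where c': "c' \<in> ?C" "adj c c'" by (rule edge_link_edge[OF uv c])
  have disj: "?C \<inter> (lk c c') = {}"
  proof (rule ccontr)
    assume "?C \<inter> lk c c' \<noteq> {}"
    then obtain d where d: "adj u d" "adj v d" "adj c d" "adj c' d" by (auto simp: nb_def)
    have "adj u c" "adj v c" "adj u c'" "adj v c'" using c c' by (auto simp: nb_def)
    then show False using no_5_clique[of u v c c' d] uv d c'(2) by blast
  qed
  show thesis
  proof (rule that[OF uv c'(2) _ disj])
    show "V = ?C \<union> lk c c'"
    proof
      show "V \<subseteq> ?C \<union> lk c c'"
      proof
        fix y assume y: "y \<in> V"
        show "y \<in> ?C \<union> lk c c'"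
        proof (cases "y \<in> ?C")
          case False
          have "y \<in> nb c" "y \<in> nb c'"
            using join[OF y False c] join[OF y False c'(1)] adj_sym by (simp_all only: mem_nb)
          then show ?thesis by simp
        qed simp
      qed
      show "?C \<union> lk c c' \<subseteq> V" using nb_subset by blast
    qed
    fix x y assume xy: "x \<in> ?C" "y \<in> lk c c'"
    then have "y \<in> V" "y \<notin> ?C" using nb_subset disj by blast+
    then show "adj x y" using join[OF _ _ xy(1)] adj_sym by blast
  qed
qed

end

section \<open>Cycles and their joins\<close>

text \<open>Walk around the graph without turning back; the walk first returns to its starting point,
  and by connectedness it has then visited everything.\<close>

lemma connected_2_regular_is_cycle:
  fixes R :: "'a \<Rightarrow> 'a \<Rightarrow> bool"
  assumes fin: "finite Z" and ne: "Z \<noteq> {}"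
    and sym: "\<And>x y. R x y \<Longrightarrow> R y x" and irr: "\<And>x. \<not> R x x"
    and reg: "\<And>x. x \<in> Z \<Longrightarrow> card {y \<in> Z. R x y} = 2"
    and conn: "\<And>A. A \<subseteq> Z \<Longrightarrow> A \<noteq> {} \<Longrightarrow> (\<And>a b. a \<in> A \<Longrightarrow> b \<in> Z \<Longrightarrow> R a b \<Longrightarrow> b \<in> A) \<Longrightarrow> A = Z"
  obtains f where "bij_betw f {..<card Z} Z"
    "\<And>i j. i < card Z \<Longrightarrow> j < card Z \<Longrightarrow> R (f i) (f j) \<longleftrightarrow> j = Suc i mod card Z \<or> i = Suc j mod card Z"
proof -
  have other: "\<exists>w. w \<in> Z \<and> R y w \<and> w \<noteq> x \<and> {z \<in> Z. R y z} = {x, w}" if xy: "x \<in> Z" "y \<in> Z" "R x y" for x y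
  proof -
    obtain a b where ab: "{z \<in> Z. R y z} = {a, b}" "a \<noteq> b" using reg[OF xy(2)] by (auto simp: card_2_iff)
    have "x \<in> {z \<in> Z. R y z}" using xy sym by blast
    then consider "x = a" | "x = b" using ab by blast
    then show ?thesis
    proof cases
      case 1
      have "b \<in> {z \<in> Z. R y z}" unfolding ab(1) by simp
      then have "b \<in> Z" "R y b" by blast+
      then show ?thesis using ab 1 by (intro exI[of _ b]) simp
    next
      case 2
      have "a \<in> {z \<in> Z. R y z}" unfolding ab(1) by simp
      then have "a \<in> Z" "R y a" by blast+
      then show ?thesis using ab 2 by (intro exI[of _ a]) (simp add: insert_commute)
    qed
  qed
  then obtain nxt where nxt: "\<And>x y. x \<in> Z \<Longrightarrow> y \<in> Z \<Longrightarrow> R x y \<Longrightarrow>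
      nxt x y \<in> Z \<and> R y (nxt x y) \<and> nxt x y \<noteq> x \<and> {z \<in> Z. R y z} = {x, nxt x y}" by metis
  obtain z0 where z0: "z0 \<in> Z" using ne by blast
  have "{y \<in> Z. R z0 y} \<noteq> {}" using reg[OF z0] by (metis card.empty zero_neq_numeral)
  then obtain z1 where z1: "z1 \<in> Z" "R z0 z1" by blast
  \<comment> \<open>The state is an oriented edge; \<open>nxt x y\<close> is the neighbour of
    \<open>y\<close> other than \<open>x\<close>.\<close>
  define st where "st i = ((\<lambda>(x, y). (y, nxt x y)) ^^ i) (z0, z1)" for i
  define s where "s i = fst (st i)" for i
  have st: "fst (st i) \<in> Z \<and> snd (st i) \<in> Z \<and> R (fst (st i)) (snd (st i))" for i
  proof (induction i)
    case (Suc i)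
    then show ?case using nxt[of "fst (st i)" "snd (st i)"] by (simp add: st_def case_prod_beta)
  qed (simp add: st_def z0 z1)
  have snd_st: "snd (st i) = s (Suc i)" for i by (simp add: s_def st_def case_prod_beta)
  have s: "s i \<in> Z" "R (s i) (s (Suc i))" for i using st[of i] snd_st[of i] by (auto simp: s_def)
  have s2: "s (Suc (Suc i)) \<noteq> s i" "{z \<in> Z. R (s (Suc i)) z} = {s i, s (Suc (Suc i))}" for i
  proof -
    have "s (Suc (Suc i)) = nxt (s i) (s (Suc i))"
      using snd_st[of "Suc i"] snd_st[of i] by (simp add: st_def s_def case_prod_beta)
    then show "s (Suc (Suc i)) \<noteq> s i" "{z \<in> Z. R (s (Suc i)) z} = {s i, s (Suc (Suc i))}"
      using nxt[OF s(1) s(1) s(2), of i] by auto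
  qed
  have "\<not> inj s"
    using fin s(1) by (meson finite_imageD finite_subset image_subsetI infinite_UNIV_nat)
  then have ex: "\<exists>k. \<exists>j<k. s k = s j" unfolding inj_def by (metis linorder_neqE_nat)
  define k where "k = (LEAST k. \<exists>j<k. s k = s j)"
  have "\<exists>j<k. s k = s j" unfolding k_def by (rule LeastI_ex[OF ex])
  then obtain j where j: "j < k" "s k = s j" by blast
  have least: "\<not> (\<exists>j<i. s i = s j)" if "i < k" for i
    using that not_less_Least unfolding k_def by blast
  have inj: "a = b" if "a < k" "b < k" "s a = s b" for a b
    using least[OF that(1)] least[OF that(2)] that(3) by (metis linorder_neqE_nat)
  obtain k' where k': "k = Suc k'" using j by (cases k) auto
  \<comment> \<open>If the first repeated vertex had a predecessor on the walk, its two neighbours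
    would be that predecessor and its successor. The walk arrives through one of them, and each
    choice gives an earlier repetition, a turn back or a loop.\<close>
  have j0: "j = 0"
  proof (rule ccontr)
    assume "j \<noteq> 0"
    then obtain i where i: "j = Suc i" by (cases j) auto
    have "s k' \<in> {z \<in> Z. R (s j) z}" using s(1)[of k'] s(2)[of k'] sym j(2) k' by auto
    then have "s k' = s i \<or> s k' = s (Suc j)" using s2(2)[of i] i by auto
    then show False
    proof
      assume "s k' = s i"
      then show False using inj[of k' i] j(1) i k' by simp
    next
      assume e: "s k' = s (Suc j)"
      show False
      proof (cases "Suc j < k")
        case True
        then have "k' = Suc j" using inj[of k' "Suc j"] e k' by simp
        then show False using s2(1)[of j] j(2) k' by simp
      next
        case False
        then have "k' = j" using j(1) k' by simp
        then show False using s(2)[of j] j(2) k' irr by auto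
      qed
    qed
  qed
  have sk: "s k = s 0" using j(2) j0 by simp
  have k2: "2 < k"
  proof -
    have "k \<noteq> 1" using s(2)[of 0] sk irr by auto
    moreover have "k \<noteq> 2" using s2(1)[of 0] sk by (auto simp: numeral_2_eq_2)
    ultimately show ?thesis using j(1) by simp
  qed
  have sm: "s (Suc i mod k) = s (Suc i)" if "i < k" for i using that sk by (cases "Suc i = k") auto
  have prev: "\<exists>p<k. Suc p mod k = i \<and> {z \<in> Z. R (s i) z} = {s p, s (Suc i mod k)}" if i: "i < k" for i
  proof (cases i)
    case (Suc p)
    then show ?thesis using s2(2)[of p] sm[OF i] i by (intro exI[of _ p]) auto
  next
    case 0
    have "s k' \<in> {z \<in> Z. R (s 0) z}" "s 1 \<in> {z \<in> Z. R (s 0) z}"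
      using s(1)[of k'] s(2)[of k'] s(1)[of 1] s(2)[of 0] sym sk k' by auto
    moreover have ne: "s k' \<noteq> s 1" using inj[of k' 1] k2 k' by auto
    moreover have "card {z \<in> Z. R (s 0) z} = 2" by (rule reg[OF s(1)])
    moreover have "finite {z \<in> Z. R (s 0) z}" using fin by simp
    ultimately have "{s k', s 1} = {z \<in> Z. R (s 0) z}" by (intro card_subset_eq) auto
    then show ?thesis using 0 k' k2 by (intro exI[of _ k']) auto
  qed
  have surj: "s ` {..<k} = Z"
  proof (rule conn)
    show "s ` {..<k} \<subseteq> Z" using s(1) by auto
    show "s ` {..<k} \<noteq> {}" using k2 by auto
    fix a b assume a: "a \<in> s ` {..<k}" and b: "b \<in> Z" "R a b"
    obtain i where i: "i < k" "a = s i" using a by auto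
    obtain p where p: "p < k" "{z \<in> Z. R (s i) z} = {s p, s (Suc i mod k)}" using prev[OF i(1)] by blast
    have "b \<in> {s p, s (Suc i mod k)}" unfolding p(2)[symmetric] using b i(2) by simp
    moreover have "Suc i mod k < k" using k2 by simp
    ultimately show "b \<in> s ` {..<k}" using p(1) by blast
  qed
  have inj_s: "inj_on s {..<k}" using inj by (auto intro: inj_onI)
  then have kZ: "card Z = k" using surj by (metis card_image card_lessThan)
  show thesis
  proof (rule that[of s]; unfold kZ)
    show "bij_betw s {..<k} Z" using inj_s surj by (simp add: bij_betw_def)
    fix i j assume i: "i < k" and j: "j < k"
    show "R (s i) (s j) \<longleftrightarrow> j = Suc i mod k \<or> i = Suc j mod k"
    proof
      assume "R (s i) (s j)"
      obtain p where p: "p < k" "Suc p mod k = i" "{z \<in> Z. R (s i) z} = {s p, s (Suc i mod k)}"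
        using prev[OF i] by blast
      have "s j \<in> {s p, s (Suc i mod k)}" unfolding p(3)[symmetric] using \<open>R (s i) (s j)\<close> s(1) by simp
      then consider "s j = s p" | "s j = s (Suc i mod k)" by blast
      then show "j = Suc i mod k \<or> i = Suc j mod k"
      proof cases
        case 1
        then have "j = p" by (rule inj[OF j p(1)])
        then show ?thesis using p(2) by simp
      next
        case 2
        then have "j = Suc i mod k" by (intro inj[OF j]) (use k2 in auto)
        then show ?thesis by simp
      qed
    next
      assume "j = Suc i mod k \<or> i = Suc j mod k"
      then show "R (s i) (s j)"
      proof
        assume "j = Suc i mod k"
        then show ?thesis using s(2)[of i] sm[OF i] by simp
      next
        assume "i = Suc j mod k"
        then show ?thesis using s(2)[of j] sm[OF j] sym by simp
      qed
    qed
  qed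
qed

lemma Suc_mod_neq:
  fixes i k :: nat
  assumes "i < k" "2 \<le> k"
  shows "Suc i mod k \<noteq> i" using assms by (auto simp: mod_Suc)

lemma finite_cycle_complex: "finite (cycle_complex k)"
  by (simp add: cycle_complex_def Setcompr_eq_image lessThan_def[symmetric])

lemma cycle_complex_finite_face: "F \<in> cycle_complex k \<Longrightarrow> finite F"
  by (auto simp: cycle_complex_def)

lemma cycle_complex_subset: "F \<in> cycle_complex k \<Longrightarrow> F \<subseteq> {..<k}"
  by (auto simp: cycle_complex_def)

lemma card_cycle_complex_faces:
  assumes k: "3 \<le> k"
  shows "card {F \<in> cycle_complex k. card F = m} = (if m = 0 then 1 else if m = 1 \<or> m = 2 then k else 0)"
proof -
  have two: "card {i, Suc i mod k} = 2" if "i < k" for i using Suc_mod_neq[OF that] k by auto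
  consider "m = 0" | "m = 1" | "m = 2" | "m > 2" by linarith
  then show ?thesis
  proof cases
    case 1
    have "{F \<in> cycle_complex k. card F = 0} = {{}}"
      using cycle_complex_finite_face by (auto simp: cycle_complex_def)
    then show ?thesis using 1 by simp
  next
    case 2
    have "{F \<in> cycle_complex k. card F = 1} = (\<lambda>i. {i}) ` {..<k}"
      using two by (auto simp: cycle_complex_def)
    then show ?thesis using 2 by (simp add: card_image)
  next
    case 3
    have "{F \<in> cycle_complex k. card F = 2} = (\<lambda>i. {i, Suc i mod k}) ` {..<k}"
      using two by (auto simp: cycle_complex_def)
    moreover have "inj_on (\<lambda>i. {i, Suc i mod k}) {..<k}"
    proof (rule inj_onI)
      fix i j assume ij: "i \<in> {..<k}" "j \<in> {..<k}" "{i, Suc i mod k} = {j, Suc j mod k}"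
      \<comment> \<open>The second alternative gives i + 2 = i modulo k, which is impossible for k
        at least 3.\<close>
      then have "i = j \<or> i = Suc j mod k \<and> j = Suc i mod k" by (auto simp: doubleton_eq_iff)
      then show "i = j" using ij(1,2) k by (auto simp: mod_Suc split: if_splits)
    qed
    ultimately show ?thesis using 3 by (simp add: card_image)
  next
    case 4
    have e: "{F \<in> cycle_complex k. card F = m} = {}" using two 4 by (auto simp: cycle_complex_def)
    show ?thesis unfolding e using 4 by simp
  qed
qed

text \<open>A face of the join is a pair of faces whose sizes add up, so the generating polynomials
  of the face numbers multiply.\<close>

lemma card_join_faces:
  fixes K :: "'a set set" and L :: "'b set set"
  assumes fin: "finite K" "finite L" "\<And>F. F \<in> K \<Longrightarrow> finite F" "\<And>G. G \<in> L \<Longrightarrow> finite G"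
  shows "card {H \<in> simplicial_join K L. card H = m}
    = (\<Sum>a\<le>m. card {F \<in> K. card F = a} * card {G \<in> L. card G = m - a})"
proof -
  let ?P = "\<Union>a\<in>{..m}. {F \<in> K. card F = a} \<times> {G \<in> L. card G = m - a}"
  have "{H \<in> simplicial_join K L. card H = m} = (\<lambda>(F, G). F <+> G) ` ?P"
  proof (intro equalityI subsetI)
    fix H assume "H \<in> {H \<in> simplicial_join K L. card H = m}"
    then obtain F G where FG: "F \<in> K" "G \<in> L" "H = F <+> G" "card H = m" by (auto simp: simplicial_join_def)
    then have "card F + card G = m" using fin by (simp add: card_Plus)
    then show "H \<in> (\<lambda>(F, G). F <+> G) ` ?P" using FG by (intro image_eqI[of _ _ "(F, G)"]) auto
  next
    fix H assume "H \<in> (\<lambda>(F, G). F <+> G) ` ?P"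
    then obtain F G where FG: "F \<in> K" "G \<in> L" "H = F <+> G" "card F \<le> m" "card G = m - card F" by auto
    then show "H \<in> {H \<in> simplicial_join K L. card H = m}"
      using fin by (auto simp: simplicial_join_def card_Plus)
  qed
  moreover have "inj_on (\<lambda>(F, G). F <+> G) ?P"
  proof (rule inj_onI, clarify)
    fix F :: "'a set" and G :: "'b set" and F' G' assume "F <+> G = F' <+> G'"
    then have "Inl -` (F <+> G) = Inl -` (F' <+> G')" "Inr -` (F <+> G) = Inr -` (F' <+> G')" by simp_all
    then show "F = F' \<and> G = G'" by (auto simp: vimage_def)
  qed
  moreover have "card ?P = (\<Sum>a\<le>m. card ({F \<in> K. card F = a} \<times> {G \<in> L. card G = m - a}))"
    using fin by (intro card_UN_disjoint) auto
  ultimately show ?thesis by (simp add: card_image card_cartesian_product)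
qed

lemma J2_eq: "J2 n = simplicial_join (cycle_complex (n div 2)) (cycle_complex (n - n div 2))"
proof -
  have "\<lfloor>real n / 2\<rfloor> = int (n div 2)" using floor_divide_of_nat_eq[of n 2] by simp
  moreover have "\<lceil>real n / 2\<rceil> = int (n - n div 2)"
    by (rule ceiling_unique; cases "even n") (auto elim!: evenE oddE simp: field_simps)
  ultimately show ?thesis unfolding J2_def by (simp only: nat_int)
qed

text \<open>The coefficients of (1 + k t + k t^2) (1 + l t + l t^2). The bound on n makes both
  cycles have at least three vertices.\<close>

lemma card_J2_faces:
  assumes "6 \<le> n"
  defines "k \<equiv> n div 2" and "l \<equiv> n - n div 2"
  shows "card {H \<in> J2 n. card H = 0} = 1" "card {H \<in> J2 n. card H = 1} = n"
    "card {H \<in> J2 n. card H = 2} = n + k * l" "card {H \<in> J2 n. card H = 3} = 2 * (k * l)"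
    "card {H \<in> J2 n. card H = 4} = k * l"
proof -
  have kl: "3 \<le> k" "3 \<le> l" "k + l = n" using assms by auto
  have J: "card {H \<in> J2 n. card H = m} = (\<Sum>a\<le>m. (if a = 0 then 1 else if a = 1 \<or> a = 2 then k else 0)
      * (if m - a = 0 then 1 else if m - a = 1 \<or> m - a = 2 then l else 0))" for m
  proof -
    have "card {H \<in> J2 n. card H = m} = (\<Sum>a\<le>m. card {F \<in> cycle_complex k. card F = a} * card {G \<in> cycle_complex l. card G = m - a})"
      unfolding J2_eq k_def l_def
      by (rule card_join_faces) (auto intro: finite_cycle_complex cycle_complex_finite_face)
    then show ?thesis unfolding card_cycle_complex_faces[OF kl(1)] card_cycle_complex_faces[OF kl(2)] .
  qed
  show "card {H \<in> J2 n. card H = 0} = 1" "card {H \<in> J2 n. card H = 1} = n"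
    "card {H \<in> J2 n. card H = 2} = n + k * l" "card {H \<in> J2 n. card H = 3} = 2 * (k * l)"
    "card {H \<in> J2 n. card H = 4} = k * l" unfolding J using kl(3) by (simp_all add: numeral_eq_Suc)
qed

lemma vertices_J2:
  assumes "2 \<le> n"
  shows "vertices (J2 n) = {..<n div 2} <+> {..<n - n div 2}"
proof -
  have v: "\<Union>(cycle_complex k) = {..<k}" for k
    using cycle_complex_subset by (auto simp: cycle_complex_def)
  have e: "{} \<in> cycle_complex k" for k by (simp add: cycle_complex_def)
  have "\<Union>(simplicial_join K L) = \<Union>K <+> \<Union>L" if "{} \<in> K" "{} \<in> L" for K :: "nat set set" and L :: "nat set set"
  proof (intro equalityI subsetI)
    fix x assume "x \<in> \<Union>(simplicial_join K L)"
    then show "x \<in> \<Union>K <+> \<Union>L" by (auto simp: simplicial_join_def)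
  next
    fix x assume "x \<in> \<Union>K <+> \<Union>L"
    then consider F a where "x = Inl a" "a \<in> F" "F \<in> K" | G b where "x = Inr b" "b \<in> G" "G \<in> L" by auto
    then show "x \<in> \<Union>(simplicial_join K L)"
    proof cases
      case 1
      then have "F <+> {} \<in> simplicial_join K L" "x \<in> F <+> {}" using that by (auto simp: simplicial_join_def)
      then show ?thesis by blast
    next
      case 2
      then have "{} <+> G \<in> simplicial_join K L" "x \<in> {} <+> G" using that by (auto simp: simplicial_join_def)
      then show ?thesis by blast
    qed
  qed
  then show ?thesis unfolding vertices_def J2_eq using v e by simp
qed

lemma pairwise_Un_iff:
  assumes "\<And>x y. x \<in> X \<Longrightarrow> y \<in> Y \<Longrightarrow> R x y" "\<And>x y. x \<in> X \<Longrightarrow> y \<in> Y \<Longrightarrow> R y x"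
  shows "(\<forall>x\<in>X \<union> Y. \<forall>y\<in>X \<union> Y. x \<noteq> y \<longrightarrow> R x y) \<longleftrightarrow>
    (\<forall>x\<in>X. \<forall>y\<in>X. x \<noteq> y \<longrightarrow> R x y) \<and> (\<forall>x\<in>Y. \<forall>y\<in>Y. x \<noteq> y \<longrightarrow> R x y)" using assms by blast

context flag_3manifold_graph
begin

text \<open>The graph induced on an edge link is a single cycle, and it contains no triangle because
  u and v would complete a 5-clique. So its cliques are exactly the faces of the cycle
  complex.\<close>

lemma edge_link_cycle:
  assumes uv: "adj u v"
  defines "A \<equiv> lk u v"
  obtains f where "bij_betw f {..<card A} A"
    "\<And>F. F \<subseteq> {..<card A} \<Longrightarrow> F \<in> cycle_complex (card A) \<longleftrightarrow> (\<forall>x\<in>f ` F. \<forall>y\<in>f ` F. x \<noteq> y \<longrightarrow> adj x y)"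
proof -
  obtain f where f: "bij_betw f {..<card A} A"
    "\<And>i j. i < card A \<Longrightarrow> j < card A \<Longrightarrow> adj (f i) (f j) \<longleftrightarrow> j = Suc i mod card A \<or> i = Suc j mod card A"
  proof (rule connected_2_regular_is_cycle[of A adj])
    show "finite A" using finite_nb by (simp add: A_def)
    show "A \<noteq> {}" unfolding A_def by (rule edge_link_nonempty_nb[OF uv])
    show "adj y x" if "adj x y" for x y using that by (rule adj_sym)
    show "\<not> adj x x" for x by (rule adj_irrefl)
    show "card {y \<in> A. adj x y} = 2" if x: "x \<in> A" for x
    proof -
      have "{y \<in> A. adj x y} = lk u v \<inter> nb x" by (auto simp: A_def mem_nb)
      then show ?thesis using card_link_2_regular[OF uv, of x] x by (simp add: A_def mem_nb)
    qed
    show "B = A" if B: "B \<subseteq> A" "B \<noteq> {}" "\<And>a b. a \<in> B \<Longrightarrow> b \<in> A \<Longrightarrow> adj a b \<Longrightarrow> b \<in> B" for B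
    proof -
      have "B = {x. adj u x \<and> adj v x}"
        by (rule edge_conn[OF uv]) (use B in \<open>auto simp: A_def mem_nb\<close>)
      then show ?thesis by (auto simp: A_def mem_nb)
    qed
  qed (rule that)
  let ?k = "card A"
  have k4: "4 \<le> ?k" unfolding A_def by (rule card_edge_link_ge_4[OF uv])
  have inj: "f i \<noteq> f j" if "i < ?k" "j < ?k" "i \<noteq> j" for i j
    using f(1) that by (auto simp: bij_betw_def inj_on_def)
  have fA: "adj u (f i)" "adj v (f i)" if "i < ?k" for i
    using bij_betwE[OF f(1)] that by (auto simp: A_def mem_nb)
  show thesis
  proof (rule that[OF f(1)])
    fix F assume F: "F \<subseteq> {..<?k}"
    show "F \<in> cycle_complex ?k \<longleftrightarrow> (\<forall>x\<in>f ` F. \<forall>y\<in>f ` F. x \<noteq> y \<longrightarrow> adj x y)"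
    proof
      assume "F \<in> cycle_complex ?k"
      then consider "F = {}" | i where "F = {i}" | i where "i < ?k" "F = {i, Suc i mod ?k}"
        by (auto simp: cycle_complex_def)
      then show "\<forall>x\<in>f ` F. \<forall>y\<in>f ` F. x \<noteq> y \<longrightarrow> adj x y"
      proof cases
        case 3
        have "adj (f i) (f (Suc i mod ?k))" using f(2)[of i "Suc i mod ?k"] 3(1) k4 by auto
        then show ?thesis using 3(2) adj_sym by auto
      qed auto
    next
      assume cl: "\<forall>x\<in>f ` F. \<forall>y\<in>f ` F. x \<noteq> y \<longrightarrow> adj x y"
      have adjF: "adj (f i) (f j)" if "i \<in> F" "j \<in> F" "i \<noteq> j" for i j
        using cl inj[of i j] F that by blast
      show "F \<in> cycle_complex ?k"
      proof (cases "\<exists>i j. i \<in> F \<and> j \<in> F \<and> i \<noteq> j")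
        case False
        then have "F = {} \<or> (\<exists>i. F = {i})" by blast
        then show ?thesis using F by (auto simp: cycle_complex_def)
      next
        case True
        then obtain i j where ij: "i \<in> F" "j \<in> F" "i \<noteq> j" by blast
        have "F = {i, j}"
        proof (rule ccontr)
          assume "F \<noteq> {i, j}"
          then obtain m where m: "m \<in> F" "m \<noteq> i" "m \<noteq> j" using ij by blast
          have "i < ?k" "j < ?k" "m < ?k" using F ij m by auto
          then have "\<not> adj (f j) (f m)"
            by (intro no_5_clique[of u v "f i" "f j" "f m"] uv fA adjF) (use ij m in auto)
          then show False using adjF[OF ij(2) m(1)] m(3) by blast
        qed
        moreover have "j = Suc i mod ?k \<or> i = Suc j mod ?k"
          using f(2)[of i j] adjF[OF ij] F ij by auto
        ultimately show ?thesis using F by (auto simp: cycle_complex_def insert_commute)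
      qed
    qed
  qed
qed

lemma degree_in_join:
  assumes uv: "adj u v" and x: "x \<in> lk u v" and V: "V = lk u v \<union> B" "lk u v \<inter> B = {}"
    and join: "\<And>y. y \<in> B \<Longrightarrow> adj x y"
  shows "card (nb x) = card B + 2"
proof -
  have "nb x = B \<union> (lk u v \<inter> nb x)" using nb_subset[of x] V join by (auto simp: mem_nb)
  moreover have "card (B \<union> (lk u v \<inter> nb x)) = card B + card (lk u v \<inter> nb x)"
    using V finite_V by (intro card_Un_disjoint) (auto intro: finite_subset)
  moreover have "card (lk u v \<inter> nb x) = 2"
    using x by (intro card_link_2_regular[OF uv]) (auto simp: mem_nb)
  ultimately show ?thesis by simp
qed

end

context extremal_graph
begin

text \<open>The edge count yields the product of the two cycle lengths; together with their sum, the
  number of vertices, it determines the lengths.\<close>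

lemma join_of_link_cycles:
  assumes "V \<noteq> {}"
  obtains A B f g where "V = A \<union> B" "A \<inter> B = {}" "card (cliques 2) = card V + card A * card B"
    "bij_betw f {..<card A} A" "bij_betw g {..<card B} B"
    "\<And>F G. F \<subseteq> {..<card A} \<Longrightarrow> G \<subseteq> {..<card B} \<Longrightarrow>
      (\<forall>x\<in>f ` F \<union> g ` G. \<forall>y\<in>f ` F \<union> g ` G. x \<noteq> y \<longrightarrow> adj x y) \<longleftrightarrow>
      F \<in> cycle_complex (card A) \<and> G \<in> cycle_complex (card B)"
proof -
  obtain u v c c' where e: "adj u v" "adj c c'" and V: "V = lk u v \<union> lk c c'"
    and disj: "lk u v \<inter> (lk c c') = {}"
    and join: "\<And>x y. x \<in> lk u v \<Longrightarrow> y \<in> lk c c' \<Longrightarrow> adj x y"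
    by (rule join_structure[OF assms]) (rule that)
  define A where "A = lk u v"
  define B where "B = lk c c'"
  note [folded A_def B_def] = V disj join
  note V = this(1) and disj = this(2) and join = this(3)
  have fin: "finite A" "finite B" using finite_nb by (auto simp: A_def B_def)
  have "(\<Sum>x\<in>V. card (nb x)) = (\<Sum>x\<in>A. card (nb x)) + (\<Sum>x\<in>B. card (nb x))"
    unfolding V by (rule sum.union_disjoint[OF fin disj])
  also have "(\<Sum>x\<in>A. card (nb x)) = (\<Sum>x\<in>A. card B + 2)"
    by (intro sum.cong refl degree_in_join[OF e(1), folded A_def] V disj join)
  also have "(\<Sum>x\<in>B. card (nb x)) = (\<Sum>x\<in>B. card A + 2)"
    by (intro sum.cong refl degree_in_join[OF e(2), folded B_def] adj_sym[OF join]) (use V disj in auto)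
  finally have "2 * card (cliques 2) = card A * (card B + 2) + card B * (card A + 2)"
    using sum_degree by simp
  moreover have "card V = card A + card B" unfolding V by (rule card_Un_disjoint[OF fin disj])
  ultimately have f1: "card (cliques 2) = card V + card A * card B" by (simp add: algebra_simps)
  obtain f where f: "bij_betw f {..<card A} A"
    "\<And>F. F \<subseteq> {..<card A} \<Longrightarrow> F \<in> cycle_complex (card A) \<longleftrightarrow> (\<forall>x\<in>f ` F. \<forall>y\<in>f ` F. x \<noteq> y \<longrightarrow> adj x y)"
    by (rule edge_link_cycle[OF e(1), folded A_def]) (rule that)
  obtain g where g: "bij_betw g {..<card B} B"
    "\<And>F. F \<subseteq> {..<card B} \<Longrightarrow> F \<in> cycle_complex (card B) \<longleftrightarrow> (\<forall>x\<in>g ` F. \<forall>y\<in>g ` F. x \<noteq> y \<longrightarrow> adj x y)"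
    by (rule edge_link_cycle[OF e(2), folded B_def]) (rule that)
  show thesis
  proof (rule that[OF V disj f1 f(1) g(1)])
    fix F G assume FG: "F \<subseteq> {..<card A}" "G \<subseteq> {..<card B}"
    have cross: "adj x y" if "x \<in> f ` F" "y \<in> g ` G" for x y
      using that FG bij_betwE[OF f(1)] bij_betwE[OF g(1)] by (intro join) auto
    show "(\<forall>x\<in>f ` F \<union> g ` G. \<forall>y\<in>f ` F \<union> g ` G. x \<noteq> y \<longrightarrow> adj x y) \<longleftrightarrow>
        F \<in> cycle_complex (card A) \<and> G \<in> cycle_complex (card B)"
      unfolding f(2)[OF FG(1)] g(2)[OF FG(2)] by (rule pairwise_Un_iff[OF cross adj_sym[OF cross]])
  qed
qed

end

section \<open>From flag manifolds to graphs\<close>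

text \<open>A smallest non-face inside \<open>F\<close> is a minimal non-face, hence a pair, but all
  pairs in \<open>F\<close> are faces.\<close>

lemma flag_complex_clique:
  assumes flag: "flag_complex K" and F: "F \<subseteq> vertices K"
    and adj: "\<And>x y. x \<in> F \<Longrightarrow> y \<in> F \<Longrightarrow> x \<noteq> y \<Longrightarrow> {x, y} \<in> K"
  shows "F \<in> K"
proof (rule ccontr)
  assume "F \<notin> K"
  have "finite K" "\<And>F. F \<in> K \<Longrightarrow> finite F"
    using flag unfolding flag_complex_def simplicial_complex_def by blast+
  then have "finite (vertices K)" unfolding vertices_def by (rule finite_Union)
  then have finF: "finite F" by (rule finite_subset[OF F])
  have "\<exists>G. (G \<subseteq> F \<and> G \<notin> K) \<and> (\<forall>H. H \<subseteq> F \<and> H \<notin> K \<longrightarrow> card G \<le> card H)"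
    by (rule ex_has_least_nat[of _ F]) (use \<open>F \<notin> K\<close> in simp)
  then obtain G where G: "G \<subseteq> F" "G \<notin> K" and min: "\<And>H. H \<subseteq> F \<Longrightarrow> H \<notin> K \<Longrightarrow> card G \<le> card H" by blast
  have finG: "finite G" by (rule finite_subset[OF G(1) finF])
  have "minimal_nonface K G" unfolding minimal_nonface_def
  proof (intro conjI allI impI)
    show "G \<subseteq> vertices K" using G F by blast
    fix H assume "H \<subset> G"
    then have "card H < card G" "H \<subseteq> F" using psubset_card_mono[OF finG, of H] G(1) by auto
    then show "H \<in> K" using min[of H] by linarith
  qed (fact G)
  then have "card G = 2" using flag by (simp add: flag_complex_def)
  then obtain x y where xy: "G = {x, y}" "x \<noteq> y" by (auto simp: card_2_iff)
  then show False using adj[of x y] G by blast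
qed

context simplicial_3manifold
begin

lemma triangle_cofaces:
  assumes T: "{x, y, z} \<in> K" "card {x, y, z} = 3"
  obtains p q where "p \<noteq> q" "p \<notin> {x, y, z}" "q \<notin> {x, y, z}"
    "insert p {x, y, z} \<in> K" "insert q {x, y, z} \<in> K"
    "\<And>F. F \<in> K \<Longrightarrow> {x, y, z} \<subseteq> F \<Longrightarrow> F \<subseteq> insert p {x, y, z} \<or> F \<subseteq> insert q {x, y, z}"
proof -
  have le: "card {x, y, z} \<le> 3" using T(2) by simp
  obtain p where p: "p \<notin> {x, y, z}" "insert p {x, y, z} \<in> K"
    using two_cofaces[OF T(1) insert_not_empty le] by blast
  obtain q where q: "q \<noteq> p" "q \<notin> {x, y, z}" "insert q {x, y, z} \<in> K"
    using two_cofaces[OF T(1) insert_not_empty le, of p] by blast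
  show thesis by (rule that[OF q(1)[symmetric] p(1) q(2) p(2) q(3)])
      (rule coface_of_triangle[OF T q(1)[symmetric] p(1) q(2) p(2) q(3)])
qed

text \<open>A larger face would contain a triangle and so lie in one of the two tetrahedra on
  it.\<close>

lemma card_face_le_4:
  assumes F: "F \<in> K"
  shows "card F \<le> 4"
proof (rule ccontr)
  assume c: "\<not> card F \<le> 4"
  then obtain T where T: "T \<subseteq> F" "card T = 3" using obtain_subset_with_card_n[of 3 F] by auto
  then obtain x y z where xyz: "T = {x, y, z}" by (auto simp: card_3_iff)
  have "{x, y, z} \<in> K" "card {x, y, z} = 3" using face_subset[OF F T(1)] T(2) xyz by auto
  then obtain p q where "F \<subseteq> insert p {x, y, z} \<or> F \<subseteq> insert q {x, y, z}"
    by (rule triangle_cofaces) (use F T(1) xyz in blast)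
  moreover have "card (insert a {x, y, z}) \<le> 4" for a by (auto simp: card_insert_if)
  moreover have "finite (insert a {x, y, z})" for a by simp
  ultimately show False using c by (meson card_mono le_trans)
qed

lemma flag_3manifold_graph:
  assumes flag: "flag_complex K"
  shows "flag_3manifold_graph (vertices K) (\<lambda>x y. x \<noteq> y \<and> {x, y} \<in> K)"
proof
  have clique: "F \<in> K" if "F \<subseteq> vertices K" "\<And>x y. x \<in> F \<Longrightarrow> y \<in> F \<Longrightarrow> x \<noteq> y \<Longrightarrow> {x, y} \<in> K" for F
    by (rule flag_complex_clique[OF flag that])
  have inV: "a \<in> vertices K" if "{a, b} \<in> K" for a b using that by (auto simp: vertices_def)
  have com: "{b, a} \<in> K" if "{a, b} \<in> K" for a b using that by (simp add: insert_commute)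
  have sing: "{a} \<in> K" if "a \<in> vertices K" for a using that face_subset by (auto simp: vertices_def)
  have clique3: "{a, b, c} \<in> K" if "{a, b} \<in> K" "{a, c} \<in> K" "{b, c} \<in> K" for a b c
    by (rule clique) (use that inV com sing in auto)
  have clique4: "{a, b, c, d} \<in> K"
    if "{a, b} \<in> K" "{a, c} \<in> K" "{a, d} \<in> K" "{b, c} \<in> K" "{b, d} \<in> K" "{c, d} \<in> K" for a b c d
    by (rule clique) (use that inV com sing in auto)
  show "finite (vertices K)" by (rule finite_vertices)
  show "y \<noteq> x \<and> {y, x} \<in> K" if "x \<noteq> y \<and> {x, y} \<in> K" for x y using that com by auto
  show "\<not> (x \<noteq> x \<and> {x, x} \<in> K)" for x by simp
  show "x \<in> vertices K" if "x \<noteq> y \<and> {x, y} \<in> K" for x y using that inV by blast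
  show "\<exists>y. x \<noteq> y \<and> {x, y} \<in> K" if x: "x \<in> vertices K" for x
    using two_cofaces[OF sing[OF x] insert_not_empty, of x] by (auto simp: insert_commute)
  show "\<exists>z. (x \<noteq> z \<and> {x, z} \<in> K) \<and> y \<noteq> z \<and> {y, z} \<in> K" if xy: "x \<noteq> y \<and> {x, y} \<in> K" for x y
  proof -
    have "card {x, y} \<le> 3" by (simp add: card_insert_if)
    then obtain z where z: "z \<notin> {x, y}" "insert z {x, y} \<in> K"
      using two_cofaces[of "{x, y}" x] xy by auto
    have "{x, z} \<in> K" "{y, z} \<in> K" by (rule face_subset[OF z(2)]; blast)+
    then show ?thesis using z(1) by (intro exI[of _ z]) auto
  qed
  show "\<exists>p q. p \<noteq> q \<and> \<not> (p \<noteq> q \<and> {p, q} \<in> K) \<and>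
      {w. (x \<noteq> w \<and> {x, w} \<in> K) \<and> (y \<noteq> w \<and> {y, w} \<in> K) \<and> z \<noteq> w \<and> {z, w} \<in> K} = {p, q}"
    if xy: "x \<noteq> y \<and> {x, y} \<in> K" and yz: "y \<noteq> z \<and> {y, z} \<in> K" and xz: "x \<noteq> z \<and> {x, z} \<in> K" for x y z
  proof -
    have T: "{x, y, z} \<in> K" "card {x, y, z} = 3" using clique3 xy yz xz by auto
    obtain p q where pq: "p \<noteq> q" "p \<notin> {x, y, z}" "q \<notin> {x, y, z}"
      "insert p {x, y, z} \<in> K" "insert q {x, y, z} \<in> K"
      "\<And>F. F \<in> K \<Longrightarrow> {x, y, z} \<subseteq> F \<Longrightarrow> F \<subseteq> insert p {x, y, z} \<or> F \<subseteq> insert q {x, y, z}"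
      by (rule triangle_cofaces[OF T]) (rule that)
    have e: "{a, p} \<in> K" "{a, q} \<in> K" if "a \<in> {x, y, z}" for a
      by (rule face_subset[OF pq(4)]; use that in blast) (rule face_subset[OF pq(5)]; use that in blast)
    \<comment> \<open>If \<open>p\<close> and \<open>q\<close> were adjacent, flagness would make
      the five vertices a face, which fits into neither tetrahedron on the triangle.\<close>
    have "{p, q} \<notin> K"
    proof
      assume pqK: "{p, q} \<in> K"
      have "{p, q, x, y, z} \<in> K"
      proof (rule clique)
        show "{p, q, x, y, z} \<subseteq> vertices K"
          using face_in_vertices[OF pq(4)] face_in_vertices[OF pq(5)] by blast
        fix a b assume "a \<in> {p, q, x, y, z}" "b \<in> {p, q, x, y, z}" "a \<noteq> b"
        then show "{a, b} \<in> K"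
          using pqK com[OF pqK] e[of x] e[of y] e[of z] xy yz xz by (auto simp: insert_commute)
      qed
      then have "{p, q, x, y, z} \<subseteq> insert p {x, y, z} \<or> {p, q, x, y, z} \<subseteq> insert q {x, y, z}"
        by (rule pq(6)) blast
      then show False using pq(1-3) by blast
    qed
    moreover have "{w. (x \<noteq> w \<and> {x, w} \<in> K) \<and> (y \<noteq> w \<and> {y, w} \<in> K) \<and> z \<noteq> w \<and> {z, w} \<in> K} = {p, q}"
    proof (intro equalityI subsetI)
      fix w assume w: "w \<in> {w. (x \<noteq> w \<and> {x, w} \<in> K) \<and> (y \<noteq> w \<and> {y, w} \<in> K) \<and> z \<noteq> w \<and> {z, w} \<in> K}"
      then have "{x, y, z, w} \<in> K" using xy yz xz by (intro clique4) auto
      then have "{x, y, z, w} \<subseteq> insert p {x, y, z} \<or> {x, y, z, w} \<subseteq> insert q {x, y, z}"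
        by (rule pq(6)) blast
      then show "w \<in> {p, q}" using w by auto
    next
      fix w assume "w \<in> {p, q}"
      then show "w \<in> {w. (x \<noteq> w \<and> {x, w} \<in> K) \<and> (y \<noteq> w \<and> {y, w} \<in> K) \<and> z \<noteq> w \<and> {z, w} \<in> K}"
        using e[of x] e[of y] e[of z] pq(2,3) by auto
    qed
    ultimately show ?thesis using pq(1) by blast
  qed
  show "A = {x. u \<noteq> x \<and> {u, x} \<in> K}"
    if u: "u \<in> vertices K" and A: "A \<subseteq> {x. u \<noteq> x \<and> {u, x} \<in> K}" "A \<noteq> {}"
      and closed: "\<And>a b. a \<in> A \<Longrightarrow> u \<noteq> b \<and> {u, b} \<in> K \<Longrightarrow> a \<noteq> b \<and> {a, b} \<in> K \<Longrightarrow> b \<in> A" for u A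
  proof (intro equalityI subsetI)
    fix b assume b: "b \<in> {x. u \<noteq> x \<and> {u, x} \<in> K}"
    show "b \<in> A"
    proof (rule vertex_link_connected[OF sing[OF u]])
      show "a \<noteq> u \<and> {a, u} \<in> K" if "a \<in> A" for a using that A(1) com by auto
      show "d \<in> A" if "a \<in> A" "d \<noteq> u" "{a, d, u} \<in> K" for a d
      proof (cases "a = d")
        case False
        have "{u, d} \<in> K" "{a, d} \<in> K" by (rule face_subset[OF that(3)]; blast)+
        then show ?thesis using closed[OF that(1), of d] that(2) False by auto
      qed (use that in simp)
    qed (use b A com in auto)
  qed (use A in blast)
  show "A = {x. (u \<noteq> x \<and> {u, x} \<in> K) \<and> v \<noteq> x \<and> {v, x} \<in> K}"
    if uv: "u \<noteq> v \<and> {u, v} \<in> K"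
      and A: "A \<subseteq> {x. (u \<noteq> x \<and> {u, x} \<in> K) \<and> v \<noteq> x \<and> {v, x} \<in> K}" "A \<noteq> {}"
      and closed: "\<And>a b. a \<in> A \<Longrightarrow> u \<noteq> b \<and> {u, b} \<in> K \<Longrightarrow> v \<noteq> b \<and> {v, b} \<in> K \<Longrightarrow>
        a \<noteq> b \<and> {a, b} \<in> K \<Longrightarrow> b \<in> A" for u v A
  proof (intro equalityI subsetI)
    fix b assume b: "b \<in> {x. (u \<noteq> x \<and> {u, x} \<in> K) \<and> v \<noteq> x \<and> {v, x} \<in> K}"
    show "b \<in> A"
    proof (rule edge_link_connected)
      show "{u, v} \<in> K" "u \<noteq> v" using uv by auto
      show "a \<notin> {u, v} \<and> {a, u, v} \<in> K" if "a \<in> A" for a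
        using that A(1) uv com by (auto intro!: clique3)
      show "d \<in> A" if "a \<in> A" "d \<notin> {u, v}" "{a, d, u, v} \<in> K" for a d
      proof (cases "a = d")
        case False
        have "{u, d} \<in> K" "{v, d} \<in> K" "{a, d} \<in> K" by (rule face_subset[OF that(3)]; blast)+
        then show ?thesis using closed[OF that(1), of d] that(2) False by auto
      qed (use that in simp)
      show "b \<notin> {u, v}" using b by auto
      show "{b, u, v} \<in> K" using b uv com by (auto intro!: clique3)
    qed (fact A)
  qed (use A in blast)
  show "\<exists>h. (\<forall>a. h a = 1 \<or> h a = -1) \<and>
      (\<forall>a b. u \<noteq> a \<and> {u, a} \<in> K \<longrightarrow> u \<noteq> b \<and> {u, b} \<in> K \<longrightarrow> a \<noteq> b \<and> {a, b} \<in> K \<longrightarrow> \<kappa> a b = h a * h b)"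
    if u: "u \<in> vertices K" and sign: "\<And>a b. \<kappa> a b = 1 \<or> \<kappa> a b = (-1::real)"
      and cocycle: "\<And>a b c. u \<noteq> a \<and> {u, a} \<in> K \<Longrightarrow> u \<noteq> b \<and> {u, b} \<in> K \<Longrightarrow> u \<noteq> c \<and> {u, c} \<in> K \<Longrightarrow>
        a = b \<or> a \<noteq> b \<and> {a, b} \<in> K \<Longrightarrow> b = c \<or> b \<noteq> c \<and> {b, c} \<in> K \<Longrightarrow> a = c \<or> a \<noteq> c \<and> {a, c} \<in> K \<Longrightarrow>
        \<kappa> a b * \<kappa> b c = \<kappa> a c" for u \<kappa>
  proof -
    \<comment> \<open>The link of a vertex is the case of equal end points in
      \<open>sign_cocycle_link\<close>.\<close>
    have uu: "{u, u} \<in> K" using sing[OF u] by simp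
    have coc: "\<kappa> a b * \<kappa> b c = \<kappa> a c" if f: "{a, b, c} \<union> {u, u} \<in> K" and n: "\<not> {u, u} \<subseteq> {a, b, c}" for a b c
    proof (rule cocycle)
      have "{u, a} \<in> K" "{u, b} \<in> K" "{u, c} \<in> K" "{a, b} \<in> K" "{b, c} \<in> K" "{a, c} \<in> K"
        by (rule face_subset[OF f]; blast)+
      then show "u \<noteq> a \<and> {u, a} \<in> K" "u \<noteq> b \<and> {u, b} \<in> K" "u \<noteq> c \<and> {u, c} \<in> K"
        "a = b \<or> a \<noteq> b \<and> {a, b} \<in> K" "b = c \<or> b \<noteq> c \<and> {b, c} \<in> K" "a = c \<or> a \<noteq> c \<and> {a, c} \<in> K"
        using n by auto
    qed
    obtain h where h: "\<And>a. h a = 1 \<or> h a = (-1::real)"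
      "\<And>a b. {a, b} \<union> {u, u} \<in> K \<Longrightarrow> \<not> {u, u} \<subseteq> {a, b} \<Longrightarrow> \<kappa> a b = h a * h b"
    proof (rule sign_cocycle_link[OF uu, where \<kappa> = \<kappa>])
      show "\<kappa> a b = 1 \<or> \<kappa> a b = -1" for a b by (rule sign)
      show "\<kappa> a b * \<kappa> b c = \<kappa> a c" if "{a, b, c} \<union> {u, u} \<in> K" "\<not> {u, u} \<subseteq> {a, b, c}" for a b c
        by (rule coc[OF that])
    qed (rule that)
    have "\<kappa> a b = h a * h b" if "u \<noteq> a \<and> {u, a} \<in> K" "u \<noteq> b \<and> {u, b} \<in> K" "a \<noteq> b \<and> {a, b} \<in> K" for a b
    proof (rule h(2))
      have "{u, a, b} \<in> K" using that by (intro clique3) auto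
      moreover have "{a, b} \<union> {u, u} = {u, a, b}" by blast
      ultimately show "{a, b} \<union> {u, u} \<in> K" by simp
      show "\<not> {u, u} \<subseteq> {a, b}" using that by auto
    qed
    then show ?thesis using h(1) by (intro exI[of _ h]) blast
  qed
qed

end

lemma join_of_cycles_isomorphic:
  assumes f: "bij_betw f {..<k} A" and g: "bij_betw g {..<l} B" and AB: "A \<inter> B = {}"
    and K: "vertices K = A \<union> B"
    and J: "vertices (simplicial_join (cycle_complex k) (cycle_complex l)) = {..<k} <+> {..<l}"
    and faces: "\<And>F G. F \<subseteq> {..<k} \<Longrightarrow> G \<subseteq> {..<l} \<Longrightarrow>
      f ` F \<union> g ` G \<in> K \<longleftrightarrow> F \<in> cycle_complex k \<and> G \<in> cycle_complex l"
  shows "simplicial_isomorphic K (simplicial_join (cycle_complex k) (cycle_complex l))"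
proof -
  define D where "D = {..<k} <+> {..<l}"
  define \<psi> where "\<psi> = case_sum f g"
  have \<psi>_Plus: "\<psi> ` (F <+> G) = f ` F \<union> g ` G" for F G by (force simp: \<psi>_def image_iff)
  have im: "\<psi> ` D = A \<union> B" unfolding D_def \<psi>_Plus using f g by (simp add: bij_betw_def)
  have inj: "inj_on \<psi> D"
  proof (rule inj_onI)
    fix x y assume xy: "x \<in> D" "y \<in> D" "\<psi> x = \<psi> y"
    have fA: "f i \<in> A" if "i < k" for i using bij_betwE[OF f] that by simp
    have gB: "g i \<in> B" if "i < l" for i using bij_betwE[OF g] that by simp
    have "inj_on f {..<k}" "inj_on g {..<l}" using f g by (auto simp: bij_betw_def)
    then show "x = y"
      using xy fA gB AB by (cases x; cases y) (auto simp: D_def \<psi>_def inj_on_def; fastforce)+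
  qed
  define \<phi> where "\<phi> = inv_into D \<psi>"
  have bij: "bij_betw \<phi> (A \<union> B) D"
    unfolding \<phi>_def by (rule bij_betw_inv_into) (use inj im in \<open>simp add: bij_betw_def\<close>)
  have "(\<lambda>F. \<phi> ` F) ` K = simplicial_join (cycle_complex k) (cycle_complex l)"
  proof (intro equalityI subsetI)
    fix H assume "H \<in> (\<lambda>F. \<phi> ` F) ` K"
    then obtain F where F: "F \<in> K" "H = \<phi> ` F" by blast
    have sub: "F \<subseteq> A \<union> B" using F(1) K by (auto simp: vertices_def)
    have HD: "H \<subseteq> D" using bij sub unfolding F(2) bij_betw_def by blast
    have \<psi>H: "\<psi> ` H = F" unfolding F(2) \<phi>_def by (rule image_inv_into_cancel[OF im sub])
    have H: "H = (Inl -` H) <+> (Inr -` H)"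
    proof (intro equalityI subsetI)
      fix x assume "x \<in> H"
      then show "x \<in> (Inl -` H) <+> (Inr -` H)" by (cases x) auto
    qed auto
    have "f ` (Inl -` H) \<union> g ` (Inr -` H) = F" using \<psi>H \<psi>_Plus H by metis
    moreover have "Inl -` H \<subseteq> {..<k}" "Inr -` H \<subseteq> {..<l}" using HD by (auto simp: D_def)
    ultimately have "Inl -` H \<in> cycle_complex k \<and> Inr -` H \<in> cycle_complex l"
      using faces F(1) by metis
    then show "H \<in> simplicial_join (cycle_complex k) (cycle_complex l)"
      unfolding simplicial_join_def using H by blast
  next
    fix H assume "H \<in> simplicial_join (cycle_complex k) (cycle_complex l)"
    then obtain F G where FG: "H = F <+> G" "F \<in> cycle_complex k" "G \<in> cycle_complex l"
      by (auto simp: simplicial_join_def)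
    note sub = cycle_complex_subset[OF FG(2)] cycle_complex_subset[OF FG(3)]
    have "\<psi> ` H \<in> K" unfolding FG(1) \<psi>_Plus using faces[OF sub] FG(2,3) by blast
    moreover have "H \<subseteq> D" unfolding FG(1) D_def using sub by blast
    then have "\<phi> ` \<psi> ` H = H" unfolding \<phi>_def by (rule inv_into_image_cancel[OF inj])
    ultimately show "H \<in> (\<lambda>F. \<phi> ` F) ` K" by (metis image_eqI)
  qed
  then show ?thesis using bij unfolding simplicial_isomorphic_def K J D_def by blast
qed

lemma face_number_eq: "face_number K (int m - 1) = card {F \<in> K. card F = m}"
  by (simp add: face_number_def)

lemma face_number_eq_0: "i < -1 \<Longrightarrow> face_number K i = 0"
  by (auto simp: face_number_def intro!: arg_cong[of _ "{}" card, simplified])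

text \<open>The 1 is the loss from unequal halves when n is odd; it is the slack allowed in
  \<open>extremal_two_neighbours\<close>.\<close>

lemma four_mult_halves:
  fixes n :: nat
  shows "n\<^sup>2 \<le> 4 * (n div 2 * (n - n div 2)) + 1"
proof (cases "even n")
  case True
  then obtain m where "n = 2 * m" by blast
  then show ?thesis by (simp add: power2_eq_square)
next
  case False
  then obtain m where "n = 2 * m + 1" by (blast elim: oddE)
  then show ?thesis by (simp add: power2_eq_square algebra_simps)
qed

context flag_3manifold_graph
begin

lemma exists_4_clique:
  assumes "V \<noteq> {}"
  obtains \<sigma> where "\<sigma> \<in> cliques 4"
proof -
  obtain x where "x \<in> V" using assms by blast
  then obtain y where y: "adj x y" using vertex_nb by blast
  obtain z where z: "adj x z" "adj y z" using edge_nb[OF y] by blast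
  obtain p q where "{w. adj x w \<and> adj y w \<and> adj z w} = {p, q}" using triangle_nb[OF y z(2,1)] by blast
  then have w: "adj x p" "adj y p" "adj z p" by blast+
  have d: "x \<noteq> y" "x \<noteq> z" "x \<noteq> p" "y \<noteq> z" "y \<noteq> p" "z \<noteq> p" using y z w adj_neq by blast+
  have "{x, y, z, p} \<in> cliques 4" using y z w d adj_V adj_V' adj_sym by (auto simp: cliques_def)
  then show thesis by (rule that)
qed

text \<open>The eight vertices that see three vertices of some tetrahedron are already there. This
  guarantees that the cycles in \<open>J2 n\<close> are not degenerate.\<close>

lemma card_V_ge_8:
  assumes "V \<noteq> {}"
  shows "8 \<le> card V"
proof -
  obtain \<sigma> where "\<sigma> \<in> cliques 4" by (rule exists_4_clique[OF assms])
  then have "card {w \<in> V. card (nb w \<inter> \<sigma>) = 3} = 8" by (rule card_adjacent_to_3)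
  then show ?thesis using card_mono[OF finite_V, of "{w \<in> V. card (nb w \<inter> \<sigma>) = 3}"] by simp
qed

end

theorem theorem3p4:
  fixes \<Delta> :: "'a set set" and n :: nat
  assumes "flag_complex \<Delta>"
    and "simplicial_manifold 3 \<Delta>"
    and "card (vertices \<Delta>) = n"
  shows "(\<forall>i::int. face_number \<Delta> i \<le> face_number (J2 n) i) \<and>
    ((\<exists>i::int. 1 \<le> i \<and> i \<le> 3 \<and> face_number \<Delta> i = face_number (J2 n) i) \<longrightarrow>
      simplicial_isomorphic \<Delta> (J2 n))"
proof -
  interpret M: simplicial_3manifold \<Delta>
    using assms(2) by unfold_locales (simp_all add: simplicial_manifold_def geometric_realization_eq)
  interpret G: flag_3manifold_graph "vertices \<Delta>" "\<lambda>x y. x \<noteq> y \<and> {x, y} \<in> \<Delta>"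
    by (rule M.flag_3manifold_graph[OF assms(1)])
  have face_iff: "F \<in> \<Delta> \<longleftrightarrow> F \<subseteq> vertices \<Delta> \<and> (\<forall>x\<in>F. \<forall>y\<in>F. x \<noteq> y \<longrightarrow> x \<noteq> y \<and> {x, y} \<in> \<Delta>)" for F
  proof
    assume F: "F \<in> \<Delta>"
    have "{x, y} \<in> \<Delta>" if "x \<in> F" "y \<in> F" for x y by (rule M.face_subset[OF F]) (use that in blast)
    then show "F \<subseteq> vertices \<Delta> \<and> (\<forall>x\<in>F. \<forall>y\<in>F. x \<noteq> y \<longrightarrow> x \<noteq> y \<and> {x, y} \<in> \<Delta>)"
      using M.face_in_vertices[OF F] by blast
  next
    assume F: "F \<subseteq> vertices \<Delta> \<and> (\<forall>x\<in>F. \<forall>y\<in>F. x \<noteq> y \<longrightarrow> x \<noteq> y \<and> {x, y} \<in> \<Delta>)"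
    show "F \<in> \<Delta>"
    proof (rule flag_complex_clique[OF assms(1)])
      show "F \<subseteq> vertices \<Delta>" using F by (rule conjunct1)
      show "{x, y} \<in> \<Delta>" if "x \<in> F" "y \<in> F" "x \<noteq> y" for x y using conjunct2[OF F] that by simp
    qed
  qed
  have cliques_eq: "{F \<in> \<Delta>. card F = m} = G.cliques m" for m
  proof (rule set_eqI)
    fix F
    show "F \<in> {F \<in> \<Delta>. card F = m} \<longleftrightarrow> F \<in> G.cliques m"
      unfolding G.cliques_def mem_Collect_eq face_iff[of F] by (simp only: conj_ac)
  qed
  show ?thesis
  \<comment> \<open>The complex whose only face is the empty set realizes the empty manifold and has
    to be treated separately; \<open>J2 0\<close> is the same complex in another type.\<close>
  proof (cases "vertices \<Delta> = {}")
    case True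
    then have "\<Delta> \<subseteq> {{}}" by (auto simp: vertices_def)
    moreover have "\<Delta> \<noteq> {}" using M.sc by (simp add: simplicial_complex_def)
    ultimately have D: "\<Delta> = {{}}" by blast
    have "n = 0" using assms(3) True by simp
    then have J: "J2 n = {{}}" by (auto simp: J2_eq simplicial_join_def cycle_complex_def)
    show ?thesis unfolding J D
      by (simp add: face_number_def simplicial_isomorphic_def vertices_def bij_betw_def Collect_conj_eq cong: conj_cong)
  next
    case False
    define k where "k = n div 2"
    define l where "l = n - n div 2"
    have n8: "8 \<le> n" using G.card_V_ge_8[OF False] assms(3) by simp
    have kln: "k + l = n" by (simp add: k_def l_def)
    define P where "P = k * l"
    have nP: "n\<^sup>2 \<le> 4 * P + 1" using four_mult_halves[of n] by (simp add: P_def k_def l_def)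
    have J: "card {H \<in> J2 n. card H = 0} = 1" "card {H \<in> J2 n. card H = 1} = n"
      "card {H \<in> J2 n. card H = 2} = n + P" "card {H \<in> J2 n. card H = 3} = 2 * P"
      "card {H \<in> J2 n. card H = 4} = P"
      using card_J2_faces[of n] n8 by (simp_all add: P_def k_def l_def)
    have c3: "card (G.cliques 3) + 2 * n = 2 * card (G.cliques 2)"
      using G.card_cliques_3 assms(3) by simp
    have c4: "card (G.cliques 4) + n = card (G.cliques 2)" using G.card_cliques_4 assms(3) by simp
    have c2: "card (G.cliques 2) \<le> n + P"
    proof -
      have "4 * card (G.cliques 2) \<le> n\<^sup>2 + 4 * n" using G.card_edges_le assms(3) by simp
      also have "\<dots> \<le> (4 * P + 1) + 4 * n" using nP by (rule add_right_mono)
      finally have "4 * card (G.cliques 2) \<le> 4 * P + 1 + 4 * n" .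
      \<comment> \<open>The slack of 1 disappears because all other terms are divisible by
        4.\<close>
      moreover have "a \<le> n + P" if "4 * a \<le> 4 * P + 1 + 4 * n" for a :: nat using that by presburger
      ultimately show ?thesis by blast
    qed
    have le: "card {F \<in> \<Delta>. card F = m} \<le> card {H \<in> J2 n. card H = m}" for m
    proof -
      consider "m = 0" | "m = 1" | "m = 2" | "m = 3" | "m = 4" | "m > 4" by linarith
      then show ?thesis
      proof cases
        case 1
        have "{F \<in> \<Delta>. card F = 0} \<subseteq> {{}}" using M.finite_face by auto
        then have "card {F \<in> \<Delta>. card F = 0} \<le> 1" using card_mono[of "{{}}" "{F \<in> \<Delta>. card F = 0}"] by simp
        then show ?thesis using 1 J(1) by simp
      next
        case 2
        have "{F \<in> \<Delta>. card F = 1} \<subseteq> (\<lambda>x. {x}) ` vertices \<Delta>"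
          by (auto simp: card_1_singleton_iff vertices_def)
        then have "card {F \<in> \<Delta>. card F = 1} \<le> card ((\<lambda>x. {x}) ` vertices \<Delta>)"
          using M.finite_vertices by (intro card_mono) auto
        also have "\<dots> \<le> n" using card_image_le[OF M.finite_vertices] assms(3) by blast
        finally show ?thesis using 2 J(2) by simp
      next
        case 3
        then show ?thesis using c2 J(3) unfolding cliques_eq by simp
      next
        case 4
        then show ?thesis using c2 c3 J(4) unfolding cliques_eq by simp
      next
        case 5
        then show ?thesis using c2 c4 J(5) unfolding cliques_eq by simp
      next
        case 6
        then have "{F \<in> \<Delta>. card F = m} = {}" using M.card_face_le_4 by force
        then show ?thesis by (simp only: card.empty le0)
      qed
    qed
    have ineq: "face_number \<Delta> i \<le> face_number (J2 n) i" for i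
    proof (cases "i < -1")
      case True
      then show ?thesis by (simp add: face_number_eq_0)
    next
      case False
      then have "i = int (nat (i + 1)) - 1" by simp
      then show ?thesis using le[of "nat (i + 1)"] face_number_eq by metis
    qed
    moreover have "simplicial_isomorphic \<Delta> (J2 n)"
      if i: "1 \<le> i" "i \<le> 3" and eq: "face_number \<Delta> i = face_number (J2 n) i" for i
    proof -
      \<comment> \<open>The numbers of triangles and tetrahedra are determined by the number of
        edges, so equality in any of the three dimensions gives equality for edges.\<close>
      have "i = int 2 - 1 \<or> i = int 3 - 1 \<or> i = int 4 - 1" using i by auto
      then have "card (G.cliques 2) = n + P"
        using eq c3 c4 J(3-5) by (elim disjE) (simp_all only: face_number_eq cliques_eq)
      then have ext: "(card (vertices \<Delta>))\<^sup>2 + 4 * card (vertices \<Delta>) \<le> 4 * card (G.cliques 2) + 1"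
        using nP assms(3) by simp
      interpret E: extremal_graph "vertices \<Delta>" "\<lambda>x y. x \<noteq> y \<and> {x, y} \<in> \<Delta>"
        by unfold_locales (rule G.extremal_two_neighbours[OF ext])
      obtain A B f g where AB: "vertices \<Delta> = A \<union> B" "A \<inter> B = {}"
        "card (G.cliques 2) = card (vertices \<Delta>) + card A * card B"
        and f: "bij_betw f {..<card A} A" and g: "bij_betw g {..<card B} B"
        and fg: "\<And>F G. F \<subseteq> {..<card A} \<Longrightarrow> G \<subseteq> {..<card B} \<Longrightarrow>
          (\<forall>x\<in>f ` F \<union> g ` G. \<forall>y\<in>f ` F \<union> g ` G. x \<noteq> y \<longrightarrow> x \<noteq> y \<and> {x, y} \<in> \<Delta>) \<longleftrightarrow>
          F \<in> cycle_complex (card A) \<and> G \<in> cycle_complex (card B)"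
        by (rule E.join_of_link_cycles[OF False]) (rule that)
      have faces: "f ` F \<union> g ` G \<in> \<Delta> \<longleftrightarrow> F \<in> cycle_complex (card A) \<and> G \<in> cycle_complex (card B)"
        if FG: "F \<subseteq> {..<card A}" "G \<subseteq> {..<card B}" for F G
      proof -
        have "f ` F \<union> g ` G \<subseteq> vertices \<Delta>"
          unfolding AB(1) using FG bij_betwE[OF f] bij_betwE[OF g] by blast
        then show ?thesis unfolding face_iff[of "f ` F \<union> g ` G"] fg[OF FG, symmetric] by (simp only: simp_thms)
      qed
      have J2: "J2 n = simplicial_join (cycle_complex k) (cycle_complex l)" "vertices (J2 n) = {..<k} <+> {..<l}"
        using J2_eq[of n] vertices_J2[of n] n8 by (simp_all add: k_def l_def)
      have ab: "card A + card B = n"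
        using assms(3) card_Un_disjoint[OF _ _ AB(2)] M.finite_vertices by (simp add: AB(1))
      have "int (card A) * int (card B) = int k * int l"
        using AB(3) assms(3) \<open>card (G.cliques 2) = n + P\<close> by (simp add: P_def flip: of_nat_mult)
      moreover have "int (card B) = int k + int l - int (card A)" using ab kln by linarith
      ultimately have "(int (card A) - int k) * (int (card A) - int l) = 0" by (simp add: algebra_simps)
      then have "card A = k \<and> card B = l \<or> card A = l \<and> card B = k" using ab kln by auto
      then show ?thesis
      proof
        assume c: "card A = k \<and> card B = l"
        show ?thesis unfolding J2(1)
          by (rule join_of_cycles_isomorphic[of f k A g l B]) (use c f g AB faces J2 in simp_all)
      next
        \<comment> \<open>Here the cycle \<open>A\<close> is the longer half, so the two cycles are
          exchanged to match the order of the join in \<open>J2 n\<close>.\<close>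
        assume c: "card A = l \<and> card B = k"
        show ?thesis unfolding J2(1) by (rule join_of_cycles_isomorphic[of g k B f l A])
            (use c f g AB faces J2 in \<open>simp_all add: Un_commute Int_commute conj_commute\<close>)
      qed
    qed
    ultimately show ?thesis by blast
  qed
qed

end
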